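(* Let $t>0$, $\alpha>0$, let $d\ge1$ be an integer, $m\in\{0,1\}$, $n\ge1$ an integer, $v_0=\frac n2$, $v_1=n+1$, and suppose $v_m>\frac d2-1$. Then $$P\left\{X_m(R^d(G_\alpha(t)))\in dx\,|\,N(t)=n\right\}=\frac{dx}{\Gamma(\alpha)B\left(\frac d2,v_m-\frac d2+1\right)}\int_0^1w^{\frac d2-1}(1-w)^{v_m-\frac d2}\,\frac{\sqrt{2t}}{\sqrt{\pi w}\,c}\left(\frac{\sqrt{t}\,|x|}{c\sqrt{2w}}\right)^{\alpha-\frac12}K_{-\alpha+\frac12}\left(\frac{\sqrt{2t}\,|x|}{c\sqrt{w}}\right)dw.$$
   Context: Fix $c>0$, $\lambda>0$. For $m\in\{0,1\}$ let $X_m(s)=c\sum_{j=1}^{N(s)+1}(s_j-s_{j-1})\cos\theta_j$, where $N$ is a homogeneous Poisson process of rate $\lambda$ with event times $s_1<s_2<\cdots$, $s_0=0$, $s_{N(s)+1}=s$, and the $\theta_j$ are i.i.d. (independent of $N$) with density $\frac{\Gamma(m+1)}{\sqrt\pi\,\Gamma(m+\frac12)}\sin^{2m}\theta$ on $(0,\pi)$. For $n\ge1$ let $p_n^m(x,s)$ be the density of $X_m(s)$ given $N(s)=n$; explicitly $p_n^m(x,s)=\frac{\Gamma(v_m)\Gamma(v_m+1)}{2\pi\Gamma(2v_m)}\left(\frac{2}{cs}\right)^{2v_m}(c^2s^2-x^2)^{v_m-\frac12}$ for $|x|<cs$ and $0$ otherwise. $R^d(t)=\sqrt{\sum_{i=1}^dB_i^2(t)}$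 ($B_i$ independent standard Brownian motions) is the Bessel process started at zero, with density $\frac{1}{\Gamma(d/2)}\frac{r^{d-1}}{2^{d/2-1}t^{d/2}}e^{-r^2/(2t)}$, $r>0$; $G_\alpha(t)$ has Gamma density $\frac{t^\alpha}{\Gamma(\alpha)}s^{\alpha-1}e^{-ts}$, $s>0$. $R^d$ and $G_\alpha$ are independent of each other and of $X_m$ and $N$, so $R^d(G_\alpha(t))$ has density $\frac{t^\alpha}{\Gamma(\alpha)\Gamma(\frac d2)2^{\frac d2-1}}\int_0^\infty\frac{r^{d-1}}{z^{d/2}}e^{-\frac{r^2}{2z}}z^{\alpha-1}e^{-tz}dz$, $r>0$. For an independent positive random time $T$, the conditional law $P\{X_m(T)\in dx\,|\,N(t)=n\}$ means the law of $X_m$ at time $T$ when the number of Poisson events up to that time is fixed to be $n$, i.e. $dx\int_0^\infty p_n^m(x,s)\,P\{T\in ds\}$. $B(a,b)=\Gamma(a)\Gamma(b)/\Gamma(a+b)$ is the Beta function, and $K_\mu(x)=\frac12\left(\frac x2\right)^\mu\int_0^\infty e^{-z-\frac{x^2}{4z}}z^{-\mu-1}dz$ ($x>0$) is the modified Bessel function of the second kind. Equalities of laws are equalities of Lebesgue densities (a.e. $x\in\mathbb{R}$). *)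

theory Defs
  imports "HOL-Probability.Probability"
begin

definition generated_events :: "'a measure \<Rightarrow> ('a \<Rightarrow> real) set \<Rightarrow> 'a set set" where
  "generated_events M Y =
     sigma_sets (space M) {f -` A \<inter> space M | f A. f \<in> Y \<and> A \<in> sets borel}"

text \<open>
  A homogeneous Poisson process is given by its event times \<open>S 1 < S 2 < \<dots>\<close> (with \<open>S 0 = 0\<close>),
  whose successive differences are independent and exponentially distributed.  The counting
  function is the number of events in \<open>(0, s]\<close>; on the null set where infinitely many events
  occur before \<open>s\<close>, \<^const>\<open>card\<close> returns \<open>0\<close>, which does not affect any law.
\<close>

definition poisson_event_times :: "'a measure \<Rightarrow> real \<Rightarrow> (nat \<Rightarrow> 'a \<Rightarrow> real) \<Rightarrow> bool" where
  "poisson_event_times M rate S \<longleftrightarrow>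
     (\<forall>\<omega>\<in>space M. S 0 \<omega> = 0) \<and>
     prob_space.indep_vars M (\<lambda>_. borel) (\<lambda>k \<omega>. S (Suc k) \<omega> - S k \<omega>) UNIV \<and>
     (\<forall>k. distributed M lborel (\<lambda>\<omega>. S (Suc k) \<omega> - S k \<omega>)
            (\<lambda>x. ennreal (exponential_density rate x)))"

definition event_count :: "(nat \<Rightarrow> 'a \<Rightarrow> real) \<Rightarrow> real \<Rightarrow> 'a \<Rightarrow> nat" where
  "event_count S s \<omega> = card {k. 1 \<le> k \<and> S k \<omega> \<le> s}"

definition angle_density :: "nat \<Rightarrow> real \<Rightarrow> real" where
  "angle_density m x =
     (if 0 < x \<and> x < pi
      then Gamma (real m + 1) / (sqrt pi * Gamma (real m + 1 / 2)) * sin x ^ (2 * m)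
      else 0)"

definition iid_angles :: "'a measure \<Rightarrow> nat \<Rightarrow> (nat \<Rightarrow> 'a \<Rightarrow> real) \<Rightarrow> bool" where
  "iid_angles M m \<theta> \<longleftrightarrow>
     prob_space.indep_vars M (\<lambda>_. borel) \<theta> {1..} \<and>
     (\<forall>j\<ge>1. distributed M lborel (\<theta> j) (\<lambda>x. ennreal (angle_density m x)))"

text \<open>\<open>switch_time S s \<omega> j\<close> is \<open>s\<^sub>j\<close>, with the convention that the index \<open>N(s) + 1\<close> denotes \<open>s\<close>.\<close>

definition switch_time :: "(nat \<Rightarrow> 'a \<Rightarrow> real) \<Rightarrow> real \<Rightarrow> 'a \<Rightarrow> nat \<Rightarrow> real" where
  "switch_time S s \<omega> j = (if j \<le> event_count S s \<omega> then S j \<omega> else s)"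

definition random_flight ::
  "real \<Rightarrow> (nat \<Rightarrow> 'a \<Rightarrow> real) \<Rightarrow> (nat \<Rightarrow> 'a \<Rightarrow> real) \<Rightarrow> real \<Rightarrow> 'a \<Rightarrow> real" where
  "random_flight c S \<theta> s \<omega> =
     c * (\<Sum>j = 1..event_count S s \<omega> + 1.
            (switch_time S s \<omega> j - switch_time S s \<omega> (j - 1)) * cos (\<theta> j \<omega>))"

text \<open>
  Paths are continuous everywhere (not merely almost surely), so that evaluating the process at a
  random time gives a random variable without completing the probability space.
\<close>

definition brownian_motion :: "'a measure \<Rightarrow> (real \<Rightarrow> 'a \<Rightarrow> real) \<Rightarrow> bool" where
  "brownian_motion M W \<longleftrightarrow>
     (\<forall>s\<ge>0. W s \<in> borel_measurable M) \<and>
     (AE \<omega> in M. W 0 \<omega> = 0) \<and>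
     (\<forall>\<omega>\<in>space M. continuous_on {0..} (\<lambda>s. W s \<omega>)) \<and>
     (\<forall>r s. 0 \<le> r \<longrightarrow> r < s \<longrightarrow>
        distributed M lborel (\<lambda>\<omega>. W s \<omega> - W r \<omega>)
          (\<lambda>x. ennreal (normal_density 0 (sqrt (s - r)) x))) \<and>
     (\<forall>k (\<tau> :: nat \<Rightarrow> real). 0 \<le> \<tau> 0 \<longrightarrow> mono \<tau> \<longrightarrow>
        prob_space.indep_vars M (\<lambda>_. borel) (\<lambda>i \<omega>. W (\<tau> (Suc i)) \<omega> - W (\<tau> i) \<omega>) {..<k})"

definition independent_brownian_motions ::
  "'a measure \<Rightarrow> nat \<Rightarrow> (nat \<Rightarrow> real \<Rightarrow> 'a \<Rightarrow> real) \<Rightarrow> bool" where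
  "independent_brownian_motions M d B \<longleftrightarrow>
     (\<forall>i\<in>{1..d}. brownian_motion M (B i)) \<and>
     prob_space.indep_sets M (\<lambda>i. generated_events M {B i s | s. 0 \<le> s}) {1..d}"

text \<open>
  The Bessel process is set to \<open>0\<close> at negative times, so that it can be evaluated at a random time
  that is positive only almost surely.
\<close>

definition bessel_process ::
  "nat \<Rightarrow> (nat \<Rightarrow> real \<Rightarrow> 'a \<Rightarrow> real) \<Rightarrow> real \<Rightarrow> 'a \<Rightarrow> real" where
  "bessel_process d B s \<omega> = (if 0 \<le> s then sqrt (\<Sum>i = 1..d. (B i s \<omega>)\<^sup>2) else 0)"

text \<open>Shape \<open>\<alpha>\<close> and rate \<open>t\<close>.\<close>

definition gamma_density :: "real \<Rightarrow> real \<Rightarrow> real \<Rightarrow> real" where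
  "gamma_density \<alpha> t s =
     (if 0 < s then t powr \<alpha> / Gamma \<alpha> * s powr (\<alpha> - 1) * exp (- t * s) else 0)"

definition cond_law_given_count ::
  "'a measure \<Rightarrow> (real \<Rightarrow> 'a \<Rightarrow> real) \<Rightarrow> (real \<Rightarrow> 'a \<Rightarrow> nat) \<Rightarrow> nat \<Rightarrow> real \<Rightarrow> real measure" where
  "cond_law_given_count M X N n s =
     distr (uniform_measure M {\<omega> \<in> space M. N s \<omega> = n}) borel (X s)"

text \<open>
  The law of \<open>X\<close> at the random time \<open>T\<close> when the number of events up to that time is fixed to be
  \<open>n\<close>: the mixture of the conditional laws of \<open>X s\<close> given \<open>N s = n\<close> over the law of \<open>T\<close>.  This is not
  the conditional law of \<open>X T\<close> given the event \<open>N T = n\<close>, which would reweight the law of \<open>T\<close>.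
\<close>

definition fixed_count_law ::
  "'a measure \<Rightarrow> (real \<Rightarrow> 'a \<Rightarrow> real) \<Rightarrow> (real \<Rightarrow> 'a \<Rightarrow> nat) \<Rightarrow> nat \<Rightarrow> ('a \<Rightarrow> real) \<Rightarrow> real measure"
  where
  "fixed_count_law M X N n T =
     Giry_Monad.bind (distr M borel T) (cond_law_given_count M X N n)"

definition bessel_K :: "real \<Rightarrow> real \<Rightarrow> real" where
  "bessel_K \<mu> x =
     1 / 2 * (x / 2) powr \<mu> * (LBINT z:{0<..}. exp (- z - x\<^sup>2 / (4 * z)) * z powr (- \<mu> - 1))"

definition flight_order :: "nat \<Rightarrow> nat \<Rightarrow> real" where
  "flight_order m n = (if m = 0 then real n / 2 else real n + 1)"

end

theory Submission
  imports Defs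
begin

text \<open>
  Given \<open>N(s) = n\<close>, the position \<open>X\<^sub>m(s)\<close> has the law of \<open>c s Y\<close> with \<open>Y\<close> of density
  proportional to \<open>(1 - y\<^sup>2) powr (v - 1/2)\<close>. By induction over the epochs this reduces to the
  statement that \<open>Q Y' + (1 - Q) cos \<theta>\<close> has the law for \<open>n\<close> when \<open>Q\<close> is Beta\<open>(n, 1)\<close> and \<open>Y'\<close>
  has the law for \<open>n - 1\<close>. All laws live on \<open>[-1, 1]\<close>, so it suffices to compare moments, and there
  the claim is \<open>f ^ (n + 1) = f ^ n * f\<close> for the generating function \<open>f\<close> of the moments of
  \<open>cos \<theta>\<close>, which is \<open>(1 - u\<^sup>2)\<close> to the power \<open>-1/2\<close> for \<open>m = 0\<close> and the Catalan series at
  \<open>u\<^sup>2 / 4\<close> for \<open>m = 1\<close>.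

  Given \<open>G = z\<close>, the square of \<open>R\<close> is gamma distributed with shape \<open>d/2\<close>, and \<open>Y\<^sup>2\<close> is
  Beta\<open>(1/2, v + 1/2)\<close>. Splitting the gamma variable as a gamma variable of shape \<open>v + 1\<close> times an
  independent Beta\<open>(d/2, v - d/2 + 1)\<close> variable \<open>w\<close>, and absorbing \<open>Y\<^sup>2\<close> into the former, leaves
  \<open>w\<close> times the square of a normal variable of variance \<open>z\<close>. Hence \<open>X\<close> is a mixture over \<open>w\<close>
  and \<open>z\<close> of centred normal laws with variance \<open>c\<^sup>2 w z\<close>; integrating out \<open>z\<close> gives the Bessel
  function.
\<close>

text \<open>The recursion survives in continuous time because an exponential step is a gamma
  variable of shape 1. The same Beta(n, 1) share therefore arises twice: as the fraction of an event
  time that precedes its last step (\<open>walk_law\<close>), and as the fraction of the fixed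
  horizon s that precedes the unfinished epoch, where the exponential tail cancels against the gamma
  density (\<open>gamma_exponential_tail\<close>). One identity, \<open>sym_beta_step\<close>,
  serves both. The generating function appears only after the k-th moment is multiplied by
  \<open>(n + k) choose k\<close>. This weight absorbs the moments of the share and turns the
  recursion into a Cauchy product; the two values of m are those whose powers of f are given closed
  coefficients. The condition on v and d makes v - d/2 + 1 a legitimate beta parameter. Laws are
  compared through nonnegative integrals of test functions, so that Tonelli applies without
  integrability conditions. At x = 0 the mixture can be infinite whereas the final formula is a real
  number, so the densities are matched almost everywhere.\<close>

section \<open>Gamma and beta laws\<close>

text \<open>The coordinates s = r + u and q = r / s, with Jacobian s, are reached by affine
  substitutions in one variable on either side of a Tonelli swap: a shift in u for fixed r, then a
  scaling in r for fixed s.\<close>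

lemma nn_integral_quadrant_substitution:
  fixes f :: "real \<Rightarrow> real \<Rightarrow> ennreal"
  assumes [measurable]: "(\<lambda>(r, u). f r u) \<in> borel_measurable (borel \<Otimes>\<^sub>M borel)"
  shows "(\<integral>\<^sup>+r. \<integral>\<^sup>+u. f r u * indicator {0<..} r * indicator {0<..} u \<partial>lborel \<partial>lborel) =
    (\<integral>\<^sup>+s. \<integral>\<^sup>+q. f (s * q) (s * (1 - q)) * ennreal s * indicator {0<..} s * indicator {0<..<1} q
       \<partial>lborel \<partial>lborel)"
proof -
  let ?F = "\<lambda>r u. f r u * indicator {0<..} r * indicator {0<..} u :: ennreal"
  have "(\<integral>\<^sup>+r. \<integral>\<^sup>+u. ?F r u \<partial>lborel \<partial>lborel) = (\<integral>\<^sup>+r. \<integral>\<^sup>+s. ?F r (s - r) \<partial>lborel \<partial>lborel)"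
  proof (rule nn_integral_cong)
    fix r :: real
    show "(\<integral>\<^sup>+u. ?F r u \<partial>lborel) = (\<integral>\<^sup>+s. ?F r (s - r) \<partial>lborel)"
      by (subst nn_integral_real_affine[where c = 1 and t = "- r"]) (simp_all add: algebra_simps)
  qed
  also have "\<dots> = (\<integral>\<^sup>+s. \<integral>\<^sup>+r. ?F r (s - r) \<partial>lborel \<partial>lborel)"
    by (rule lborel_pair.Fubini') measurable
  also have "\<dots> = (\<integral>\<^sup>+s. \<integral>\<^sup>+q. f (s * q) (s * (1 - q)) * ennreal s * indicator {0<..} s *
      indicator {0<..<1} q \<partial>lborel \<partial>lborel)"
  proof (rule nn_integral_cong)
    fix s :: real
    show "(\<integral>\<^sup>+r. ?F r (s - r) \<partial>lborel) = (\<integral>\<^sup>+q. f (s * q) (s * (1 - q)) * ennreal s *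
        indicator {0<..} s * indicator {0<..<1} q \<partial>lborel)"
    proof (cases "0 < s")
      case True
      have "(\<integral>\<^sup>+r. ?F r (s - r) \<partial>lborel) = ennreal s * (\<integral>\<^sup>+q. ?F (s * q) (s - s * q) \<partial>lborel)"
        using True by (subst nn_integral_real_affine[where c = s and t = 0]) simp_all
      also have "\<dots> = (\<integral>\<^sup>+q. ennreal s * ?F (s * q) (s - s * q) \<partial>lborel)"
        by (rule nn_integral_cmult[symmetric]) simp
      also have "\<dots> = (\<integral>\<^sup>+q. f (s * q) (s * (1 - q)) * ennreal s *
        indicator {0<..} s * indicator {0<..<1} q \<partial>lborel)"
        using True by (intro nn_integral_cong)
          (auto simp: indicator_def algebra_simps zero_less_mult_iff)
      finally show ?thesis .
    next
      case False
      then have "(\<integral>\<^sup>+r. ?F r (s - r) \<partial>lborel) = (\<integral>\<^sup>+r. 0 \<partial>(lborel :: real measure))"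
        by (intro nn_integral_cong) (auto simp: indicator_def)
      with False show ?thesis by simp
    qed
  qed
  finally show ?thesis .
qed

text \<open>The substitution rule is applied on compact intervals, from [0, k] to [0, k^2], and
  monotone convergence exhausts the half-line. The endpoint 0 is a null set.\<close>

lemma nn_integral_square_substitution:
  fixes f :: "real \<Rightarrow> ennreal"
  assumes [measurable]: "f \<in> borel_measurable borel"
  shows "(\<integral>\<^sup>+u. f u * indicator {0<..} u \<partial>lborel) =
    (\<integral>\<^sup>+y. f (y\<^sup>2) * ennreal (2 * y) * indicator {0<..} y \<partial>lborel)"
proof -
  let ?a = "\<lambda>n. {(0::real)..real n}" and ?b = "\<lambda>n. {(0::real)..(real n)\<^sup>2}"
  have sup: "(SUP n. g y * indicator (A n) y) = g y * indicator (\<Union>n. A n) y"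
    for g :: "real \<Rightarrow> ennreal" and A :: "nat \<Rightarrow> real set" and y
  proof (rule antisym)
    show "(SUP n. g y * indicator (A n) y) \<le> g y * indicator (\<Union>n. A n) y"
      by (rule SUP_least) (auto simp: indicator_def)
    show "g y * indicator (\<Union>n. A n) y \<le> (SUP n. g y * indicator (A n) y)"
    proof (cases "y \<in> (\<Union>n. A n)")
      case True
      then obtain n where "y \<in> A n" by blast
      then show ?thesis by (intro SUP_upper2[of n]) (auto simp: indicator_def)
    qed simp
  qed
  have ia: "incseq ?a" and ib: "incseq ?b"
    by (auto simp: incseq_def power2_eq_square intro: order_trans mult_mono)
  have Ua: "(\<Union>n. ?a n) = {0..}" by (auto intro: real_arch_simple)
  have Ub: "(\<Union>n. ?b n) = {0..}"
  proof safe
    fix x :: real assume "0 \<le> x"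
    obtain n :: nat where "x + 1 \<le> real n" using real_arch_simple by blast
    then have "x \<le> real n * 1" "1 \<le> real n" using \<open>0 \<le> x\<close> by auto
    then have "x \<le> (real n)\<^sup>2" unfolding power2_eq_square
      by (meson mult_left_mono of_nat_0_le_iff order_trans)
    with \<open>0 \<le> x\<close> show "x \<in> (\<Union>n. ?b n)" by auto
  qed auto
  have mono: "incseq (\<lambda>n y. g y * indicator (A n) y)" if "incseq A" for g :: "real \<Rightarrow> ennreal" and A
    using that by (auto simp: incseq_def le_fun_def indicator_def subset_eq)
  have "(\<integral>\<^sup>+u. f u * indicator {0<..} u \<partial>lborel) = (\<integral>\<^sup>+u. f u * indicator {0..} u \<partial>lborel)"
    by (intro nn_integral_cong_AE AE_I[where N = "{0}"]) (auto simp: indicator_def)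
  also have "\<dots> = (\<integral>\<^sup>+u. (SUP n. f u * indicator (?b n) u) \<partial>lborel)"
    by (simp only: sup[where g = f and A = ?b] Ub)
  also have "\<dots> = (SUP n. \<integral>\<^sup>+u. f u * indicator (?b n) u \<partial>lborel)"
    by (intro nn_integral_monotone_convergence_SUP mono ib) measurable
  also have "\<dots> = (SUP n. \<integral>\<^sup>+y. f (y\<^sup>2) * ennreal (2 * y) * indicator (?a n) y \<partial>lborel)"
  proof (intro SUP_cong refl)
    fix n :: nat
    show "(\<integral>\<^sup>+u. f u * indicator (?b n) u \<partial>lborel) =
      (\<integral>\<^sup>+y. f (y\<^sup>2) * ennreal (2 * y) * indicator (?a n) y \<partial>lborel)"
    \<comment> \<open>For n = 0 the interval degenerates to a point, and the substitution rule asks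
      for distinct endpoints.\<close>
    proof (cases "n = 0")
      case True
      then show ?thesis
        by (intro nn_integral_cong_AE AE_I[where N = "{0}"]) (auto simp: indicator_def)
    next
      case False
      have "((\<lambda>y. y\<^sup>2) has_real_derivative 2 * x) (at x)" for x :: real
        by (auto intro!: derivative_eq_intros)
      with False show ?thesis
        using nn_integral_substitution_aux[of f 0 "real n" "\<lambda>y. y\<^sup>2" "\<lambda>y. 2 * y"]
        by (auto intro!: continuous_intros)
    qed
  qed
  also have "\<dots> = (\<integral>\<^sup>+y. (SUP n. f (y\<^sup>2) * ennreal (2 * y) * indicator (?a n) y) \<partial>lborel)"
    by (intro nn_integral_monotone_convergence_SUP[symmetric] mono ia) measurable
  also have "\<dots> = (\<integral>\<^sup>+y. f (y\<^sup>2) * ennreal (2 * y) * indicator {0..} y \<partial>lborel)"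
    by (simp only: sup[where g = "\<lambda>y. f (y\<^sup>2) * ennreal (2 * y)" and A = ?a] Ua)
  also have "\<dots> = (\<integral>\<^sup>+y. f (y\<^sup>2) * ennreal (2 * y) * indicator {0<..} y \<partial>lborel)"
    by (intro nn_integral_cong) (auto simp: indicator_def)
  finally show ?thesis .
qed

section \<open>Gamma and beta laws as measures, and their multiplicative algebra\<close>

definition gamma_measure :: "real \<Rightarrow> real \<Rightarrow> real measure" where
  "gamma_measure a t = density lborel (\<lambda>s. ennreal (gamma_density a t s))"

definition beta_density :: "real \<Rightarrow> real \<Rightarrow> real \<Rightarrow> real" where
  "beta_density a b q =
     (if 0 < q \<and> q < 1 then q powr (a - 1) * (1 - q) powr (b - 1) / Beta a b else 0)"

definition beta_measure :: "real \<Rightarrow> real \<Rightarrow> real measure" where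
  "beta_measure a b = density lborel (\<lambda>q. ennreal (beta_density a b q))"

lemma gamma_density_measurable [measurable]: "gamma_density a t \<in> borel_measurable borel"
  unfolding gamma_density_def[abs_def] by measurable

lemma beta_density_measurable [measurable]: "beta_density a b \<in> borel_measurable borel"
  unfolding beta_density_def[abs_def] by measurable

lemma sets_gamma_measure [simp, measurable_cong]: "sets (gamma_measure a t) = sets borel"
  and space_gamma_measure [simp]: "space (gamma_measure a t) = UNIV"
  by (simp_all add: gamma_measure_def)

lemma sets_beta_measure [simp, measurable_cong]: "sets (beta_measure a b) = sets borel"
  and space_beta_measure [simp]: "space (beta_measure a b) = UNIV"
  by (simp_all add: beta_measure_def)

lemma Beta_pos: "0 < a \<Longrightarrow> 0 < b \<Longrightarrow> 0 < Beta a (b :: real)"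
  by (simp add: Beta_def)

lemma beta_density_nonneg: "0 < a \<Longrightarrow> 0 < b \<Longrightarrow> 0 \<le> beta_density a b q"
  by (simp add: beta_density_def Beta_pos less_imp_le)

lemma gamma_density_nonneg: "0 < a \<Longrightarrow> 0 \<le> gamma_density a t q"
  by (simp add: gamma_density_def)

lemma nn_integral_gamma_measure:
  "f \<in> borel_measurable borel \<Longrightarrow>
    (\<integral>\<^sup>+s. f s \<partial>gamma_measure a t) = (\<integral>\<^sup>+s. ennreal (gamma_density a t s) * f s \<partial>lborel)"
  unfolding gamma_measure_def by (subst nn_integral_density) auto

lemma nn_integral_beta_measure:
  "f \<in> borel_measurable borel \<Longrightarrow>
    (\<integral>\<^sup>+q. f q \<partial>beta_measure a b) = (\<integral>\<^sup>+q. ennreal (beta_density a b q) * f q \<partial>lborel)"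
  unfolding beta_measure_def by (subst nn_integral_density) auto

lemma prob_space_gamma_measure:
  assumes "0 < a" "0 < t"
  shows "prob_space (gamma_measure a t)"
proof
  have "ennreal (Gamma a) = (\<integral>\<^sup>+s. ennreal (indicator {0..} s * s powr (a - 1) / exp s) \<partial>lborel)"
    by (rule Gamma_conv_nn_integral_real[OF assms(1)])
  also have "\<dots> = ennreal t *
      (\<integral>\<^sup>+s. ennreal (indicator {0..} (t * s) * (t * s) powr (a - 1) / exp (t * s)) \<partial>lborel)"
    using assms by (subst nn_integral_real_affine[where c = t and t = 0]) simp_all
  also have "\<dots> = (\<integral>\<^sup>+s. ennreal t *
      ennreal (indicator {0..} (t * s) * (t * s) powr (a - 1) / exp (t * s)) \<partial>lborel)"
    by (rule nn_integral_cmult[symmetric]) simp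
  also have "\<dots> = (\<integral>\<^sup>+s. ennreal (Gamma a) * ennreal (gamma_density a t s) \<partial>lborel)"
  proof (intro nn_integral_cong_AE AE_I[where N = "{0}"])
    have "ennreal t * ennreal (indicator {0..} (t * s) * (t * s) powr (a - 1) / exp (t * s)) =
      ennreal (Gamma a) * ennreal (gamma_density a t s)" if "s \<noteq> 0" for s
      using assms that Gamma_real_pos[OF assms(1), THEN less_imp_neq]
      by (auto simp: indicator_def gamma_density_def powr_mult zero_le_mult_iff exp_minus field_simps
          powr_diff simp flip: ennreal_mult')
    then show "{s \<in> space lborel. ennreal t * ennreal (indicator {0..} (t * s) * (t * s) powr (a - 1) / exp (t * s)) \<noteq>
      ennreal (Gamma a) * ennreal (gamma_density a t s)} \<subseteq> {0}" by blast
  qed auto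
  also have "\<dots> = ennreal (Gamma a) * (\<integral>\<^sup>+s. ennreal (gamma_density a t s) \<partial>lborel)"
    by (rule nn_integral_cmult) simp
  finally have "ennreal (Gamma a) * 1 = ennreal (Gamma a) * (\<integral>\<^sup>+s. ennreal (gamma_density a t s) \<partial>lborel)"
    by simp
  then have "(\<integral>\<^sup>+s. ennreal (gamma_density a t s) \<partial>lborel) = 1"
    using Gamma_real_pos[OF assms(1)] by (subst (asm) ennreal_mult_cancel_left) auto
  then show "emeasure (gamma_measure a t) (space (gamma_measure a t)) = 1"
    by (simp add: gamma_measure_def emeasure_density)
qed

lemma sigma_finite_gamma_measure: "0 < a \<Longrightarrow> 0 < t \<Longrightarrow> sigma_finite_measure (gamma_measure a t)"
  using prob_space_gamma_measure by (simp add: prob_space_imp_sigma_finite)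

text \<open>With a common rate the exponentials multiply to a function of the sum s alone, and the
  powers, together with the Jacobian s, separate into a factor in s and a factor in q. So the sum
  and the share q are independent. Both corollaries below and the induction of
  \<open>walk_law\<close> rest on this.\<close>

lemma gamma_beta_factorization:
  assumes pos: "0 < a" "0 < b" "0 < t"
    and F[measurable]: "(\<lambda>(r, u). F r u) \<in> borel_measurable (borel \<Otimes>\<^sub>M borel)"
  shows "(\<integral>\<^sup>+r. \<integral>\<^sup>+u. F r u \<partial>gamma_measure b t \<partial>gamma_measure a t) =
    (\<integral>\<^sup>+s. \<integral>\<^sup>+q. F (s * q) (s * (1 - q)) \<partial>beta_measure a b \<partial>gamma_measure (a + b) t)"
proof -
  interpret B: sigma_finite_measure "gamma_measure b t" using pos by (simp add: sigma_finite_gamma_measure)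
  let ?f = "\<lambda>r u. ennreal (gamma_density a t r) * (ennreal (gamma_density b t u) * F r u)"
  have "(\<integral>\<^sup>+r. \<integral>\<^sup>+u. F r u \<partial>gamma_measure b t \<partial>gamma_measure a t) =
    (\<integral>\<^sup>+r. \<integral>\<^sup>+u. ?f r u \<partial>lborel \<partial>lborel)"
    by (subst nn_integral_gamma_measure) (simp_all add: nn_integral_gamma_measure nn_integral_cmult)
  also have "\<dots> = (\<integral>\<^sup>+r. \<integral>\<^sup>+u. ?f r u * indicator {0<..} r * indicator {0<..} u \<partial>lborel \<partial>lborel)"
    by (intro nn_integral_cong) (auto simp: indicator_def gamma_density_def)
  also have "\<dots> = (\<integral>\<^sup>+s. \<integral>\<^sup>+q. ?f (s * q) (s * (1 - q)) * ennreal s * indicator {0<..} s *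
      indicator {0<..<1} q \<partial>lborel \<partial>lborel)"
    by (rule nn_integral_quadrant_substitution) measurable
  also have "\<dots> = (\<integral>\<^sup>+s. \<integral>\<^sup>+q. ennreal (gamma_density (a + b) t s) *
      (ennreal (beta_density a b q) * F (s * q) (s * (1 - q))) \<partial>lborel \<partial>lborel)"
  proof (intro nn_integral_cong)
    fix s q :: real
    show "?f (s * q) (s * (1 - q)) * ennreal s * indicator {0<..} s * indicator {0<..<1} q =
      ennreal (gamma_density (a + b) t s) * (ennreal (beta_density a b q) * F (s * q) (s * (1 - q)))"
    proof (cases "0 < s \<and> 0 < q \<and> q < 1")
      case True
      have "gamma_density a t (s * q) * gamma_density b t (s * (1 - q)) * s =
          gamma_density (a + b) t s * beta_density a b q"
      proof -
        have "exp (- t * (s * q)) * exp (- t * (s * (1 - q))) = exp (- t * s)"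
          by (simp add: algebra_simps flip: exp_add)
        \<comment> \<open>The lone factor s is the Jacobian; it raises the exponent of s from a + b
          - 2 to a + b - 1.\<close>
        moreover have "(s * q) powr (a - 1) * (s * (1 - q)) powr (b - 1) * s =
            s powr (a + b - 1) * (q powr (a - 1) * (1 - q) powr (b - 1))"
        proof -
          have "s powr (a + b - 1) = s powr ((a - 1) + (b - 1) + 1)" by (simp add: algebra_simps)
          also have "\<dots> = s powr (a - 1) * s powr (b - 1) * s" using True by (simp only: powr_add) simp
          finally show ?thesis using True by (simp add: powr_mult)
        qed
        moreover have "Gamma (a + b) \<noteq> 0" using Gamma_real_pos[of "a + b"] pos by (metis add_pos_pos less_irrefl)
        ultimately have "(t powr a * t powr b) / (Gamma a * Gamma b) *
            ((s * q) powr (a - 1) * (s * (1 - q)) powr (b - 1) * s) *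
            (exp (- t * (s * q)) * exp (- t * (s * (1 - q)))) =
          t powr (a + b) / Gamma (a + b) * s powr (a + b - 1) * exp (- t * s) *
            (q powr (a - 1) * (1 - q) powr (b - 1) / Beta a b)"
          by (simp add: Beta_def powr_add)
        moreover have "0 < s * q" "0 < s * (1 - q)" using True by simp_all
        ultimately show ?thesis
          using True by (simp add: gamma_density_def beta_density_def ac_simps)
      qed
      then have "ennreal (gamma_density a t (s * q)) * ennreal (gamma_density b t (s * (1 - q))) * ennreal s =
          ennreal (gamma_density (a + b) t s) * ennreal (beta_density a b q)"
        using True pos
        by (simp add: gamma_density_nonneg beta_density_nonneg flip: ennreal_mult)
      moreover have "?f (s * q) (s * (1 - q)) * ennreal s =
          (ennreal (gamma_density a t (s * q)) * ennreal (gamma_density b t (s * (1 - q))) * ennreal s) *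
          F (s * q) (s * (1 - q))"
        by (simp only: ac_simps)
      ultimately show ?thesis
        using True by (simp add: mult.assoc)
    qed (auto simp: indicator_def gamma_density_def beta_density_def)
  qed
  also have "\<dots> = (\<integral>\<^sup>+s. \<integral>\<^sup>+q. F (s * q) (s * (1 - q)) \<partial>beta_measure a b \<partial>gamma_measure (a + b) t)"
  proof -
    have "(\<lambda>s. \<integral>\<^sup>+q. ennreal (beta_density a b q) * F (s * q) (s * (1 - q)) \<partial>lborel) \<in> borel_measurable borel"
      by measurable
    then show ?thesis
      by (simp add: nn_integral_beta_measure nn_integral_gamma_measure nn_integral_cmult)
  qed
  finally show ?thesis .
qed

text \<open>Taking F = 1 in the factorisation compares total masses: three of the four laws are
  gamma laws of mass 1, which forces mass 1 on the beta law.\<close>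

lemma prob_space_beta_measure:
  assumes "0 < a" "0 < b"
  shows "prob_space (beta_measure a b)"
proof
  interpret A: prob_space "gamma_measure a 1" using assms by (simp add: prob_space_gamma_measure)
  interpret B: prob_space "gamma_measure b 1" using assms by (simp add: prob_space_gamma_measure)
  interpret C: prob_space "gamma_measure (a + b) 1" using assms by (simp add: prob_space_gamma_measure)
  show "emeasure (beta_measure a b) (space (beta_measure a b)) = 1"
    using gamma_beta_factorization[of a b 1 "\<lambda>_ _. 1"] assms
      A.emeasure_space_1 B.emeasure_space_1 C.emeasure_space_1 by simp
qed

corollary gamma_add:
  assumes "0 < a" "0 < b" "0 < t" and [measurable]: "g \<in> borel_measurable borel"
  shows "(\<integral>\<^sup>+r. \<integral>\<^sup>+u. g (r + u) \<partial>gamma_measure b t \<partial>gamma_measure a t) =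
    (\<integral>\<^sup>+s. g s \<partial>gamma_measure (a + b) t)"
proof -
  interpret prob_space "beta_measure a b" using assms by (simp add: prob_space_beta_measure)
  show ?thesis
    using assms emeasure_space_1
    by (subst gamma_beta_factorization) (simp_all add: algebra_simps)
qed

corollary gamma_mult_beta:
  assumes "0 < a" "0 < b" "0 < t" and [measurable]: "g \<in> borel_measurable borel"
  shows "(\<integral>\<^sup>+s. \<integral>\<^sup>+q. g (s * q) \<partial>beta_measure a b \<partial>gamma_measure (a + b) t) =
    (\<integral>\<^sup>+r. g r \<partial>gamma_measure a t)"
proof -
  interpret prob_space "gamma_measure b t" using assms by (simp add: prob_space_gamma_measure)
  show ?thesis
    using assms emeasure_space_1
    by (subst gamma_beta_factorization[where F = "\<lambda>r _. g r", symmetric]) simp_all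
qed

section \<open>The symmetric beta law\<close>

lemma ennreal_half_double: "ennreal (1 / 2) * (x + x) = x"
proof -
  have "ennreal (1 / 2) * (x + x) = (ennreal (1 / 2) * ennreal 2) * x"
    by (simp add: ac_simps flip: mult_2)
  also have "ennreal (1 / 2) * ennreal 2 = 1" by (subst ennreal_mult[symmetric]) simp_all
  finally show ?thesis by simp
qed

text \<open>An even law is that of a square root with an independent fair sign. In the hypothesis
  \<open>square\<close> the Jacobian 2 * y has been halved by the sign, which is why a bare y
  remains.\<close>

lemma nn_integral_even_density:
  fixes p q :: "real \<Rightarrow> real" and g :: "real \<Rightarrow> ennreal"
  assumes [measurable]: "p \<in> borel_measurable borel" "q \<in> borel_measurable borel" "g \<in> borel_measurable borel"
    and pos: "\<And>y. 0 \<le> p y" "\<And>u. 0 \<le> q u"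
    and even: "\<And>y. p (- y) = p y"
    and square: "\<And>y. 0 < y \<Longrightarrow> q (y\<^sup>2) * y = p y"
    and zero: "\<And>u. u \<le> 0 \<Longrightarrow> q u = 0"
  shows "(\<integral>\<^sup>+y. ennreal (p y) * g y \<partial>lborel) =
    (\<integral>\<^sup>+u. ennreal (q u) * (ennreal (1 / 2) * (g (sqrt u) + g (- sqrt u))) \<partial>lborel)"
proof -
  let ?f = "\<lambda>y. ennreal (p y) * g y"
  have "(\<integral>\<^sup>+y. ?f y \<partial>lborel) = (\<integral>\<^sup>+y. ?f y * indicator {0<..} y + ?f y * indicator {..<0} y \<partial>lborel)"
    by (intro nn_integral_cong_AE AE_I[where N = "{0}"]) (auto simp: indicator_def)
  also have "\<dots> = (\<integral>\<^sup>+y. ?f y * indicator {0<..} y \<partial>lborel) + (\<integral>\<^sup>+y. ?f y * indicator {..<0} y \<partial>lborel)"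
    by (rule nn_integral_add) measurable
  also have "(\<integral>\<^sup>+y. ?f y * indicator {..<0} y \<partial>lborel) =
      (\<integral>\<^sup>+y. ennreal (p y) * g (- y) * indicator {0<..} y \<partial>lborel)"
    by (subst nn_integral_real_affine[where c = "-1" and t = 0])
      (auto simp: even indicator_def intro!: nn_integral_cong)
  also have "(\<integral>\<^sup>+y. ?f y * indicator {0<..} y \<partial>lborel) + \<dots> =
      (\<integral>\<^sup>+y. ?f y * indicator {0<..} y + ennreal (p y) * g (- y) * indicator {0<..} y \<partial>lborel)"
    by (rule nn_integral_add[symmetric]) measurable
  also have "\<dots> = (\<integral>\<^sup>+y. ennreal (q (y\<^sup>2)) * (ennreal (1 / 2) * (g (sqrt (y\<^sup>2)) + g (- sqrt (y\<^sup>2)))) *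
      ennreal (2 * y) * indicator {0<..} y \<partial>lborel)"
  proof (intro nn_integral_cong)
    fix y :: real
    show "?f y * indicator {0<..} y + ennreal (p y) * g (- y) * indicator {0<..} y =
      ennreal (q (y\<^sup>2)) * (ennreal (1 / 2) * (g (sqrt (y\<^sup>2)) + g (- sqrt (y\<^sup>2)))) *
      ennreal (2 * y) * indicator {0<..} y"
    proof (cases "0 < y")
      case True
      have "ennreal (q (y\<^sup>2)) * (ennreal (1 / 2) * (g y + g (- y))) * ennreal (2 * y) =
        (ennreal (q (y\<^sup>2)) * ennreal (1 / 2) * ennreal (2 * y)) * (g y + g (- y))"
        by (simp only: ac_simps)
      also have "ennreal (q (y\<^sup>2)) * ennreal (1 / 2) * ennreal (2 * y) = ennreal (q (y\<^sup>2) * (1 / 2) * (2 * y))"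
      proof -
        have n: "0 \<le> q (y\<^sup>2) * (1 / 2)" "0 \<le> 2 * y" "0 \<le> (1 / 2 :: real)" "0 \<le> q (y\<^sup>2)"
          using True pos(2) by simp_all
        show ?thesis by (simp only: ennreal_mult[OF n(1,2)] ennreal_mult[OF n(4,3)])
      qed
      also have "q (y\<^sup>2) * (1 / 2) * (2 * y) = p y" using square[OF True] by simp
      finally show ?thesis using True by (simp add: distrib_left)
    qed simp
  qed
  also have "\<dots> = (\<integral>\<^sup>+u. ennreal (q u) * (ennreal (1 / 2) * (g (sqrt u) + g (- sqrt u))) *
      indicator {0<..} u \<partial>lborel)"
    by (rule nn_integral_square_substitution[symmetric]) measurable
  also have "\<dots> = (\<integral>\<^sup>+u. ennreal (q u) * (ennreal (1 / 2) * (g (sqrt u) + g (- sqrt u))) \<partial>lborel)"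
    by (intro nn_integral_cong) (auto simp: indicator_def zero)
  finally show ?thesis .
qed

lemma nn_integral_normal_density:
  fixes g :: "real \<Rightarrow> ennreal"
  assumes [measurable]: "g \<in> borel_measurable borel" and "0 < \<sigma>"
  shows "(\<integral>\<^sup>+x. ennreal (normal_density 0 \<sigma> x) * g x \<partial>lborel) =
    (\<integral>\<^sup>+u. ennreal (1 / 2) * (g (sqrt u) + g (- sqrt u)) \<partial>gamma_measure (1 / 2) (1 / (2 * \<sigma>\<^sup>2)))"
proof -
  have "(\<integral>\<^sup>+x. ennreal (normal_density 0 \<sigma> x) * g x \<partial>lborel) =
      (\<integral>\<^sup>+u. ennreal (gamma_density (1 / 2) (1 / (2 * \<sigma>\<^sup>2)) u) *
        (ennreal (1 / 2) * (g (sqrt u) + g (- sqrt u))) \<partial>lborel)"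
  proof (rule nn_integral_even_density)
    fix y :: real assume "0 < y"
    have "(y\<^sup>2) powr (1 / 2 - 1) = 1 / y"
      using \<open>0 < y\<close> by (simp add: powr_half_sqrt powr_minus_divide flip: powr_minus)
    then show "gamma_density (1 / 2) (1 / (2 * \<sigma>\<^sup>2)) (y\<^sup>2) * y = normal_density 0 \<sigma> y"
      using \<open>0 < y\<close> \<open>0 < \<sigma>\<close>
      by (simp add: gamma_density_def normal_density_def Gamma_one_half_real powr_half_sqrt
          real_sqrt_divide real_sqrt_mult)
  qed (auto simp: gamma_density_nonneg gamma_density_def normal_density_def)
  then show ?thesis by (simp add: nn_integral_gamma_measure)
qed

text \<open>This is the conditional density of the flight rescaled to c s = 1; its constant agrees
  with the usual one by the duplication formula for Gamma. Order 0 is the arcsine law, order 1 the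
  semicircle law.\<close>

definition sym_beta_density :: "real \<Rightarrow> real \<Rightarrow> real" where
  "sym_beta_density v y =
     (if - 1 < y \<and> y < 1 then (1 - y\<^sup>2) powr (v - 1 / 2) / Beta (1 / 2) (v + 1 / 2) else 0)"

definition sym_beta_measure :: "real \<Rightarrow> real measure" where
  "sym_beta_measure v = density lborel (\<lambda>y. ennreal (sym_beta_density v y))"

lemma sym_beta_density_measurable [measurable]: "sym_beta_density v \<in> borel_measurable borel"
  unfolding sym_beta_density_def[abs_def] by measurable

lemma sets_sym_beta_measure [simp, measurable_cong]: "sets (sym_beta_measure v) = sets borel"
  and space_sym_beta_measure [simp]: "space (sym_beta_measure v) = UNIV"
  by (simp_all add: sym_beta_measure_def)

lemma sym_beta_density_nonneg: "- 1 / 2 < v \<Longrightarrow> 0 \<le> sym_beta_density v y"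
  by (simp add: sym_beta_density_def Beta_pos less_imp_le)

lemma nn_integral_sym_beta_measure:
  "f \<in> borel_measurable borel \<Longrightarrow>
    (\<integral>\<^sup>+y. f y \<partial>sym_beta_measure v) = (\<integral>\<^sup>+y. ennreal (sym_beta_density v y) * f y \<partial>lborel)"
  unfolding sym_beta_measure_def by (subst nn_integral_density) auto

text \<open>This opens a law on the interval from -1 to 1 to the beta-gamma algebra: its square is a
  beta variable and its sign a fair coin.\<close>

lemma nn_integral_sym_beta_measure':
  fixes g :: "real \<Rightarrow> ennreal"
  assumes [measurable]: "g \<in> borel_measurable borel" and v: "- 1 / 2 < v"
  shows "(\<integral>\<^sup>+y. g y \<partial>sym_beta_measure v) =
    (\<integral>\<^sup>+u. ennreal (1 / 2) * (g (sqrt u) + g (- sqrt u)) \<partial>beta_measure (1 / 2) (v + 1 / 2))"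
proof -
  have "(\<integral>\<^sup>+y. ennreal (sym_beta_density v y) * g y \<partial>lborel) =
      (\<integral>\<^sup>+u. ennreal (beta_density (1 / 2) (v + 1 / 2) u) *
        (ennreal (1 / 2) * (g (sqrt u) + g (- sqrt u))) \<partial>lborel)"
  proof (rule nn_integral_even_density)
    fix y :: real assume "0 < y"
    have "(y\<^sup>2) powr (1 / 2 - 1) = 1 / y"
      using \<open>0 < y\<close> by (simp add: powr_half_sqrt powr_minus_divide flip: powr_minus)
    moreover have "y\<^sup>2 < 1 \<longleftrightarrow> y < 1"
      using \<open>0 < y\<close> by (simp add: power_less_one_iff)
    ultimately show "beta_density (1 / 2) (v + 1 / 2) (y\<^sup>2) * y = sym_beta_density v y"
      using \<open>0 < y\<close> by (simp add: beta_density_def sym_beta_density_def)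
  qed (use v in \<open>(simp_all add: beta_density_nonneg sym_beta_density_nonneg)?,
      auto simp: beta_density_def sym_beta_density_def\<close>)
  then show ?thesis by (simp add: nn_integral_sym_beta_measure nn_integral_beta_measure)
qed

lemma prob_space_sym_beta_measure:
  assumes "- 1 / 2 < v"
  shows "prob_space (sym_beta_measure v)"
proof
  interpret prob_space "beta_measure (1 / 2) (v + 1 / 2)" using assms by (simp add: prob_space_beta_measure)
  show "emeasure (sym_beta_measure v) (space (sym_beta_measure v)) = 1"
    using nn_integral_sym_beta_measure'[of "\<lambda>_. 1" v] assms emeasure_space_1 ennreal_half_double[of 1] by simp
qed

text \<open>Multiplying a beta density by powers of q and 1 - q shifts its parameters, so the moment
  is a ratio of normalising constants.\<close>

lemma beta_moment:
  assumes "0 < a" "0 < b"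
  shows "(\<integral>\<^sup>+q. ennreal (q ^ i * (1 - q) ^ j) \<partial>beta_measure a b) =
    ennreal (Beta (a + real i) (b + real j) / Beta a b)"
proof -
  interpret prob_space "beta_measure (a + real i) (b + real j)" using assms by (simp add: prob_space_beta_measure)
  have "(\<integral>\<^sup>+q. ennreal (q ^ i * (1 - q) ^ j) \<partial>beta_measure a b) =
    (\<integral>\<^sup>+q. ennreal (Beta (a + real i) (b + real j) / Beta a b) *
       ennreal (beta_density (a + real i) (b + real j) q) \<partial>lborel)"
  proof (subst nn_integral_beta_measure, simp, intro nn_integral_cong)
    fix q :: real
    have "beta_density a b q * (q ^ i * (1 - q) ^ j) =
      Beta (a + real i) (b + real j) / Beta a b * beta_density (a + real i) (b + real j) q"
    proof (cases "0 < q \<and> q < 1")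
      case True
      have "q powr (a + real i - 1) = q powr (a - 1) * q ^ i" "(1 - q) powr (b + real j - 1) = (1 - q) powr (b - 1) * (1 - q) ^ j"
        using True by (simp_all flip: powr_realpow powr_add add: algebra_simps)
      then show ?thesis
        using True Beta_pos[OF assms] Beta_pos[of "a + real i" "b + real j"] assms
        by (simp add: beta_density_def)
    qed (auto simp: beta_density_def)
    then show "ennreal (beta_density a b q) * ennreal (q ^ i * (1 - q) ^ j) =
      ennreal (Beta (a + real i) (b + real j) / Beta a b) * ennreal (beta_density (a + real i) (b + real j) q)"
      using assms Beta_pos[OF assms] Beta_pos[of "a + real i" "b + real j"]
      by (simp add: beta_density_nonneg flip: ennreal_mult')
  qed
  also have "\<dots> = ennreal (Beta (a + real i) (b + real j) / Beta a b)"
    using emeasure_space_1 by (subst nn_integral_cmult) (simp_all add: beta_measure_def emeasure_density)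
  finally show ?thesis .
qed

lemma AE_beta_measure: "AE q in beta_measure a b. 0 < q \<and> q < 1"
  unfolding beta_measure_def by (subst AE_density) (auto simp: beta_density_def)

lemma AE_sym_beta_measure: "AE y in sym_beta_measure v. \<bar>y\<bar> \<le> 1"
  unfolding sym_beta_measure_def by (subst AE_density) (auto simp: sym_beta_density_def)

lemma real_beta_moment:
  assumes "0 < a" "0 < b"
  shows "(\<integral>q. q ^ i * (1 - q) ^ j \<partial>beta_measure a b) = Beta (a + real i) (b + real j) / Beta a b"
  using assms Beta_pos[OF assms] Beta_pos[of "a + real i" "b + real j"] AE_beta_measure[of a b]
  by (subst integral_eq_nn_integral) (auto simp: beta_moment elim: eventually_mono)

lemma Beta_add_nat:
  assumes "0 < a" "0 < (b::real)"
  shows "Beta (a + real i) b / Beta a b = pochhammer a i / pochhammer (a + b) i"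
proof -
  have "Gamma (a + real i) = Gamma a * pochhammer a i" "Gamma (a + b + real i) = Gamma (a + b) * pochhammer (a + b) i"
  proof -
    have "a \<notin> \<int>\<^sub>\<le>\<^sub>0" "a + b \<notin> \<int>\<^sub>\<le>\<^sub>0" using assms by (auto elim!: nonpos_Ints_cases)
    then show "Gamma (a + real i) = Gamma a * pochhammer a i"
      "Gamma (a + b + real i) = Gamma (a + b) * pochhammer (a + b) i"
      by (simp_all add: pochhammer_Gamma Gamma_eq_zero_iff)
  qed
  then show ?thesis
    using assms Gamma_real_pos[of a, THEN less_imp_neq] Gamma_real_pos[of b, THEN less_imp_neq]
      Gamma_real_pos[of "a + b", THEN less_imp_neq] pochhammer_pos[of "a + b" i]
    by (simp add: Beta_def field_simps)
qed

lemma sym_beta_moment_even: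
  assumes v: "- 1 / 2 < v"
  shows "(\<integral>y. y ^ (2 * i) \<partial>sym_beta_measure v) = pochhammer (1 / 2) i / pochhammer (v + 1) i"
proof -
  have "(\<integral>\<^sup>+y. ennreal (y ^ (2 * i)) \<partial>sym_beta_measure v) =
      (\<integral>\<^sup>+u. ennreal (1 / 2) * (ennreal (sqrt u ^ (2 * i)) + ennreal ((- sqrt u) ^ (2 * i))) \<partial>beta_measure (1 / 2) (v + 1 / 2))"
    using v by (subst nn_integral_sym_beta_measure') simp_all
  also have "\<dots> = (\<integral>\<^sup>+u. ennreal (u ^ i * (1 - u) ^ 0) \<partial>beta_measure (1 / 2) (v + 1 / 2))"
  proof (intro nn_integral_cong_AE, use AE_beta_measure[of "1/2" "v + 1/2"] in eventually_elim)
    fix u :: real assume "0 < u \<and> u < 1"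
    then have "sqrt u ^ (2 * i) = u ^ i * (1 - u) ^ 0" "(- sqrt u) ^ (2 * i) = u ^ i * (1 - u) ^ 0"
      by (simp_all add: power_mult)
    then show "ennreal (1 / 2) * (ennreal (sqrt u ^ (2 * i)) + ennreal ((- sqrt u) ^ (2 * i))) =
        ennreal (u ^ i * (1 - u) ^ 0)"
      by (simp only: ennreal_half_double)
  qed
  also have "\<dots> = ennreal (pochhammer (1 / 2) i / pochhammer (v + 1) i)"
    using v Beta_add_nat[of "1/2" "v + 1/2" i] by (subst beta_moment) (simp_all add: ac_simps)
  finally have nn: "(\<integral>\<^sup>+y. ennreal (y ^ (2 * i)) \<partial>sym_beta_measure v) =
    ennreal (pochhammer (1 / 2) i / pochhammer (v + 1) i)" .
  have "0 \<le> pochhammer (1 / 2) i / pochhammer (v + 1) i"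
    using v by (intro divide_nonneg_nonneg less_imp_le[OF pochhammer_pos]) auto
  with nn show ?thesis
    by (subst integral_eq_nn_integral) (auto simp: zero_le_even_power)
qed

lemma sym_beta_moment_odd:
  assumes "- 1 / 2 < v"
  shows "(\<integral>y. y ^ (Suc (2 * i)) \<partial>sym_beta_measure v) = 0"
proof -
  have even: "sym_beta_density v (- y) = sym_beta_density v y" for y
    by (auto simp: sym_beta_density_def)
  let ?f = "\<lambda>y. sym_beta_density v y * y ^ (Suc (2 * i))"
  have "(\<integral>y. y ^ (Suc (2 * i)) \<partial>sym_beta_measure v) = (\<integral>y. ?f y \<partial>lborel)"
    unfolding sym_beta_measure_def using assms by (subst integral_density) (auto simp: sym_beta_density_nonneg)
  moreover have "(\<integral>y. ?f y \<partial>lborel) = - (\<integral>y. ?f y \<partial>lborel)"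
    by (subst lborel_integral_real_affine[where c = "- 1" and t = 0])
      (simp_all add: even)
  ultimately show ?thesis by simp
qed

section \<open>Moments of the flight\<close>

text \<open>The convolution recursion makes the quadratic equation of the generating series
  immediate.\<close>

fun catalan :: "nat \<Rightarrow> real" where
  "catalan 0 = 1"
| "catalan (Suc n) = (\<Sum>i\<le>n. catalan i * catalan (n - i))"

definition catalan_fps :: "real fps" where
  "catalan_fps = Abs_fps catalan"

lemma catalan_fps_eq: "catalan_fps = 1 + fps_X * catalan_fps\<^sup>2"
proof (rule fps_ext)
  fix n
  show "fps_nth catalan_fps n = fps_nth (1 + fps_X * catalan_fps\<^sup>2) n"
  proof (cases n)
    case (Suc k)
    have "fps_nth (catalan_fps\<^sup>2) k = catalan (Suc k)"
      by (simp add: catalan_fps_def power2_eq_square fps_mult_nth atMost_atLeast0)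
    with Suc show ?thesis by (simp add: catalan_fps_def)
  qed (simp add: catalan_fps_def)
qed

text \<open>These are the ballot numbers. Multiplying the quadratic equation of the series C by C^r
  gives C^(r+1) = C^r + X C^(r+2), whose terms have either a smaller r or a smaller index; hence an
  induction on i for all r, with an induction on r inside. The factor 2 * i + r is kept on the left
  so that i = r = 0 is no exception.\<close>

lemma catalan_fps_power_nth:
  "real (2 * i + r) * fps_nth (catalan_fps ^ r) i = real r * real ((2 * i + r) choose i)"
proof (induction i arbitrary: r)
  case 0
  have "fps_nth catalan_fps 0 = 1" by (simp add: catalan_fps_def)
  then show ?case by (simp add: fps_power_zeroth)
next
  case (Suc i)
  show ?case
  proof (induction r)
    case (Suc r)
    let ?N = "2 * i + r + 2"
    have "catalan_fps ^ Suc r = catalan_fps ^ r * (1 + fps_X * catalan_fps\<^sup>2)"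
      by (subst catalan_fps_eq[symmetric]) simp
    also have "\<dots> = catalan_fps ^ r + fps_X * catalan_fps ^ (r + 2)"
      by (simp add: algebra_simps power2_eq_square)
    finally have c: "fps_nth (catalan_fps ^ Suc r) (Suc i) = fps_nth (catalan_fps ^ r) (Suc i) + fps_nth (catalan_fps ^ (r + 2)) i"
    proof -
      assume *: "catalan_fps ^ Suc r = catalan_fps ^ r + fps_X * catalan_fps ^ (r + 2)"
      have "fps_nth (fps_X * g) (Suc i) = fps_nth g i" for g :: "real fps" by simp
      then show ?thesis unfolding * by (simp only: fps_add_nth)
    qed
    have c1: "real ?N * fps_nth (catalan_fps ^ r) (Suc i) = real r * real (?N choose Suc i)"
      using Suc by (simp add: algebra_simps)
    have c2: "real ?N * fps_nth (catalan_fps ^ (r + 2)) i = real (r + 2) * real (?N choose i)"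
      using \<open>\<And>r. real (2 * i + r) * fps_nth (catalan_fps ^ r) i = real r * real ((2 * i + r) choose i)\<close>[of "r + 2"]
      by (simp only: add.assoc)
    \<comment> \<open>Both binomials of row \<open>?N\<close> are expressed by the one below them in
      Pascal's triangle, \<open>Suc ?N choose Suc i\<close>, so that the claim becomes
      polynomial.\<close>
    have b2: "real (Suc ?N) * real (?N choose i) = real (Suc i) * real (Suc ?N choose Suc i)"
      using Suc_times_binomial_eq[of ?N i] by (metis of_nat_mult mult.commute)
    have b1: "real (Suc ?N) * real (?N choose Suc i) = (real ?N - real i) * real (Suc ?N choose Suc i)"
    proof -
      have "real (Suc ?N choose Suc i) = real (?N choose i) + real (?N choose Suc i)" by simp
      then have "real (Suc ?N) * real (?N choose Suc i) =
          real (Suc ?N) * real (Suc ?N choose Suc i) - real (Suc ?N) * real (?N choose i)"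
        by (simp add: algebra_simps)
      then show ?thesis unfolding b2 by (simp add: algebra_simps)
    qed
    have "real ?N * (real (Suc ?N) * fps_nth (catalan_fps ^ Suc r) (Suc i)) =
      real r * (real (Suc ?N) * real (?N choose Suc i)) + real (r + 2) * (real (Suc ?N) * real (?N choose i))"
    proof -
      have "real ?N * (real (Suc ?N) * fps_nth (catalan_fps ^ Suc r) (Suc i)) =
          real (Suc ?N) * (real ?N * fps_nth (catalan_fps ^ r) (Suc i) + real ?N * fps_nth (catalan_fps ^ (r + 2)) i)"
        unfolding c by (simp only: distrib_left mult.left_commute)
      then show ?thesis unfolding c1 c2 by (simp only: distrib_left mult.left_commute)
    qed
    also have "\<dots> = (real r * (real ?N - real i) + real (r + 2) * real (Suc i)) * real (Suc ?N choose Suc i)"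
      unfolding b1 b2 by (simp only: distrib_right mult.assoc)
    also have "real r * (real ?N - real i) + real (r + 2) * real (Suc i) = real ?N * real (Suc r)"
      by (simp add: algebra_simps)
    finally have "real (Suc ?N) * fps_nth (catalan_fps ^ Suc r) (Suc i) = real (Suc r) * real (Suc ?N choose Suc i)"
      by (simp only: mult.assoc mult_left_cancel)
    moreover have "Suc ?N = 2 * Suc i + Suc r" by simp
    ultimately show ?case by simp
  qed simp
qed

text \<open>The coefficients of \<open>(1 - u\<^sup>2)\<close> to the power \<open>- r / 2\<close> for \<open>m = 0\<close>, and of
  \<open>(2 / (1 + sqrt (1 - u\<^sup>2))) ^ r\<close> for \<open>m = 1\<close>, at \<open>u ^ (2 * i)\<close>.\<close>

definition angle_coeff :: "nat \<Rightarrow> nat \<Rightarrow> nat \<Rightarrow> real" where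
  "angle_coeff m r i =
     (if m = 0 then pochhammer (real r / 2) i / fact i else (1 / 4) ^ i * fps_nth (catalan_fps ^ r) i)"

text \<open>For m = 0 this is the Vandermonde identity for rising factorials, with 1/2 added to the
  argument; for m = 1 it is the product of power series.\<close>

lemma angle_coeff_convolution:
  "angle_coeff m (Suc r) i = (\<Sum>j\<le>i. angle_coeff m r j * angle_coeff m 1 (i - j))"
proof (cases "m = 0")
  case True
  have "pochhammer (real (Suc r) / 2) i / fact i = (\<Sum>j\<le>i. real (i choose j) * pochhammer (real r / 2) j * pochhammer (1 / 2) (i - j)) / fact i"
    by (subst pochhammer_binomial_sum[symmetric]) (simp add: add_divide_distrib ac_simps)
  also have "\<dots> = (\<Sum>j\<le>i. pochhammer (real r / 2) j / fact j * (pochhammer (1 / 2) (i - j) / fact (i - j)))"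
    unfolding sum_divide_distrib
    by (intro sum.cong refl) (simp add: binomial_fact)
  finally show ?thesis using True by (simp add: angle_coeff_def)
next
  case False
  have "fps_nth (catalan_fps ^ Suc r) i = (\<Sum>j\<le>i. fps_nth (catalan_fps ^ r) j * fps_nth catalan_fps (i - j))"
    by (simp add: fps_mult_nth atMost_atLeast0 mult.commute[of catalan_fps])
  then have "(1 / 4) ^ i * fps_nth (catalan_fps ^ Suc r) i =
      (\<Sum>j\<le>i. (1 / 4) ^ (j + (i - j)) * (fps_nth (catalan_fps ^ r) j * fps_nth catalan_fps (i - j)))"
    by (simp add: sum_distrib_left)
  with False show ?thesis
    unfolding angle_coeff_def power_add by (simp add: ac_simps)
qed

text \<open>The moments of the symmetric beta law of order \<open>flight_order m n\<close> (see
  \<open>flight_order_moment\<close>), separated from the measures so that the recursion is pure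
  algebra.\<close>

definition flight_moment :: "nat \<Rightarrow> nat \<Rightarrow> nat \<Rightarrow> real" where
  "flight_moment m n k =
     (if even k then pochhammer (1 / 2) (k div 2) / pochhammer (flight_order m n + 1) (k div 2) else 0)"

lemma fact_add_pochhammer: "fact (n + k) = (fact n * pochhammer (real n + 1) k :: real)"
  using pochhammer_product'[of "1 :: real" n k] by (simp add: pochhammer_fact add.commute)

text \<open>The binomial weight cancels the denominator of the moment. For m = 0 the rising
  factorial of n + 1 splits by duplication and that of (n + 1) / 2 remains; for m = 1 a ballot
  number remains. The power is \<open>Suc n\<close> because n events leave n + 1 epochs.\<close>

lemma flight_moment_even:
  assumes "m \<in> {0, 1}"
  shows "flight_moment m n (2 * i) * real ((n + 2 * i) choose (2 * i)) = angle_coeff m (Suc n) i"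
proof -
  have half: "pochhammer (1 / 2 :: real) i = fact (2 * i) / (4 ^ i * fact i)"
    using fact_double[of i, where 'a = real] by (simp add: power_mult)
  have bin: "real ((n + 2 * i) choose (2 * i)) = fact (n + 2 * i) / (fact (2 * i) * fact n)"
    by (simp add: binomial_fact)
  consider "m = 0" | "m = 1" using assms by auto
  then show ?thesis
  proof cases
    case 1
    have "pochhammer (real n + 1) (2 * i) =
        4 ^ i * pochhammer ((real n + 1) / 2) i * pochhammer (real n / 2 + 1) i"
      using pochhammer_double[of "(real n + 1) / 2" i]
      by (simp add: power_mult add_divide_distrib add.commute)
    then have "(fact (n + 2 * i) :: real) =
        fact n * (4 ^ i * pochhammer ((real n + 1) / 2) i * pochhammer (real n / 2 + 1) i)"
      by (simp add: fact_add_pochhammer)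
    then show ?thesis
      using 1 pochhammer_pos[of "real n / 2 + 1" i]
      by (simp add: flight_moment_def flight_order_def angle_coeff_def half bin add.commute)
  next
    case 2
    have "(fact (Suc n + i) :: real) = fact (Suc n) * pochhammer (real n + 2) i"
      using fact_add_pochhammer[of "Suc n" i] by (simp add: add.commute)
    then have p: "pochhammer (real n + 2) i = fact (Suc n + i) / fact (Suc n)" by simp
    have c: "fps_nth (catalan_fps ^ Suc n) i = real (Suc n) * real ((2 * i + Suc n) choose i) / real (2 * i + Suc n)"
      using catalan_fps_power_nth[of i "Suc n"] by (simp add: field_simps del: power_Suc)
    have b: "real ((2 * i + Suc n) choose i) = fact (2 * i + Suc n) / (fact i * fact (Suc n + i))"
      by (subst binomial_fact) (simp_all add: ac_simps)
    have f: "(fact (2 * i + Suc n) :: real) = real (2 * i + Suc n) * fact (n + 2 * i)"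
      by (simp add: ac_simps)
    have "flight_moment m n (2 * i) * real ((n + 2 * i) choose (2 * i)) =
      fact (2 * i) / (4 ^ i * fact i) / (fact (Suc n + i) / fact (Suc n)) * (fact (n + 2 * i) / (fact (2 * i) * fact n))"
      using 2 by (simp add: flight_moment_def flight_order_def half bin p p[unfolded add.commute[of "real n"]] del: fact_Suc)
    also have "\<dots> = (1 / 4) ^ i * (real (Suc n) * fact (n + 2 * i) / (fact i * fact (Suc n + i)))"
      by (simp add: power_divide del: of_nat_Suc fact_Suc) simp
    also have "\<dots> = angle_coeff m (Suc n) i"
      using 2 unfolding angle_coeff_def c b f by simp
    finally show ?thesis .
  qed
qed

text \<open>The right-hand side is the binomial expansion of the k-th moment of q Y + (1 - q) Z,
  with q distributed as Beta(n, 1). Weighted by \<open>(n + k) choose k\<close>, it becomes a Cauchy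
  product.\<close>

lemma flight_moment_recursion:
  assumes m: "m \<in> {0, 1}" and n: "1 \<le> n"
  shows "flight_moment m n k = (\<Sum>j\<le>k. real (k choose j) *
    (Beta (real n + real j) (1 + real (k - j)) / Beta (real n) 1) *
    flight_moment m (n - 1) j * flight_moment m 0 (k - j))"
proof -
  define b where "b n k = flight_moment m n k * real ((n + k) choose k)" for n k
  have b0: "b 0 k = flight_moment m 0 k" for k by (simp add: b_def)
  have b_odd: "b n k = 0" if "odd k" for n k using that by (simp add: b_def flight_moment_def)
  have b_even: "b n (2 * i) = angle_coeff m (Suc n) i" for n i
    using flight_moment_even[OF m] by (simp add: b_def)
  have b_conv: "b n k = (\<Sum>j\<le>k. b (n - 1) j * b 0 (k - j))"
  proof (cases "even k")
    case True
    then obtain i where k: "k = 2 * i" by blast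
    have "(\<Sum>j\<le>k. b (n - 1) j * b 0 (k - j)) = (\<Sum>j\<in>(\<lambda>l. 2 * l) ` {..i}. b (n - 1) j * b 0 (k - j))"
    proof (rule sum.mono_neutral_right)
      show "\<forall>j\<in>{..k} - (\<lambda>l. 2 * l) ` {..i}. b (n - 1) j * b 0 (k - j) = 0"
      proof
        fix j assume "j \<in> {..k} - (\<lambda>l. 2 * l) ` {..i}"
        then have "odd j" using k by (auto elim!: evenE)
        then show "b (n - 1) j * b 0 (k - j) = 0" by (simp add: b_odd)
      qed
    qed (auto simp: k)
    also have "\<dots> = (\<Sum>l\<le>i. b (n - 1) (2 * l) * b 0 (k - 2 * l))"
      by (subst sum.reindex) (auto simp: inj_on_def)
    also have "\<dots> = (\<Sum>l\<le>i. angle_coeff m n l * angle_coeff m 1 (i - l))"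
    proof (intro sum.cong refl)
      fix l
      have *: "k - 2 * l = 2 * (i - l)" by (simp add: k)
      show "b (n - 1) (2 * l) * b 0 (k - 2 * l) = angle_coeff m n l * angle_coeff m 1 (i - l)"
        using n unfolding * b_even by simp
    qed
    also have "\<dots> = b n k"
      by (simp only: k b_even angle_coeff_convolution[of m n i])
    finally show ?thesis ..
  next
    case False
    \<comment> \<open>For odd k exactly one of j and k - j is odd, so one factor vanishes.\<close>
    then have "b (n - 1) j * b 0 (k - j) = 0" if "j \<le> k" for j
      using that by (cases "odd j") (auto simp: b_odd)
    then have "(\<Sum>j\<le>k. b (n - 1) j * b 0 (k - j)) = 0" by (intro sum.neutral) auto
    with False show ?thesis by (simp add: b_odd)
  qed
  let ?C = "real ((n + k) choose k)"
  \<comment> \<open>All Gamma values are factorials here. The factorial of k - j in the beta moment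
    cancels the one in \<open>k choose j\<close>, and what is left is the weight belonging to n - 1;
    the weight belonging to 0 is 1.\<close>
  have C: "real (k choose j) * (Beta (real n + real j) (1 + real (k - j)) / Beta (real n) 1) * ?C =
      real ((n - 1 + j) choose j)" if "j \<le> k" for j
  proof -
    have r: "real n + real j = 1 + real (n - 1 + j)" "real n + real j + (1 + real (k - j)) = 1 + real (n + k)"
      "real n = 1 + real (n - 1)" "real n + 1 = 1 + real n"
      using n that by (simp_all add: of_nat_diff)
    have g: "Gamma (real n + real j) = fact (n - 1 + j)" "Gamma (1 + real (k - j)) = fact (k - j)"
      "Gamma (real n + real j + (1 + real (k - j))) = fact (n + k)"
      "Gamma (real n) = fact (n - 1)" "Gamma (real n + 1) = fact n" "Gamma (1::real) = 1"
      by (subst r(1), rule Gamma_fact) (rule Gamma_fact, subst r(2), rule Gamma_fact, subst r(3), rule Gamma_fact,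
        subst r(4), rule Gamma_fact, rule Gamma_1)
    have b: "real (k choose j) = fact k / (fact j * fact (k - j))"
      "?C = fact (n + k) / (fact k * fact n)"
      "real ((n - 1 + j) choose j) = fact (n - 1 + j) / (fact j * fact (n - 1))"
      using that by (simp_all add: binomial_fact)
    show ?thesis
      unfolding Beta_def g b by simp
  qed
  have "?C * flight_moment m n k = (\<Sum>j\<le>k. ?C * (real (k choose j) *
    (Beta (real n + real j) (1 + real (k - j)) / Beta (real n) 1) *
    flight_moment m (n - 1) j * flight_moment m 0 (k - j)))"
  proof -
    have "?C * flight_moment m n k = (\<Sum>j\<le>k. b (n - 1) j * b 0 (k - j))"
      unfolding b_conv[symmetric] by (simp add: b_def)
    also have "\<dots> = (\<Sum>j\<le>k. ?C * (real (k choose j) *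
      (Beta (real n + real j) (1 + real (k - j)) / Beta (real n) 1) *
      flight_moment m (n - 1) j * flight_moment m 0 (k - j)))"
    proof (intro sum.cong refl)
      fix j assume "j \<in> {..k}"
      then have "j \<le> k" by simp
      then show "b (n - 1) j * b 0 (k - j) = ?C * (real (k choose j) *
          (Beta (real n + real j) (1 + real (k - j)) / Beta (real n) 1) *
          flight_moment m (n - 1) j * flight_moment m 0 (k - j))"
        unfolding b0 unfolding b_def C[OF \<open>j \<le> k\<close>, symmetric] by (simp only: ac_simps)
    qed
    finally show ?thesis .
  qed
  then show ?thesis
    unfolding sum_distrib_left[symmetric] by (subst (asm) mult_left_cancel) simp_all
qed

section \<open>The mixture recursion\<close>

lemma
  fixes f :: "'a \<Rightarrow> real" and g :: "'b \<Rightarrow> real"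
  assumes "sigma_finite_measure M1" "sigma_finite_measure M2"
    and f: "integrable M1 f" and g: "integrable M2 g"
  shows integrable_pair_mult: "integrable (M1 \<Otimes>\<^sub>M M2) (\<lambda>p. f (fst p) * g (snd p))"
    and integral_pair_mult: "(\<integral>p. f (fst p) * g (snd p) \<partial>(M1 \<Otimes>\<^sub>M M2)) = (\<integral>x. f x \<partial>M1) * (\<integral>y. g y \<partial>M2)"
proof -
  interpret M1: sigma_finite_measure M1 by fact
  interpret M2: sigma_finite_measure M2 by fact
  interpret pair_sigma_finite M1 M2 ..
  have [measurable]: "f \<in> borel_measurable M1" "g \<in> borel_measurable M2" using f g by auto
  show int: "integrable (M1 \<Otimes>\<^sub>M M2) (\<lambda>p. f (fst p) * g (snd p))"
    by (rule Fubini_integrable) (use f g in \<open>auto simp: abs_mult\<close>)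
  show "(\<integral>p. f (fst p) * g (snd p) \<partial>(M1 \<Otimes>\<^sub>M M2)) = (\<integral>x. f x \<partial>M1) * (\<integral>y. g y \<partial>M2)"
    by (subst integral_fst'[OF int, symmetric]) simp
qed

text \<open>Absolute moments are at most 1 here, so the Taylor error of order n of a characteristic
  function at t is at most 2 |t|^n / n!, which tends to 0. Equal moments thus give equal
  characteristic functions.\<close>

lemma real_distribution_eqI_moments:
  assumes M: "real_distribution M" "AE x in M. \<bar>x\<bar> \<le> 1"
    and N: "real_distribution N" "AE x in N. \<bar>x\<bar> \<le> 1"
    and eq: "\<And>k. (\<integral>x. x ^ k \<partial>M) = (\<integral>x. x ^ k \<partial>N)"
  shows "M = N"
proof (rule Levy_uniqueness[OF M(1) N(1)], rule ext)
  fix t :: real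
  have bound: "cmod (char L t - (\<Sum>k\<le>n. ((\<i> * t) ^ k / fact k) * (\<integral>x. x ^ k \<partial>L))) \<le> 2 * (\<bar>t\<bar> ^ n / fact n)"
    if "real_distribution L" "AE x in L. \<bar>x\<bar> \<le> 1" for L :: "real measure" and n
  proof -
    interpret real_distribution L by fact
    have int: "integrable L (\<lambda>x. x ^ k)" for k
      using that(2) by (intro integrable_const_bound[where B = 1])
        (auto elim!: eventually_mono simp: power_abs power_le_one)
    have "(\<integral>x. \<bar>x\<bar> ^ n \<partial>L) \<le> (\<integral>x. 1 \<partial>L)"
      using that(2) int[of n]
      by (intro integral_mono_AE) (auto elim!: eventually_mono simp: power_abs[symmetric] integrable_abs, simp add: power_abs power_le_one)
    then have "(\<integral>x. \<bar>x\<bar> ^ n \<partial>L) \<le> 1" using prob_space by simp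
    then have "2 * \<bar>t\<bar> ^ n / fact n * (\<integral>x. \<bar>x\<bar> ^ n \<partial>L) \<le> 2 * \<bar>t\<bar> ^ n / fact n"
      by (intro mult_left_le) auto
    with char_approx1[of n t] int show ?thesis by fastforce
  qed
  have lim: "(\<lambda>n. 4 * (\<bar>t\<bar> ^ n / fact n)) \<longlonglongrightarrow> 4 * 0"
    using summable_LIMSEQ_zero[OF summable_exp[of "\<bar>t\<bar>"]]
    by (intro tendsto_mult tendsto_const) (simp add: field_simps)
  have "cmod (char M t - char N t) \<le> 4 * (\<bar>t\<bar> ^ n / fact n)" for n
    using norm_triangle_le_diff[OF add_mono[OF bound[OF M, of n] bound[OF N, of n]]] by (simp add: eq)
  then have "cmod (char M t - char N t) \<le> 4 * 0"
    by (intro LIMSEQ_le_const[OF lim]) auto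
  then show "char M t = char N t" by simp
qed

lemma flight_order_gt: "- 1 / 2 < flight_order m n"
  by (simp add: flight_order_def)

lemma real_distribution_sym_beta: "real_distribution (sym_beta_measure (flight_order m n))"
  using prob_space_sym_beta_measure[OF flight_order_gt]
  by (simp add: real_distribution_def real_distribution_axioms_def)

lemma flight_order_moment: "(\<integral>y. y ^ k \<partial>sym_beta_measure (flight_order m n)) = flight_moment m n k"
proof (cases "even k")
  case True
  then obtain i where "k = 2 * i" by blast
  with sym_beta_moment_even[OF flight_order_gt] show ?thesis by (simp add: flight_moment_def)
next
  case False
  then obtain i where "k = Suc (2 * i)" using oddE by fastforce
  with sym_beta_moment_odd[OF flight_order_gt] False show ?thesis by (simp add: flight_moment_def)
qed

lemma sym_beta_convex_mixture:
  assumes m: "m \<in> {0, 1}" and n: "1 \<le> n"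
  shows "distr (beta_measure (real n) 1 \<Otimes>\<^sub>M (sym_beta_measure (flight_order m (n - 1)) \<Otimes>\<^sub>M sym_beta_measure (flight_order m 0)))
    borel (\<lambda>(q, y, z). q * y + (1 - q) * z) = sym_beta_measure (flight_order m n)"
    (is "distr (?Q \<Otimes>\<^sub>M (?Y \<Otimes>\<^sub>M ?Z)) borel ?f = ?L")
proof -
  have nn: "0 < real n" using n by simp
  interpret Q: prob_space ?Q using nn by (simp add: prob_space_beta_measure)
  interpret Y: real_distribution ?Y by (rule real_distribution_sym_beta)
  interpret Z: real_distribution ?Z by (rule real_distribution_sym_beta)
  interpret YZ: pair_prob_space ?Y ?Z ..
  interpret P: pair_prob_space ?Q "?Y \<Otimes>\<^sub>M ?Z" ..
  let ?P = "?Q \<Otimes>\<^sub>M (?Y \<Otimes>\<^sub>M ?Z)"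
  have AE_YZ: "AE p in ?Y \<Otimes>\<^sub>M ?Z. \<bar>fst p\<bar> \<le> 1 \<and> \<bar>snd p\<bar> \<le> 1"
    by (rule YZ.AE_pair_measure) (measurable, use AE_sym_beta_measure in \<open>auto elim!: eventually_mono\<close>)
  \<comment> \<open>The moment criterion demands a law on the interval from -1 to 1, and a convex
    combination of two of its points stays there.\<close>
  have AE_P: "AE (q, y, z) in ?P. \<bar>?f (q, y, z)\<bar> \<le> 1"
  proof (rule P.AE_pair_measure)
    show "AE q in ?Q. AE p in ?Y \<Otimes>\<^sub>M ?Z. case (q, p) of (q, y, z) \<Rightarrow> \<bar>?f (q, y, z)\<bar> \<le> 1"
      using AE_beta_measure
    proof eventually_elim
      case (elim q)
      from AE_YZ show ?case
      proof eventually_elim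
        case (elim p)
        obtain y z where p: "p = (y, z)" by (cases p)
        have "\<bar>q * y + (1 - q) * z\<bar> \<le> \<bar>q * y\<bar> + \<bar>(1 - q) * z\<bar>" by (rule abs_triangle_ineq)
        also have "\<dots> = q * \<bar>y\<bar> + (1 - q) * \<bar>z\<bar>" using \<open>0 < q \<and> q < 1\<close> by (simp add: abs_mult)
        also have "\<dots> \<le> q * 1 + (1 - q) * 1"
          using \<open>0 < q \<and> q < 1\<close> elim by (intro add_mono mult_left_mono) (auto simp: p)
        finally show ?case by (simp add: p)
      qed
    qed
  qed measurable
  show ?thesis
  proof (rule real_distribution_eqI_moments)
    show "real_distribution (distr ?P borel ?f)"
      by (rule P.real_distribution_distr) measurable
    show "AE x in distr ?P borel ?f. \<bar>x\<bar> \<le> 1"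
      using AE_P by (subst AE_distr_iff) (auto simp: case_prod_unfold)
    show "real_distribution ?L" by (rule real_distribution_sym_beta)
    show "AE x in ?L. \<bar>x\<bar> \<le> 1" by (rule AE_sym_beta_measure)
    fix k
    have intY: "integrable ?Y (\<lambda>y. y ^ j)" and intZ: "integrable ?Z (\<lambda>y. y ^ j)" for j
    proof -
      have *: "AE y in sym_beta_measure v. norm (y ^ j) \<le> 1" for v
        using AE_sym_beta_measure[of v] by (auto elim!: eventually_mono simp: power_abs power_le_one)
      show "integrable ?Y (\<lambda>y. y ^ j)" by (rule Y.integrable_const_bound[OF *]) simp
      show "integrable ?Z (\<lambda>y. y ^ j)" by (rule Z.integrable_const_bound[OF *]) simp
    qed
    have intQ: "integrable ?Q (\<lambda>q. q ^ i * (1 - q) ^ j)" for i j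
    proof (rule Q.integrable_const_bound[where B = 1])
      show "AE q in ?Q. norm (q ^ i * (1 - q) ^ j) \<le> 1"
        using AE_beta_measure[of "real n" 1]
        by eventually_elim (simp add: abs_mult power_abs power_le_one mult_le_one)
    qed simp
    note intYZ = integrable_pair_mult[OF Y.sigma_finite_measure_axioms Z.sigma_finite_measure_axioms intY intZ]
    note intP = integrable_pair_mult[OF Q.sigma_finite_measure_axioms YZ.sigma_finite_measure_axioms intQ intYZ]
    note valYZ = integral_pair_mult[OF Y.sigma_finite_measure_axioms Z.sigma_finite_measure_axioms intY intZ]
    note valP = integral_pair_mult[OF Q.sigma_finite_measure_axioms YZ.sigma_finite_measure_axioms intQ intYZ]
    have "(\<integral>x. x ^ k \<partial>distr ?P borel ?f) = (\<integral>p. ?f p ^ k \<partial>?P)"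
      by (rule integral_distr) measurable
    also have "\<dots> = (\<integral>p. (\<Sum>j\<le>k. real (k choose j) * ((fst p ^ j * (1 - fst p) ^ (k - j)) *
        (fst (snd p) ^ j * snd (snd p) ^ (k - j)))) \<partial>?P)"
      by (intro Bochner_Integration.integral_cong refl)
        (simp add: case_prod_unfold binomial_ring power_mult_distrib ac_simps)
    also have "\<dots> = (\<Sum>j\<le>k. real (k choose j) * (\<integral>p. (fst p ^ j * (1 - fst p) ^ (k - j)) *
        (fst (snd p) ^ j * snd (snd p) ^ (k - j)) \<partial>?P))"
      using intP by (subst Bochner_Integration.integral_sum) auto
    also have "\<dots> = (\<Sum>j\<le>k. real (k choose j) *
      (Beta (real n + real j) (1 + real (k - j)) / Beta (real n) 1) *
      flight_moment m (n - 1) j * flight_moment m 0 (k - j))"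
      unfolding valP valYZ real_beta_moment[OF nn zero_less_one] flight_order_moment
      by (simp only: mult.assoc)
    also have "\<dots> = flight_moment m n k"
      by (rule flight_moment_recursion[OF m n, symmetric])
    finally show "(\<integral>x. x ^ k \<partial>distr ?P borel ?f) = (\<integral>x. x ^ k \<partial>?L)"
      by (simp add: flight_order_moment)
  qed
qed

text \<open>The form in which the mixture is applied: the iterated integral has the order share,
  past, last step in which \<open>walk_law\<close> and \<open>nn_integral_flight_count\<close>
  produce it.\<close>

lemma sym_beta_step:
  fixes g :: "real \<Rightarrow> ennreal"
  assumes m: "m \<in> {0, 1}" and n: "1 \<le> n" and [measurable]: "g \<in> borel_measurable borel"
  shows "(\<integral>\<^sup>+q. \<integral>\<^sup>+y. \<integral>\<^sup>+z. g (q * y + (1 - q) * z) \<partial>sym_beta_measure (flight_order m 0)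
      \<partial>sym_beta_measure (flight_order m (n - 1)) \<partial>beta_measure (real n) 1) =
    (\<integral>\<^sup>+x. g x \<partial>sym_beta_measure (flight_order m n))"
    (is "(\<integral>\<^sup>+q. \<integral>\<^sup>+y. \<integral>\<^sup>+z. _ \<partial>?Z \<partial>?Y \<partial>?Q) = _")
proof -
  interpret Q: prob_space ?Q using n by (simp add: prob_space_beta_measure)
  interpret Y: real_distribution ?Y by (rule real_distribution_sym_beta)
  interpret Z: real_distribution ?Z by (rule real_distribution_sym_beta)
  interpret YZ: pair_prob_space ?Y ?Z ..
  have "(\<integral>\<^sup>+x. g x \<partial>sym_beta_measure (flight_order m n)) =
      (\<integral>\<^sup>+p. g (case p of (q, y, z) \<Rightarrow> q * y + (1 - q) * z) \<partial>(?Q \<Otimes>\<^sub>M (?Y \<Otimes>\<^sub>M ?Z)))"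
    unfolding sym_beta_convex_mixture[OF m n, symmetric] by (rule nn_integral_distr) measurable
  also have "\<dots> = (\<integral>\<^sup>+q. \<integral>\<^sup>+p. g (q * fst p + (1 - q) * snd p) \<partial>(?Y \<Otimes>\<^sub>M ?Z) \<partial>?Q)"
    by (subst YZ.nn_integral_fst[symmetric]) (simp_all add: case_prod_unfold)
  also have "\<dots> = (\<integral>\<^sup>+q. \<integral>\<^sup>+y. \<integral>\<^sup>+z. g (q * y + (1 - q) * z) \<partial>?Z \<partial>?Y \<partial>?Q)"
    by (subst Z.nn_integral_fst[symmetric]) simp_all
  finally show ?thesis ..
qed

section \<open>The law of the embedded walk\<close>

lemma angle_density_measurable [measurable]: "angle_density m \<in> borel_measurable borel"
  unfolding angle_density_def[abs_def] by measurable

lemma nn_integral_cos_angle: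
  fixes g :: "real \<Rightarrow> ennreal"
  assumes m: "m \<in> {0, 1}" and [measurable]: "g \<in> borel_measurable borel"
  shows "(\<integral>\<^sup>+a. g (cos a) \<partial>density lborel (\<lambda>x. ennreal (angle_density m x))) =
    (\<integral>\<^sup>+x. g x \<partial>sym_beta_measure (flight_order m 0))"
proof -
  let ?v = "flight_order m 0"
  let ?f = "\<lambda>y. ennreal (sym_beta_density ?v y) * g (- y)"
  have even: "sym_beta_density ?v (- y) = sym_beta_density ?v y" for y
    by (auto simp: sym_beta_density_def)
  have angle: "sym_beta_density ?v (- cos a) * sin a = angle_density m a" if "0 < a" "a < pi" for a
  proof -
    have s: "0 < sin a" using that by (rule sin_gt_zero)
    have "(cos a)\<^sup>2 < 1" using s by (simp add: cos_squared_eq)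
    then have "\<bar>cos a\<bar> < 1" by (simp add: abs_square_less_1)
    then have "- 1 < - cos a \<and> - cos a < 1" by auto
    moreover have "1 - (- cos a)\<^sup>2 = (sin a)\<^sup>2" by (simp add: sin_squared_eq)
    moreover have "((sin a)\<^sup>2) powr (- (1 / 2)) = 1 / sin a" "((sin a)\<^sup>2) powr (1 / 2) = sin a"
      using s by (simp_all add: powr_half_sqrt powr_minus_divide)
    ultimately show ?thesis
      using m s that by (auto simp: sym_beta_density_def angle_density_def flight_order_def Beta_def
          Gamma_one_half_real power2_eq_square)
  qed
  have "(\<integral>\<^sup>+x. g x \<partial>sym_beta_measure ?v) = (\<integral>\<^sup>+y. ennreal (sym_beta_density ?v y) * g y \<partial>lborel)"
    by (rule nn_integral_sym_beta_measure) simp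
  \<comment> \<open>Evenness makes the reflection harmless, and after it the substitution y = - cos
    a is increasing on [0, pi].\<close>
  also have "\<dots> = (\<integral>\<^sup>+y. ?f y \<partial>lborel)"
    by (subst nn_integral_real_affine[where c = "- 1" and t = 0]) (simp_all add: even)
  also have "\<dots> = (\<integral>\<^sup>+y. ?f y * indicator {- cos 0..- cos pi} y \<partial>lborel)"
    by (intro nn_integral_cong) (auto simp: indicator_def sym_beta_density_def)
  also have "\<dots> = (\<integral>\<^sup>+a. ?f (- cos a) * ennreal (sin a) * indicator {0..pi} a \<partial>lborel)"
    by (rule nn_integral_substitution_aux)
      (auto intro!: derivative_eq_intros continuous_intros sin_ge_zero)
  also have "\<dots> = (\<integral>\<^sup>+a. ennreal (angle_density m a) * g (cos a) \<partial>lborel)"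
  proof (intro nn_integral_cong_AE AE_I[where N = "{0, pi}"] subsetI)
    fix a assume *: "a \<in> {a \<in> space lborel. ?f (- cos a) * ennreal (sin a) * indicator {0..pi} a \<noteq>
      ennreal (angle_density m a) * g (cos a)}"
    show "a \<in> {0, pi}"
    proof (rule ccontr)
      assume a: "a \<notin> {0, pi}"
      have "?f (- cos a) * ennreal (sin a) * indicator {0..pi} a = ennreal (angle_density m a) * g (cos a)"
      proof (cases "0 < a \<and> a < pi")
        case True
        then have "ennreal (sym_beta_density ?v (- cos a)) * ennreal (sin a) = ennreal (angle_density m a)"
          using sin_ge_zero[of a] sym_beta_density_nonneg[OF flight_order_gt]
          by (subst ennreal_mult[symmetric]) (simp_all add: angle less_imp_le)
        then have "ennreal (sym_beta_density ?v (- cos a)) * g (cos a) * ennreal (sin a) =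
          ennreal (angle_density m a) * g (cos a)"
          by (metis mult.assoc mult.commute)
        with True show ?thesis by simp
      qed (use a in \<open>auto simp: indicator_def angle_density_def\<close>)
      with * show False by simp
    qed
  qed (auto simp: emeasure_lborel_countable)
  also have "\<dots> = (\<integral>\<^sup>+a. g (cos a) \<partial>density lborel (\<lambda>x. ennreal (angle_density m x)))"
    by (rule nn_integral_density[symmetric]) measurable
  finally show ?thesis ..
qed

definition angle_measure :: "nat \<Rightarrow> real measure" where
  "angle_measure m = density lborel (\<lambda>x. ennreal (angle_density m x))"

lemma sets_angle_measure [simp, measurable_cong]: "sets (angle_measure m) = sets borel"
  and space_angle_measure [simp]: "space (angle_measure m) = UNIV"
  by (simp_all add: angle_measure_def)

lemma prob_space_angle_measure:
  assumes "m \<in> {0, 1}"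
  shows "prob_space (angle_measure m)"
proof
  interpret real_distribution "sym_beta_measure (flight_order m 0)" by (rule real_distribution_sym_beta)
  show "emeasure (angle_measure m) (space (angle_measure m)) = 1"
    using nn_integral_cos_angle[OF assms, of "\<lambda>_. 1"] emeasure_space_1 by (simp add: angle_measure_def)
qed

text \<open>The two densities differ at 0 alone, where \<open>gamma_density\<close> is cut
  off.\<close>

lemma exponential_eq_gamma_measure:
  "0 < t \<Longrightarrow> density lborel (\<lambda>x. ennreal (exponential_density t x)) = gamma_measure 1 t"
  unfolding gamma_measure_def
  by (intro density_cong AE_I[where N = "{0}"])
    (auto simp: gamma_density_def exponential_density_def algebra_simps)

text \<open>Isolates the last time and angle, leaving the past visible only through its two sums.
  The last pair is handed over raw because it is used in two ways: as a complete step in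
  \<open>walk_law\<close>, and as an epoch cut off at s in
  \<open>nn_integral_flight_count\<close>.\<close>

lemma walk_split:
  fixes G :: "real \<times> real \<times> real \<times> real \<Rightarrow> ennreal" and E A :: "real measure"
  assumes E: "prob_space E" and [simp, measurable_cong]: "sets E = sets borel"
    and A: "prob_space A" and [simp, measurable_cong]: "sets A = sets borel"
    and G [measurable]: "G \<in> borel_measurable (borel \<Otimes>\<^sub>M borel \<Otimes>\<^sub>M borel \<Otimes>\<^sub>M borel)"
  shows "(\<integral>\<^sup>+\<tau>. \<integral>\<^sup>+\<theta>. G (\<Sum>j<n. \<tau> j, \<Sum>j<n. \<tau> j * cos (\<theta> j), \<tau> n, \<theta> n)
      \<partial>PiM {..<Suc n} (\<lambda>_. A) \<partial>PiM {..<Suc n} (\<lambda>_. E)) =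
    (\<integral>\<^sup>+\<tau>. \<integral>\<^sup>+\<theta>. \<integral>\<^sup>+t. \<integral>\<^sup>+a. G (\<Sum>j<n. \<tau> j, \<Sum>j<n. \<tau> j * cos (\<theta> j), t, a)
      \<partial>A \<partial>E \<partial>PiM {..<n} (\<lambda>_. A) \<partial>PiM {..<n} (\<lambda>_. E))"
proof -
  interpret E: prob_space E by fact
  interpret A: prob_space A by fact
  interpret PE: product_prob_space "\<lambda>_::nat. E" "{..<Suc n}" by standard
  interpret PA: product_prob_space "\<lambda>_::nat. A" "{..<Suc n}" by standard
  interpret An: prob_space "PiM {..<n} (\<lambda>_. A)" by (rule prob_space_PiM) (rule A)
  interpret An': prob_space "PiM (insert n {..<n}) (\<lambda>_. A)" by (rule prob_space_PiM) (rule A)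
  interpret EA: pair_prob_space "PiM {..<n} (\<lambda>_. A)" E ..
  have "(\<integral>\<^sup>+\<tau>. \<integral>\<^sup>+\<theta>. G (\<Sum>j<n. \<tau> j, \<Sum>j<n. \<tau> j * cos (\<theta> j), \<tau> n, \<theta> n)
      \<partial>PiM {..<Suc n} (\<lambda>_. A) \<partial>PiM {..<Suc n} (\<lambda>_. E)) =
    (\<integral>\<^sup>+\<tau>. \<integral>\<^sup>+t. \<integral>\<^sup>+\<theta>. G (\<Sum>j<n. \<tau> j, \<Sum>j<n. \<tau> j * cos (\<theta> j), t, \<theta> n)
      \<partial>PiM (insert n {..<n}) (\<lambda>_. A) \<partial>E \<partial>PiM {..<n} (\<lambda>_. E))"
    unfolding lessThan_Suc
    by (subst PE.product_nn_integral_insert) simp_all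
  also have "\<dots> = (\<integral>\<^sup>+\<tau>. \<integral>\<^sup>+t. \<integral>\<^sup>+\<theta>. \<integral>\<^sup>+a. G (\<Sum>j<n. \<tau> j, \<Sum>j<n. \<tau> j * cos (\<theta> j), t, a)
      \<partial>A \<partial>PiM {..<n} (\<lambda>_. A) \<partial>E \<partial>PiM {..<n} (\<lambda>_. E))"
    by (intro nn_integral_cong, subst PA.product_nn_integral_insert) (simp_all add: space_PiM)
  also have "\<dots> = (\<integral>\<^sup>+\<tau>. \<integral>\<^sup>+\<theta>. \<integral>\<^sup>+t. \<integral>\<^sup>+a. G (\<Sum>j<n. \<tau> j, \<Sum>j<n. \<tau> j * cos (\<theta> j), t, a)
      \<partial>A \<partial>E \<partial>PiM {..<n} (\<lambda>_. A) \<partial>PiM {..<n} (\<lambda>_. E))"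
    by (intro nn_integral_cong, rule EA.Fubini') (simp add: case_prod_unfold)
  finally show ?thesis .
qed

text \<open>The gamma-beta factorisation replaces past time and last step by total time and share,
  and the share mixes the two directions as in \<open>sym_beta_step\<close>. So position over
  elapsed time remains independent of elapsed time; keeping r as an argument of g carries this
  independence through the induction.\<close>

lemma walk_law:
  fixes g :: "real \<Rightarrow> real \<Rightarrow> ennreal"
  assumes m: "m \<in> {0, 1}" and t: "0 < t"
    and g [measurable]: "(\<lambda>(r, x). g r x) \<in> borel_measurable (borel \<Otimes>\<^sub>M borel)"
  shows "(\<integral>\<^sup>+\<tau>. \<integral>\<^sup>+\<theta>. g (\<Sum>j<Suc n. \<tau> j) (\<Sum>j<Suc n. \<tau> j * cos (\<theta> j))
      \<partial>PiM {..<Suc n} (\<lambda>_. angle_measure m) \<partial>PiM {..<Suc n} (\<lambda>_. gamma_measure 1 t)) =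
    (\<integral>\<^sup>+r. \<integral>\<^sup>+y. g r (r * y) \<partial>sym_beta_measure (flight_order m n) \<partial>gamma_measure (real (Suc n)) t)"
  using g
proof (induction n arbitrary: g)
  case (0 g)
  note [measurable] = 0
  note split = walk_split[OF prob_space_gamma_measure[OF zero_less_one t] sets_gamma_measure prob_space_angle_measure[OF m] sets_angle_measure]
  have "(\<integral>\<^sup>+\<tau>. \<integral>\<^sup>+\<theta>. g (\<Sum>j<Suc 0. \<tau> j) (\<Sum>j<Suc 0. \<tau> j * cos (\<theta> j))
      \<partial>PiM {..<Suc 0} (\<lambda>_. angle_measure m) \<partial>PiM {..<Suc 0} (\<lambda>_. gamma_measure 1 t)) =
      (\<integral>\<^sup>+r. \<integral>\<^sup>+a. g r (r * cos a) \<partial>angle_measure m \<partial>gamma_measure 1 t)"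
    using split[of "\<lambda>(r, x, t, a). g (r + t) (x + t * cos a)" 0]
    by (simp add: PiM_empty nn_integral_count_space_finite)
  also have "\<dots> = (\<integral>\<^sup>+r. \<integral>\<^sup>+y. g r (r * y) \<partial>sym_beta_measure (flight_order m 0) \<partial>gamma_measure 1 t)"
    unfolding angle_measure_def by (simp add: nn_integral_cos_angle[OF m, of "\<lambda>y. g _ (_ * y)"])
  finally show ?case by simp
next
  case (Suc n g)
  note [measurable] = Suc.prems
  note split = walk_split[OF prob_space_gamma_measure[OF zero_less_one t] sets_gamma_measure prob_space_angle_measure[OF m] sets_angle_measure]
  let ?E = "gamma_measure 1 t" and ?A = "angle_measure m"
    and ?Y = "sym_beta_measure (flight_order m n)" and ?Z = "sym_beta_measure (flight_order m 0)"
  interpret E: prob_space ?E using t by (simp add: prob_space_gamma_measure)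
  interpret A: prob_space ?A by (rule prob_space_angle_measure[OF m])
  interpret Y: real_distribution ?Y by (rule real_distribution_sym_beta)
  interpret Z: real_distribution ?Z by (rule real_distribution_sym_beta)
  interpret EY: pair_prob_space ?E ?Y ..
  have "(\<integral>\<^sup>+\<tau>. \<integral>\<^sup>+\<theta>. g (\<Sum>j<Suc (Suc n). \<tau> j) (\<Sum>j<Suc (Suc n). \<tau> j * cos (\<theta> j))
      \<partial>PiM {..<Suc (Suc n)} (\<lambda>_. ?A) \<partial>PiM {..<Suc (Suc n)} (\<lambda>_. ?E)) =
    (\<integral>\<^sup>+\<tau>. \<integral>\<^sup>+\<theta>. (\<integral>\<^sup>+u. \<integral>\<^sup>+a. g ((\<Sum>j<Suc n. \<tau> j) + u) ((\<Sum>j<Suc n. \<tau> j * cos (\<theta> j)) + u * cos a) \<partial>?A \<partial>?E)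
      \<partial>PiM {..<Suc n} (\<lambda>_. ?A) \<partial>PiM {..<Suc n} (\<lambda>_. ?E))"
    using split[of "\<lambda>(r, x, t, a). g (r + t) (x + t * cos a)" "Suc n"] by simp
  also have "\<dots> = (\<integral>\<^sup>+r. \<integral>\<^sup>+y. \<integral>\<^sup>+u. \<integral>\<^sup>+a. g (r + u) (r * y + u * cos a) \<partial>?A \<partial>?E \<partial>?Y \<partial>gamma_measure (real (Suc n)) t)"
    by (rule Suc.IH[of "\<lambda>r x. \<integral>\<^sup>+u. \<integral>\<^sup>+a. g (r + u) (x + u * cos a) \<partial>?A \<partial>?E"]) measurable
  also have "\<dots> = (\<integral>\<^sup>+r. \<integral>\<^sup>+y. \<integral>\<^sup>+u. \<integral>\<^sup>+z. g (r + u) (r * y + u * z) \<partial>?Z \<partial>?E \<partial>?Y \<partial>gamma_measure (real (Suc n)) t)"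
    unfolding angle_measure_def by (simp add: nn_integral_cos_angle[OF m, of "\<lambda>z. g _ (_ + _ * z)"])
  also have "\<dots> = (\<integral>\<^sup>+r. \<integral>\<^sup>+u. \<integral>\<^sup>+y. \<integral>\<^sup>+z. g (r + u) (r * y + u * z) \<partial>?Z \<partial>?Y \<partial>?E \<partial>gamma_measure (real (Suc n)) t)"
    by (rule nn_integral_cong, rule EY.Fubini') (simp add: case_prod_unfold)
  \<comment> \<open>The last step is exponential, hence gamma of shape 1, so the share of the past
    is Beta with parameters \<open>Suc n\<close> and 1.\<close>
  also have "\<dots> = (\<integral>\<^sup>+s. \<integral>\<^sup>+q. \<integral>\<^sup>+y. \<integral>\<^sup>+z. g (s * q + s * (1 - q)) (s * q * y + s * (1 - q) * z) \<partial>?Z \<partial>?Y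
      \<partial>beta_measure (real (Suc n)) 1 \<partial>gamma_measure (real (Suc n) + 1) t)"
    by (rule gamma_beta_factorization[of "real (Suc n)" 1 t "\<lambda>r u. \<integral>\<^sup>+y. \<integral>\<^sup>+z. g (r + u) (r * y + u * z) \<partial>?Z \<partial>?Y"])
      (use t in \<open>auto simp: case_prod_unfold\<close>)
  also have "\<dots> = (\<integral>\<^sup>+s. \<integral>\<^sup>+q. \<integral>\<^sup>+y. \<integral>\<^sup>+z. g s (s * (q * y + (1 - q) * z)) \<partial>?Z \<partial>?Y
      \<partial>beta_measure (real (Suc n)) 1 \<partial>gamma_measure (real (Suc n) + 1) t)"
    by (simp add: algebra_simps)
  also have "\<dots> = (\<integral>\<^sup>+s. \<integral>\<^sup>+x. g s (s * x) \<partial>sym_beta_measure (flight_order m (Suc n)) \<partial>gamma_measure (real (Suc n) + 1) t)"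
    by (rule nn_integral_cong, rule sym_beta_step[OF m, of "Suc n" "\<lambda>x. g _ (_ * x)", unfolded diff_Suc_1]) simp_all
  finally show ?case by (simp add: add.commute)
qed

section \<open>The flight given the number of events\<close>

definition gen_sigma :: "'a measure \<Rightarrow> ('a \<Rightarrow> real) set \<Rightarrow> 'a measure" where
  "gen_sigma M Y = sigma (space M) {f -` A \<inter> space M | f A. f \<in> Y \<and> A \<in> sets borel}"

lemma space_gen_sigma [simp]: "space (gen_sigma M Y) = space M"
  by (simp add: gen_sigma_def space_measure_of_conv)

lemma sets_gen_sigma: "sets (gen_sigma M Y) = generated_events M Y"
  unfolding gen_sigma_def generated_events_def by (rule sets_measure_of) auto

lemma measurable_gen_sigma: "f \<in> Y \<Longrightarrow> f \<in> borel_measurable (gen_sigma M Y)"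
  by (rule measurableI) (auto simp: sets_gen_sigma generated_events_def)

text \<open>Independence is assumed for generated sigma-algebras, so any two maps measurable with
  respect to them inherit it, whatever their codomains: the joint law is a product, which is checked
  on rectangles.\<close>

lemma
  assumes "prob_space M"
    and ind: "prob_space.indep_set M (generated_events M Y) (generated_events M Z)"
    and X: "X \<in> gen_sigma M Y \<rightarrow>\<^sub>M N1" and W: "W \<in> gen_sigma M Z \<rightarrow>\<^sub>M N2"
  shows indep_generated_measurable1: "X \<in> M \<rightarrow>\<^sub>M N1"
    and indep_generated_measurable2: "W \<in> M \<rightarrow>\<^sub>M N2"
    and indep_generated_nn_integral: "h \<in> borel_measurable (N1 \<Otimes>\<^sub>M N2) \<Longrightarrow>
      (\<integral>\<^sup>+\<omega>. h (X \<omega>, W \<omega>) \<partial>M) = (\<integral>\<^sup>+x. \<integral>\<^sup>+w. h (x, w) \<partial>distr M N2 W \<partial>distr M N1 X)"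
proof -
  interpret prob_space M by fact
  have sub: "generated_events M Y \<subseteq> events" "generated_events M Z \<subseteq> events"
    and prod: "\<And>a b. a \<in> generated_events M Y \<Longrightarrow> b \<in> generated_events M Z \<Longrightarrow> prob (a \<inter> b) = prob a * prob b"
    using ind unfolding indep_sets2_eq by auto
  show XM[measurable]: "X \<in> M \<rightarrow>\<^sub>M N1" using X sub(1) by (auto simp: measurable_def sets_gen_sigma)
  show WM[measurable]: "W \<in> M \<rightarrow>\<^sub>M N2" using W sub(2) by (auto simp: measurable_def sets_gen_sigma)
  interpret N1: prob_space "distr M N1 X" by (rule prob_space_distr) (rule XM)
  interpret N2: prob_space "distr M N2 W" by (rule prob_space_distr) (rule WM)
  have eq: "distr M N1 X \<Otimes>\<^sub>M distr M N2 W = distr M (N1 \<Otimes>\<^sub>M N2) (\<lambda>\<omega>. (X \<omega>, W \<omega>))"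
  proof (rule pair_measure_eqI)
    fix A B assume "A \<in> sets (distr M N1 X)" "B \<in> sets (distr M N2 W)"
    then have [measurable]: "A \<in> sets N1" "B \<in> sets N2" by simp_all
    have "X -` A \<inter> space M \<in> generated_events M Y" "W -` B \<inter> space M \<in> generated_events M Z"
      using measurable_sets[OF X, of A] measurable_sets[OF W, of B] by (simp_all add: sets_gen_sigma)
    then have "prob ((X -` A \<inter> space M) \<inter> (W -` B \<inter> space M)) = prob (X -` A \<inter> space M) * prob (W -` B \<inter> space M)"
      by (rule prod)
    moreover have "(\<lambda>\<omega>. (X \<omega>, W \<omega>)) -` (A \<times> B) \<inter> space M = (X -` A \<inter> space M) \<inter> (W -` B \<inter> space M)" by auto
    ultimately show "emeasure (distr M N1 X) A * emeasure (distr M N2 W) B =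
        emeasure (distr M (N1 \<Otimes>\<^sub>M N2) (\<lambda>\<omega>. (X \<omega>, W \<omega>))) (A \<times> B)"
      by (simp add: emeasure_distr emeasure_eq_measure ennreal_mult)
  qed (simp_all add: N1.sigma_finite_measure_axioms N2.sigma_finite_measure_axioms cong: sets_pair_measure_cong)
  assume h[measurable]: "h \<in> borel_measurable (N1 \<Otimes>\<^sub>M N2)"
  have "(\<integral>\<^sup>+\<omega>. h (X \<omega>, W \<omega>) \<partial>M) = (\<integral>\<^sup>+p. h p \<partial>distr M (N1 \<Otimes>\<^sub>M N2) (\<lambda>\<omega>. (X \<omega>, W \<omega>)))"
    by (rule nn_integral_distr[symmetric]) measurable
  also have "\<dots> = (\<integral>\<^sup>+x. \<integral>\<^sup>+w. h (x, w) \<partial>distr M N2 W \<partial>distr M N1 X)"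
    unfolding eq[symmetric] by (rule N2.nn_integral_fst[symmetric]) simp
  finally show "(\<integral>\<^sup>+\<omega>. h (X \<omega>, W \<omega>) \<partial>M) = (\<integral>\<^sup>+x. \<integral>\<^sup>+w. h (x, w) \<partial>distr M N2 W \<partial>distr M N1 X)" .
qed

text \<open>Steps are indexed from 0 but angles from 1; this moves independence along the shift
  \<open>Suc\<close>.\<close>

lemma (in prob_space) indep_sets_reindex:
  assumes ind: "indep_sets F (f ` I)" and inj: "inj_on f I"
  shows "indep_sets (\<lambda>i. F (f i)) I"
proof (rule indep_setsI)
  show "F (f i) \<subseteq> events" if "i \<in> I" for i
    using ind that by (auto simp: indep_sets_def)
  fix A J assume J: "J \<noteq> {}" "J \<subseteq> I" "finite J" "\<forall>j\<in>J. A j \<in> F (f j)"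
  have inj': "inj_on f J" using inj J(2) by (rule inj_on_subset)
  have inv: "inv_into J f (f j) = j" if "j \<in> J" for j using inj' that by simp
  have "prob (\<Inter>k\<in>f ` J. A (inv_into J f k)) = (\<Prod>k\<in>f ` J. prob (A (inv_into J f k)))"
  proof (rule indep_setsD[OF ind])
    show "f ` J \<subseteq> f ` I" "f ` J \<noteq> {}" "finite (f ` J)" using J by auto
    show "\<forall>k\<in>f ` J. A (inv_into J f k) \<in> F k" using J(4) inv by simp
  qed
  then show "prob (\<Inter>j\<in>J. A j) = (\<Prod>j\<in>J. prob (A j))"
    using inv by (simp add: prod.reindex[OF inj'])
qed

text \<open>Strictly increasing event times make the events up to s an initial segment of the
  indices.\<close>

lemma event_count_eq_iff:
  assumes inc: "\<And>k. S k \<omega> < S (Suc k) \<omega>" and n: "1 \<le> n"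
  shows "event_count S s \<omega> = n \<longleftrightarrow> S n \<omega> \<le> s \<and> s < S (Suc n) \<omega>"
proof -
  have mono: "S i \<omega> \<le> S j \<omega>" if "i \<le> j" for i j
  proof (rule lift_Suc_mono_le[where f = "\<lambda>k. S k \<omega>"])
    show "S k \<omega> \<le> S (Suc k) \<omega>" for k using inc[of k] by simp
  qed (rule that)
  let ?A = "{k. 1 \<le> k \<and> S k \<omega> \<le> s}"
  show ?thesis
  proof
    assume *: "S n \<omega> \<le> s \<and> s < S (Suc n) \<omega>"
    have "S k \<omega> \<le> s \<longleftrightarrow> k \<le> n" for k
    proof (cases "k \<le> n")
      case True
      with mono[OF True] * show ?thesis by simp
    next
      case False
      then have "S (Suc n) \<omega> \<le> S k \<omega>" by (intro mono) simp
      with * False show ?thesis by simp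
    qed
    then have "?A = {k. 1 \<le> k \<and> k \<le> n}" by (simp only:)
    also have "\<dots> = {1..n}" by auto
    finally have "?A = {1..n}" .
    then show "event_count S s \<omega> = n" by (simp add: event_count_def)
  next
    assume c: "event_count S s \<omega> = n"
    \<comment> \<open>A positive cardinality excludes an infinite set, to which \<open>card\<close>
      assigns 0; this is where n being at least 1 matters.\<close>
    then have fin: "finite ?A" using n unfolding event_count_def by (intro card_ge_0_finite) simp
    have "S n \<omega> \<le> s"
    proof (rule ccontr)
      assume "\<not> S n \<omega> \<le> s"
      then have "k < n" if "S k \<omega> \<le> s" for k
        using mono[of n k] that by (cases "k < n") auto
      then have "?A \<subseteq> {1..<n}" by (intro subsetI) simp
      then have "card ?A \<le> card {1..<n}" by (intro card_mono) auto
      with c n show False by (simp add: event_count_def)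
    qed
    moreover have "s < S (Suc n) \<omega>"
    proof (rule ccontr)
      assume "\<not> s < S (Suc n) \<omega>"
      then have "S k \<omega> \<le> s" if "k \<le> Suc n" for k
        using mono[OF that] by simp
      then have "{1..Suc n} \<subseteq> ?A" by (intro subsetI) simp
      then have "card {1..Suc n} \<le> card ?A" using fin by (intro card_mono)
      with c show False by (simp add: event_count_def)
    qed
    ultimately show "S n \<omega> \<le> s \<and> s < S (Suc n) \<omega>" by simp
  qed
qed

text \<open>Steps replace event times throughout, even for the start of the last epoch, so that the
  value is a function of the coordinates of the product measures.\<close>

lemma random_flight_eq:
  assumes "event_count S s \<omega> = n" "1 \<le> n" "S 0 \<omega> = 0"
  shows "random_flight c S \<theta> s \<omega> = c * ((\<Sum>j<n. (S (Suc j) \<omega> - S j \<omega>) * cos (\<theta> (Suc j) \<omega>)) +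
    (s - (\<Sum>j<n. S (Suc j) \<omega> - S j \<omega>)) * cos (\<theta> (Suc n) \<omega>))"
proof -
  have "(\<Sum>j<n. S (Suc j) \<omega> - S j \<omega>) = S n \<omega>"
    using assms(3) sum_lessThan_telescope[of "\<lambda>j. S j \<omega>" n] by simp
  moreover have "(\<Sum>j = 1..n + 1. (switch_time S s \<omega> j - switch_time S s \<omega> (j - 1)) * cos (\<theta> j \<omega>)) =
      (\<Sum>j<Suc n. (switch_time S s \<omega> (Suc j) - switch_time S s \<omega> j) * cos (\<theta> (Suc j) \<omega>))"
    using sum.atLeast1_atMost_eq[of "\<lambda>j. (switch_time S s \<omega> j - switch_time S s \<omega> (j - 1)) * cos (\<theta> j \<omega>)" "n + 1"]
    by simp
  moreover have "\<dots> = (\<Sum>j<n. (S (Suc j) \<omega> - S j \<omega>) * cos (\<theta> (Suc j) \<omega>)) + (s - S n \<omega>) * cos (\<theta> (Suc n) \<omega>)"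
    using assms(1) by (simp add: switch_time_def)
  ultimately show ?thesis using assms(1) by (simp add: random_flight_def)
qed

section \<open>The flight with n events on a fixed time interval\<close>

locale flight =
  fixes M :: "'a measure" and c rate :: real and m :: nat and S \<theta> :: "nat \<Rightarrow> 'a \<Rightarrow> real"
  assumes prob: "prob_space M" and c: "0 < c" and rate: "0 < rate" and m: "m \<in> {0, 1}"
    and poisson: "poisson_event_times M rate S" and angles: "iid_angles M m \<theta>"
    and indep: "prob_space.indep_set M (generated_events M (range S)) (generated_events M (\<theta> ` {1..}))"
begin

sublocale prob_space M by (rule prob)

abbreviation "\<tau> \<equiv> \<lambda>k \<omega>. S (Suc k) \<omega> - S k \<omega>"

lemma S_0: "\<omega> \<in> space M \<Longrightarrow> S 0 \<omega> = 0"
  using poisson by (simp add: poisson_event_times_def)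

lemma distributed_step: "distributed M lborel (\<tau> k) (\<lambda>x. ennreal (exponential_density rate x))"
  using poisson by (simp add: poisson_event_times_def)

lemma measurable_step [measurable]: "\<tau> k \<in> borel_measurable M"
  using distributed_measurable[OF distributed_step[of k]] by simp

lemma measurable_S [measurable]: "S k \<in> borel_measurable M"
proof (induction k)
  case 0
  show ?case by (subst measurable_cong[OF S_0]) simp_all
next
  case (Suc k)
  then have "(\<lambda>\<omega>. (S (Suc k) \<omega> - S k \<omega>) + S k \<omega>) \<in> borel_measurable M"
    by (intro borel_measurable_add measurable_step)
  then show ?case by simp
qed

lemma measurable_angle: "1 \<le> j \<Longrightarrow> \<theta> j \<in> borel_measurable M"
  using angles distributed_measurable[of M lborel "\<theta> j"] by (auto simp: iid_angles_def)

lemma distr_step: "distr M borel (\<tau> k) = gamma_measure 1 rate"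
proof -
  have "distr M borel (\<tau> k) = distr M lborel (\<tau> k)" by (rule distr_cong) simp_all
  also have "\<dots> = gamma_measure 1 rate"
    using distributed_distr_eq_density[OF distributed_step] exponential_eq_gamma_measure[OF rate] by simp
  finally show ?thesis .
qed

lemma distr_angle: "1 \<le> j \<Longrightarrow> distr M borel (\<theta> j) = angle_measure m"
proof -
  assume "1 \<le> j"
  have "distr M borel (\<theta> j) = distr M lborel (\<theta> j)" by (rule distr_cong) simp_all
  also have "\<dots> = angle_measure m"
    using \<open>1 \<le> j\<close> angles distributed_distr_eq_density[of M lborel "\<theta> j"]
    by (simp add: iid_angles_def angle_measure_def)
  finally show ?thesis .
qed

lemma AE_increasing: "AE \<omega> in M. \<forall>k. S k \<omega> < S (Suc k) \<omega>"
proof (subst AE_all_countable, rule allI)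
  fix k
  have "AE x in gamma_measure 1 rate. 0 < x"
    unfolding gamma_measure_def by (subst AE_density) (auto simp: gamma_density_def)
  then have "AE x in distr M borel (\<tau> k). 0 < x" by (simp only: distr_step)
  then show "AE \<omega> in M. S k \<omega> < S (Suc k) \<omega>" by (subst (asm) AE_distr_iff) auto
qed

lemma measurable_event_count [measurable]: "event_count S s \<in> M \<rightarrow>\<^sub>M count_space UNIV"
  unfolding event_count_def[abs_def] by measurable

lemma measurable_random_flight [measurable]: "random_flight c S \<theta> s \<in> borel_measurable M"
proof -
  have [measurable]: "\<theta> (Suc j) \<in> borel_measurable M" for j by (simp add: measurable_angle)
  \<comment> \<open>The count determines the number of summands, so measurability is checked for
    each of its countably many values.\<close>
  have "(\<lambda>\<omega>. c * (\<Sum>j<Suc (event_count S s \<omega>). ((if Suc j \<le> event_count S s \<omega> then S (Suc j) \<omega> else s) -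
      (if j \<le> event_count S s \<omega> then S j \<omega> else s)) * cos (\<theta> (Suc j) \<omega>))) \<in> borel_measurable M"
    by (rule measurable_compose_countable[OF _ measurable_event_count]) measurable
  also have "(\<lambda>\<omega>. c * (\<Sum>j<Suc (event_count S s \<omega>). ((if Suc j \<le> event_count S s \<omega> then S (Suc j) \<omega> else s) -
      (if j \<le> event_count S s \<omega> then S j \<omega> else s)) * cos (\<theta> (Suc j) \<omega>))) = random_flight c S \<theta> s"
  proof (rule ext)
    fix \<omega>
    show "c * (\<Sum>j<Suc (event_count S s \<omega>). ((if Suc j \<le> event_count S s \<omega> then S (Suc j) \<omega> else s) -
      (if j \<le> event_count S s \<omega> then S j \<omega> else s)) * cos (\<theta> (Suc j) \<omega>)) = random_flight c S \<theta> s \<omega>"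
      using sum.atLeast1_atMost_eq[of "\<lambda>j. (switch_time S s \<omega> j - switch_time S s \<omega> (j - 1)) * cos (\<theta> j \<omega>)"
          "event_count S s \<omega> + 1"]
      by (simp add: random_flight_def switch_time_def del: sum.lessThan_Suc)
  qed
  finally show ?thesis .
qed

text \<open>This vector and the next are measurable with respect to the two independent
  sigma-algebras. In \<open>angle_vec\<close> the index is shifted so that coordinate i of both
  belongs to the same epoch.\<close>

definition step_vec :: "nat \<Rightarrow> 'a \<Rightarrow> nat \<Rightarrow> real" where
  "step_vec n \<omega> = (\<lambda>i\<in>{..<Suc n}. \<tau> i \<omega>)"

definition angle_vec :: "nat \<Rightarrow> 'a \<Rightarrow> nat \<Rightarrow> real" where
  "angle_vec n \<omega> = (\<lambda>i\<in>{..<Suc n}. \<theta> (Suc i) \<omega>)"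

lemma distr_step_vec: "distr M (PiM {..<Suc n} (\<lambda>_. borel)) (step_vec n) = PiM {..<Suc n} (\<lambda>_. gamma_measure 1 rate)"
proof -
  have "indep_vars (\<lambda>_. borel) \<tau> {..<Suc n}"
    using poisson by (auto simp: poisson_event_times_def intro: indep_vars_subset)
  then show ?thesis
    unfolding step_vec_def[abs_def]
    by (subst (asm) indep_vars_iff_distr_eq_PiM') (auto simp: distr_step)
qed

lemma distr_angle_vec: "distr M (PiM {..<Suc n} (\<lambda>_. borel)) (angle_vec n) = PiM {..<Suc n} (\<lambda>_. angle_measure m)"
proof -
  have "indep_vars (\<lambda>_. borel) \<theta> {1..}" using angles by (simp add: iid_angles_def)
  then have "indep_sets (\<lambda>i. {\<theta> (Suc i) -` A \<inter> space M | A. A \<in> sets borel}) {..<Suc n}"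
    unfolding indep_vars_def2 by (intro indep_sets_reindex[of _ Suc]) (auto intro: indep_sets_mono_index[rotated])
  then have "indep_vars (\<lambda>_. borel) (\<lambda>i. \<theta> (Suc i)) {..<Suc n}"
    by (simp add: indep_vars_def2 measurable_angle)
  then show ?thesis
    unfolding angle_vec_def[abs_def]
    by (subst (asm) indep_vars_iff_distr_eq_PiM') (auto simp: distr_angle measurable_angle)
qed

text \<open>Here r is the n-th event time and \<open>exp (- rate * (s - r))\<close> the chance that
  no further event comes up to s. The exponentials combine to a constant, so r / s keeps only the
  power density of Beta(n, 1), and the Poisson probability of n events comes out as the
  factor.\<close>

lemma gamma_exponential_tail:
  fixes g :: "real \<Rightarrow> ennreal"
  assumes n: "1 \<le> n" and s: "0 < s" and [measurable]: "g \<in> borel_measurable borel"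
  shows "(\<integral>\<^sup>+r. ennreal (exp (- rate * (s - r))) * g (r / s) * indicator {..s} r \<partial>gamma_measure (real n) rate) =
    ennreal ((rate * s) ^ n / fact n * exp (- rate * s)) * (\<integral>\<^sup>+q. g q \<partial>beta_measure (real n) 1)"
proof -
  have "(\<integral>\<^sup>+r. ennreal (exp (- rate * (s - r))) * g (r / s) * indicator {..s} r \<partial>gamma_measure (real n) rate) =
    (\<integral>\<^sup>+r. ennreal (gamma_density (real n) rate r) * (ennreal (exp (- rate * (s - r))) * g (r / s) * indicator {..s} r) \<partial>lborel)"
    by (rule nn_integral_gamma_measure) measurable
  also have "\<dots> = ennreal s * (\<integral>\<^sup>+q. ennreal (gamma_density (real n) rate (s * q)) *
      (ennreal (exp (- rate * (s - s * q))) * g q * indicator {..s} (s * q)) \<partial>lborel)"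
    using s by (subst nn_integral_real_affine[where c = s and t = 0]) simp_all
  also have "\<dots> = (\<integral>\<^sup>+q. ennreal s * (ennreal (gamma_density (real n) rate (s * q)) *
      (ennreal (exp (- rate * (s - s * q))) * g q * indicator {..s} (s * q))) \<partial>lborel)"
    by (rule nn_integral_cmult[symmetric]) measurable
  also have "\<dots> = (\<integral>\<^sup>+q. ennreal ((rate * s) ^ n / fact n * exp (- rate * s)) *
      (ennreal (beta_density (real n) 1 q) * g q) \<partial>lborel)"
  \<comment> \<open>At q = 1 the indicator is still 1 while \<open>beta_density\<close> is cut off,
    so the endpoints are left to a null set.\<close>
  proof (intro nn_integral_cong_AE AE_I[where N = "{0, 1}"] subsetI)
    fix q assume *: "q \<in> {q \<in> space lborel. ennreal s * (ennreal (gamma_density (real n) rate (s * q)) *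
      (ennreal (exp (- rate * (s - s * q))) * g q * indicator {..s} (s * q))) \<noteq>
      ennreal ((rate * s) ^ n / fact n * exp (- rate * s)) * (ennreal (beta_density (real n) 1 q) * g q)}"
    show "q \<in> {0, 1}"
    proof (rule ccontr)
      assume q: "q \<notin> {0, 1}"
      have "ennreal s * (ennreal (gamma_density (real n) rate (s * q)) *
          (ennreal (exp (- rate * (s - s * q))) * g q * indicator {..s} (s * q))) =
        ennreal ((rate * s) ^ n / fact n * exp (- rate * s)) * (ennreal (beta_density (real n) 1 q) * g q)"
      proof (cases "0 < q \<and> q < 1")
        case True
        obtain k where k: "n = Suc k" using n by (cases n) auto
        have G: "Gamma (real n) = fact k" "Gamma (real n + 1) = fact n"
          using Gamma_fact[of k, where 'a = real] Gamma_fact[of n, where 'a = real] by (simp_all add: k add.commute)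
        have e: "exp (- rate * (s * q)) * exp (- rate * (s - s * q)) = exp (- rate * s)"
          by (simp add: algebra_simps flip: exp_add)
        have p: "(s * q) powr (real n - 1) = s ^ k * q ^ k" "q powr (real n - 1) = q ^ k"
          using True s by (simp_all add: k powr_realpow power_mult_distrib)
        have gd: "gamma_density (real n) rate (s * q) = rate ^ n / fact k * (s ^ k * q ^ k) * exp (- rate * (s * q))"
          using True s rate by (simp only: gamma_density_def p G) (simp add: powr_realpow)
        have bd: "beta_density (real n) 1 q = q ^ k * fact n / fact k"
          using True by (simp only: beta_density_def Beta_def p G) simp
        have "s * (gamma_density (real n) rate (s * q) * exp (- rate * (s - s * q))) =
            rate ^ n * (s * s ^ k) / fact k * q ^ k * (exp (- rate * (s * q)) * exp (- rate * (s - s * q)))"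
          unfolding gd by simp
        also have "\<dots> = (rate * s) ^ n / fact n * exp (- rate * s) * beta_density (real n) 1 q"
          unfolding e bd by (simp add: k power_mult_distrib del: fact_Suc)
        finally have "s * (gamma_density (real n) rate (s * q) * exp (- rate * (s - s * q))) =
            (rate * s) ^ n / fact n * exp (- rate * s) * beta_density (real n) 1 q" .
        then have eq: "ennreal s * (ennreal (gamma_density (real n) rate (s * q)) * ennreal (exp (- rate * (s - s * q)))) =
            ennreal ((rate * s) ^ n / fact n * exp (- rate * s)) * ennreal (beta_density (real n) 1 q)"
          using s n rate by (simp add: gamma_density_nonneg beta_density_nonneg flip: ennreal_mult)
        have one: "indicator {..s} (s * q) = (1 :: ennreal)" using True s by simp
        have "ennreal s * (ennreal (gamma_density (real n) rate (s * q)) *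
            (ennreal (exp (- rate * (s - s * q))) * g q * indicator {..s} (s * q))) =
          ennreal s * (ennreal (gamma_density (real n) rate (s * q)) * ennreal (exp (- rate * (s - s * q)))) * g q"
          unfolding one by (simp only: mult_1_right mult.assoc)
        also note eq
        finally show ?thesis by (simp only: mult.assoc)
      next
        case False
        then have "q < 0 \<or> 1 < q" using q by auto
        then show ?thesis
          using s by (auto simp: gamma_density_def beta_density_def zero_less_mult_iff)
      qed
      with * show False by simp
    qed
  qed (auto simp: emeasure_lborel_countable)
  also have "\<dots> = ennreal ((rate * s) ^ n / fact n * exp (- rate * s)) * (\<integral>\<^sup>+q. g q \<partial>beta_measure (real n) 1)"
    by (subst nn_integral_cmult) (simp_all add: nn_integral_beta_measure)
  finally show ?thesis .
qed

lemma emeasure_exponential_tail: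
  assumes "0 \<le> a"
  shows "emeasure (gamma_measure 1 rate) {a<..} = ennreal (exp (- rate * a))"
proof -
  have "emeasure (gamma_measure 1 rate) {a<..} = emeasure M (\<tau> 0 -` {a<..} \<inter> space M)"
    unfolding distr_step[of 0, symmetric] by (rule emeasure_distr) measurable
  also have "\<tau> 0 -` {a<..} \<inter> space M = {\<omega> \<in> space M. a < \<tau> 0 \<omega>}" by auto
  finally show ?thesis
    using exponential_distributedD_gt[OF distributed_step[of 0] assms rate]
    by (simp add: emeasure_eq_measure ac_simps)
qed

text \<open>Unnormalised on purpose: the Poisson probability and the conditional law come out
  together, and g = 1 gives the probability of the conditioning event.\<close>

lemma nn_integral_flight_count:
  fixes g :: "real \<Rightarrow> ennreal"
  assumes n: "1 \<le> n" and s: "0 < s" and [measurable]: "g \<in> borel_measurable borel"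
  shows "(\<integral>\<^sup>+\<omega>. g (random_flight c S \<theta> s \<omega>) * indicator {\<omega>. event_count S s \<omega> = n} \<omega> \<partial>M) =
    ennreal ((rate * s) ^ n / fact n * exp (- rate * s)) *
      (\<integral>\<^sup>+x. g (c * s * x) \<partial>sym_beta_measure (flight_order m n))"
proof -
  \<comment> \<open>The indicators encode that the n-th event is at most s and the next one later.
    The last step t only decides whether the epoch reaches past s; its contribution to the position
    has length s - r.\<close>
  define G :: "real \<times> real \<times> real \<times> real \<Rightarrow> ennreal" where
    "G = (\<lambda>(r, x, t, a). g (c * (x + (s - r) * cos a)) * indicator {..s} r * indicator {0<..} (r + t - s))"
  have ind: "indicator {0<..} (r + t - s) = (indicator {s - r<..} t :: ennreal)" for r t
    by (auto simp: indicator_def)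
  have [measurable]: "G \<in> borel_measurable (borel \<Otimes>\<^sub>M borel \<Otimes>\<^sub>M borel \<Otimes>\<^sub>M borel)"
    unfolding G_def by measurable
  define H :: "(nat \<Rightarrow> real) \<times> (nat \<Rightarrow> real) \<Rightarrow> ennreal" where
    "H = (\<lambda>p. G (\<Sum>j<n. fst p j, \<Sum>j<n. fst p j * cos (snd p j), fst p n, snd p n))"
  have H[measurable]: "H \<in> borel_measurable (PiM {..<Suc n} (\<lambda>_. borel) \<Otimes>\<^sub>M PiM {..<Suc n} (\<lambda>_. borel))"
    unfolding H_def by measurable
  have sv: "step_vec n \<in> gen_sigma M (range S) \<rightarrow>\<^sub>M PiM {..<Suc n} (\<lambda>_. borel)"
    unfolding step_vec_def[abs_def]
    by (intro measurable_restrict borel_measurable_diff measurable_gen_sigma) auto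
  have av: "angle_vec n \<in> gen_sigma M (\<theta> ` {1..}) \<rightarrow>\<^sub>M PiM {..<Suc n} (\<lambda>_. borel)"
    unfolding angle_vec_def[abs_def]
    by (intro measurable_restrict measurable_gen_sigma) auto
  let ?E = "gamma_measure 1 rate" and ?A = "angle_measure m" and ?Z = "sym_beta_measure (flight_order m 0)"
  have E: "prob_space ?E" using rate by (simp add: prob_space_gamma_measure)
  have A: "prob_space ?A" by (rule prob_space_angle_measure[OF m])
  interpret A: prob_space ?A by (rule A)
  interpret E: prob_space ?E by (rule E)
  interpret Z: real_distribution ?Z by (rule real_distribution_sym_beta)
  obtain n' where n': "n = Suc n'" using n by (cases n) auto
  interpret Y: real_distribution "sym_beta_measure (flight_order m n')" by (rule real_distribution_sym_beta)
  have "(\<integral>\<^sup>+\<omega>. g (random_flight c S \<theta> s \<omega>) * indicator {\<omega>. event_count S s \<omega> = n} \<omega> \<partial>M) =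
      (\<integral>\<^sup>+\<omega>. H (step_vec n \<omega>, angle_vec n \<omega>) \<partial>M)"
  \<comment> \<open>The count is described by two event times only where these increase strictly,
    hence an almost sure identity.\<close>
  proof (rule nn_integral_cong_AE, use AE_increasing AE_space in eventually_elim)
    fix \<omega> assume inc: "\<forall>k. S k \<omega> < S (Suc k) \<omega>" and \<omega>: "\<omega> \<in> space M"
    have iff: "event_count S s \<omega> = n \<longleftrightarrow> S n \<omega> \<le> s \<and> s < S (Suc n) \<omega>"
      by (rule event_count_eq_iff) (use inc n in auto)
    have sum: "(\<Sum>j<n. S (Suc j) \<omega> - S j \<omega>) = S n \<omega>"
      using S_0[OF \<omega>] sum_lessThan_telescope[of "\<lambda>j. S j \<omega>" n] by simp
    have H': "H (step_vec n \<omega>, angle_vec n \<omega>) =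
      G (\<Sum>j<n. \<tau> j \<omega>, \<Sum>j<n. \<tau> j \<omega> * cos (\<theta> (Suc j) \<omega>), \<tau> n \<omega>, \<theta> (Suc n) \<omega>)"
      by (simp add: H_def step_vec_def angle_vec_def)
    show "g (random_flight c S \<theta> s \<omega>) * indicator {\<omega>. event_count S s \<omega> = n} \<omega> =
        H (step_vec n \<omega>, angle_vec n \<omega>)"
    proof (cases "event_count S s \<omega> = n")
      case True
      then show ?thesis
        using iff random_flight_eq[OF True n S_0[OF \<omega>], of c \<theta>] unfolding H' by (simp add: G_def sum)
    next
      case False
      with iff show ?thesis unfolding H' by (auto simp: G_def sum indicator_def)
    qed
  qed
  also have "\<dots> = (\<integral>\<^sup>+t. \<integral>\<^sup>+a. H (t, a) \<partial>PiM {..<Suc n} (\<lambda>_. ?A) \<partial>PiM {..<Suc n} (\<lambda>_. ?E))"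
    unfolding distr_step_vec[symmetric] distr_angle_vec[symmetric]
    by (rule indep_generated_nn_integral[OF prob indep sv av H])
  also have "\<dots> = (\<integral>\<^sup>+\<tau>. \<integral>\<^sup>+\<theta>. \<integral>\<^sup>+t. \<integral>\<^sup>+a. G (\<Sum>j<n. \<tau> j, \<Sum>j<n. \<tau> j * cos (\<theta> j), t, a)
      \<partial>?A \<partial>?E \<partial>PiM {..<n} (\<lambda>_. ?A) \<partial>PiM {..<n} (\<lambda>_. ?E))"
    unfolding H_def fst_conv snd_conv
    by (rule walk_split[OF E _ A]) simp_all
  \<comment> \<open>The first n steps are complete, and n complete steps have the order of n - 1
    events.\<close>
  also have "\<dots> = (\<integral>\<^sup>+r. \<integral>\<^sup>+y. \<integral>\<^sup>+t. \<integral>\<^sup>+a. G (r, r * y, t, a) \<partial>?A \<partial>?E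
      \<partial>sym_beta_measure (flight_order m n') \<partial>gamma_measure (real n) rate)"
    unfolding n' by (rule walk_law[OF m rate, where g = "\<lambda>r x. \<integral>\<^sup>+t. \<integral>\<^sup>+a. G (r, x, t, a) \<partial>?A \<partial>?E"]) measurable
  \<comment> \<open>Integrating out t leaves the exponential tail, and dividing times by s exhibits
    the share r / s.\<close>
  also have "\<dots> = (\<integral>\<^sup>+r. ennreal (exp (- rate * (s - r))) * (\<integral>\<^sup>+y. \<integral>\<^sup>+z. g (c * s * ((r / s) * y + (1 - r / s) * z)) \<partial>?Z
      \<partial>sym_beta_measure (flight_order m n')) * indicator {..s} r \<partial>gamma_measure (real n) rate)"
  proof (rule nn_integral_cong)
    fix r :: real
    let ?Y = "sym_beta_measure (flight_order m n')"
    have "(\<integral>\<^sup>+y. \<integral>\<^sup>+t. \<integral>\<^sup>+a. G (r, r * y, t, a) \<partial>?A \<partial>?E \<partial>?Y) =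
      (\<integral>\<^sup>+y. \<integral>\<^sup>+t. \<integral>\<^sup>+a. g (c * (r * y + (s - r) * cos a)) * (indicator {..s} r * indicator {s - r<..} t) \<partial>?A \<partial>?E \<partial>?Y)"
      by (simp add: G_def mult.assoc ind)
    also have "\<dots> = (\<integral>\<^sup>+y. (\<integral>\<^sup>+z. g (c * (r * y + (s - r) * z)) \<partial>?Z) *
        (\<integral>\<^sup>+t. indicator {..s} r * indicator {s - r<..} t \<partial>?E) \<partial>?Y)"
      by (simp add: nn_integral_multc nn_integral_cmult angle_measure_def
          nn_integral_cos_angle[OF m, of "\<lambda>z. g (c * (r * _ + (s - r) * z))"])
    also have "\<dots> = (\<integral>\<^sup>+y. (\<integral>\<^sup>+z. g (c * (r * y + (s - r) * z)) \<partial>?Z) \<partial>?Y) *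
        (\<integral>\<^sup>+t. indicator {..s} r * indicator {s - r<..} t \<partial>?E)"
      by (rule nn_integral_multc) measurable
    also have "(\<integral>\<^sup>+t. indicator {..s} r * indicator {s - r<..} t \<partial>?E) = ennreal (exp (- rate * (s - r))) * indicator {..s} r"
      by (cases "r \<le> s") (simp_all add: nn_integral_cmult emeasure_exponential_tail)
    also have "(\<integral>\<^sup>+y. (\<integral>\<^sup>+z. g (c * (r * y + (s - r) * z)) \<partial>?Z) \<partial>?Y) =
        (\<integral>\<^sup>+y. \<integral>\<^sup>+z. g (c * s * ((r / s) * y + (1 - r / s) * z)) \<partial>?Z \<partial>?Y)"
    proof -
      have "c * s * ((r / s) * y + (1 - r / s) * z) = c * (r * y + (s - r) * z)" for y z
        using s by (simp add: field_simps)
      then show ?thesis by (simp only:)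
    qed
    finally show "(\<integral>\<^sup>+y. \<integral>\<^sup>+t. \<integral>\<^sup>+a. G (r, r * y, t, a) \<partial>?A \<partial>?E \<partial>?Y) =
        ennreal (exp (- rate * (s - r))) * (\<integral>\<^sup>+y. \<integral>\<^sup>+z. g (c * s * ((r / s) * y + (1 - r / s) * z)) \<partial>?Z
        \<partial>?Y) * indicator {..s} r"
      by (simp only: ac_simps)
  qed
  \<comment> \<open>Given n events, the share of the past is Beta(n, 1), as
    \<open>sym_beta_step\<close> requires next.\<close>
  also have "\<dots> = ennreal ((rate * s) ^ n / fact n * exp (- rate * s)) *
      (\<integral>\<^sup>+q. \<integral>\<^sup>+y. \<integral>\<^sup>+z. g (c * s * (q * y + (1 - q) * z)) \<partial>?Z
      \<partial>sym_beta_measure (flight_order m n') \<partial>beta_measure (real n) 1)"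
    by (rule gamma_exponential_tail[OF n s, where g = "\<lambda>q. \<integral>\<^sup>+y. \<integral>\<^sup>+z. g (c * s * (q * y + (1 - q) * z)) \<partial>?Z
      \<partial>sym_beta_measure (flight_order m n')"]) measurable
  also have "\<dots> = ennreal ((rate * s) ^ n / fact n * exp (- rate * s)) *
      (\<integral>\<^sup>+x. g (c * s * x) \<partial>sym_beta_measure (flight_order m n))"
  proof (rule arg_cong[where f = "\<lambda>x. ennreal ((rate * s) ^ n / fact n * exp (- rate * s)) * x"])
    have d: "n - 1 = n'" using n' by simp
    have "(\<lambda>x. g (c * s * x)) \<in> borel_measurable borel" by measurable
    from sym_beta_step[OF m n this]
    show "(\<integral>\<^sup>+q. \<integral>\<^sup>+y. \<integral>\<^sup>+z. g (c * s * (q * y + (1 - q) * z)) \<partial>?Z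
        \<partial>sym_beta_measure (flight_order m n') \<partial>beta_measure (real n) 1) =
      (\<integral>\<^sup>+x. g (c * s * x) \<partial>sym_beta_measure (flight_order m n))" unfolding d .
  qed
  finally show ?thesis .
qed

lemma emeasure_count:
  assumes "1 \<le> n" "0 < s"
  shows "emeasure M {\<omega> \<in> space M. event_count S s \<omega> = n} = ennreal ((rate * s) ^ n / fact n * exp (- rate * s))"
proof -
  interpret L: real_distribution "sym_beta_measure (flight_order m n)" by (rule real_distribution_sym_beta)
  have "emeasure M {\<omega> \<in> space M. event_count S s \<omega> = n} = (\<integral>\<^sup>+\<omega>. indicator {\<omega> \<in> space M. event_count S s \<omega> = n} \<omega> \<partial>M)"
    by (rule nn_integral_indicator[symmetric]) measurable
  also have "\<dots> = (\<integral>\<^sup>+\<omega>. 1 * indicator {\<omega>. event_count S s \<omega> = n} \<omega> \<partial>M)"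
    by (intro nn_integral_cong) (auto simp: indicator_def)
  finally show ?thesis
    using nn_integral_flight_count[OF assms, of "\<lambda>_. 1"] L.emeasure_space_1 by simp
qed

text \<open>The Poisson probability cancels in the quotient, and with it every trace of the
  rate.\<close>

lemma cond_law_pos:
  assumes n: "1 \<le> n" and s: "0 < s"
  shows "cond_law_given_count M (random_flight c S \<theta>) (event_count S) n s =
    distr (sym_beta_measure (flight_order m n)) borel (\<lambda>x. c * s * x)"
proof (rule measure_eqI)
  let ?C = "ennreal ((rate * s) ^ n / fact n * exp (- rate * s))"
  let ?U = "{\<omega> \<in> space M. event_count S s \<omega> = n}"
  have pos: "0 < (rate * s) ^ n / fact n * exp (- rate * s)" using rate s by simp
  have [measurable]: "?U \<in> events" by measurable
  fix A assume "A \<in> sets (cond_law_given_count M (random_flight c S \<theta>) (event_count S) n s)"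
  then have [measurable]: "A \<in> sets borel" by (simp add: cond_law_given_count_def)
  have "emeasure (cond_law_given_count M (random_flight c S \<theta>) (event_count S) n s) A =
      emeasure M (?U \<inter> (random_flight c S \<theta> s -` A \<inter> space M)) / emeasure M ?U"
    unfolding cond_law_given_count_def by (subst emeasure_distr) simp_all
  also have "emeasure M (?U \<inter> (random_flight c S \<theta> s -` A \<inter> space M)) =
      (\<integral>\<^sup>+\<omega>. indicator A (random_flight c S \<theta> s \<omega>) * indicator {\<omega>. event_count S s \<omega> = n} \<omega> \<partial>M)"
  proof -
    have "(\<integral>\<^sup>+\<omega>. indicator A (random_flight c S \<theta> s \<omega>) * indicator {\<omega>. event_count S s \<omega> = n} \<omega> \<partial>M) =
        (\<integral>\<^sup>+\<omega>. indicator (?U \<inter> (random_flight c S \<theta> s -` A \<inter> space M)) \<omega> \<partial>M)"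
      by (intro nn_integral_cong) (auto simp: indicator_def)
    also have "\<dots> = emeasure M (?U \<inter> (random_flight c S \<theta> s -` A \<inter> space M))"
      by (rule nn_integral_indicator) measurable
    finally show ?thesis ..
  qed
  also have "\<dots> = ?C * (\<integral>\<^sup>+x. indicator A (c * s * x) \<partial>sym_beta_measure (flight_order m n))"
    by (rule nn_integral_flight_count[OF n s]) simp
  also have "\<dots> / emeasure M ?U = (\<integral>\<^sup>+x. indicator A (c * s * x) \<partial>sym_beta_measure (flight_order m n))"
    unfolding emeasure_count[OF n s] mult.commute[of ?C]
    by (rule ennreal_mult_divide_eq) (use pos rate s in auto)
  also have "\<dots> = (\<integral>\<^sup>+x. indicator A x \<partial>distr (sym_beta_measure (flight_order m n)) borel (\<lambda>x. c * s * x))"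
    by (rule nn_integral_distr[symmetric]) measurable
  finally show "emeasure (cond_law_given_count M (random_flight c S \<theta>) (event_count S) n s) A =
      emeasure (distr (sym_beta_measure (flight_order m n)) borel (\<lambda>x. c * s * x)) A"
    by simp
qed (simp add: cond_law_given_count_def)

text \<open>The conditioning event is null at these times, and \<open>uniform_measure\<close> then
  divides 0 by 0, which is 0. This fixes the kernel on the rest of the real line.\<close>

lemma cond_law_nonpos:
  assumes n: "1 \<le> n" and s: "s \<le> 0"
  shows "cond_law_given_count M (random_flight c S \<theta>) (event_count S) n s = null_measure borel"
proof (rule measure_eqI)
  let ?U = "{\<omega> \<in> space M. event_count S s \<omega> = n}"
  have [measurable]: "?U \<in> events" by measurable
  have "AE \<omega> in M. \<omega> \<notin> ?U"
    using AE_increasing AE_space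
  proof eventually_elim
    fix \<omega> assume inc: "\<forall>k. S k \<omega> < S (Suc k) \<omega>" and \<omega>: "\<omega> \<in> space M"
    have "S 0 \<omega> \<le> S j \<omega>" for j
    proof (rule lift_Suc_mono_le[where f = "\<lambda>k. S k \<omega>"])
      show "S k \<omega> \<le> S (Suc k) \<omega>" for k using inc less_imp_le by blast
    qed simp
    moreover obtain k where "n = Suc k" using n by (cases n) auto
    ultimately have "s < S n \<omega>"
      using inc S_0[OF \<omega>] s by (metis le_less_trans order_trans)
    then show "\<omega> \<notin> ?U" using event_count_eq_iff[of S \<omega> n s] inc n by auto
  qed
  then have U: "emeasure M ?U = 0" by (subst (asm) AE_iff_measurable[of ?U]) auto
  fix A assume "A \<in> sets (cond_law_given_count M (random_flight c S \<theta>) (event_count S) n s)"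
  then have [measurable]: "A \<in> sets borel" by (simp add: cond_law_given_count_def)
  have "emeasure M (?U \<inter> (random_flight c S \<theta> s -` A \<inter> space M)) \<le> emeasure M ?U"
    by (rule emeasure_mono) auto
  then have "emeasure M (?U \<inter> (random_flight c S \<theta> s -` A \<inter> space M)) = 0" using U by simp
  then show "emeasure (cond_law_given_count M (random_flight c S \<theta>) (event_count S) n s) A = emeasure (null_measure borel) A"
    unfolding cond_law_given_count_def by (subst emeasure_distr) simp_all
qed (simp add: cond_law_given_count_def)

end

section \<open>The Bessel process at a gamma time\<close>

abbreviation normal_measure :: "real \<Rightarrow> real measure" where
  "normal_measure \<sigma> \<equiv> density lborel (\<lambda>x. ennreal (normal_density 0 \<sigma> x))"

lemma AE_gamma_measure: "AE u in gamma_measure a t. 0 < u"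
  unfolding gamma_measure_def by (subst AE_density) (auto simp: gamma_density_def)

lemma nn_integral_normal_square:
  fixes g :: "real \<Rightarrow> ennreal"
  assumes [measurable]: "g \<in> borel_measurable borel" and z: "0 < z"
  shows "(\<integral>\<^sup>+x. g (x\<^sup>2) \<partial>normal_measure (sqrt z)) = (\<integral>\<^sup>+u. g u \<partial>gamma_measure (1 / 2) (1 / (2 * z)))"
proof -
  have "(\<integral>\<^sup>+x. g (x\<^sup>2) \<partial>normal_measure (sqrt z)) =
      (\<integral>\<^sup>+x. ennreal (normal_density 0 (sqrt z) x) * g (x\<^sup>2) \<partial>lborel)"
    by (rule nn_integral_density) measurable
  also have "\<dots> = (\<integral>\<^sup>+u. ennreal (1 / 2) * (g ((sqrt u)\<^sup>2) + g ((- sqrt u)\<^sup>2)) \<partial>gamma_measure (1 / 2) (1 / (2 * (sqrt z)\<^sup>2)))"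
    using z by (intro nn_integral_normal_density[where g = "\<lambda>x. g (x\<^sup>2)"]) auto
  also have "\<dots> = (\<integral>\<^sup>+u. g u \<partial>gamma_measure (1 / 2) (1 / (2 * (sqrt z)\<^sup>2)))"
    by (rule nn_integral_cong_AE, use AE_gamma_measure in eventually_elim)
      (simp add: ennreal_half_double[unfolded ennreal_half])
  finally show ?thesis using z by simp
qed

text \<open>Each squared coordinate is gamma of shape 1/2 at a common rate, so the shapes add up by
  \<open>gamma_add\<close>.\<close>

lemma nn_integral_sum_normal_squares:
  fixes g :: "real \<Rightarrow> ennreal"
  assumes "finite J" "J \<noteq> {}" and z: "0 < z" and g: "g \<in> borel_measurable borel"
  shows "(\<integral>\<^sup>+x. g (\<Sum>i\<in>J. (x i)\<^sup>2) \<partial>PiM J (\<lambda>_::nat. normal_measure (sqrt z))) =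
    (\<integral>\<^sup>+u. g u \<partial>gamma_measure (real (card J) / 2) (1 / (2 * z)))"
  using assms(1,2) g
proof (induction J arbitrary: g rule: finite_ne_induct)
  case (singleton i)
  note [measurable] = singleton
  interpret N: prob_space "normal_measure (sqrt z)" using z by (intro prob_space_normal_density) simp
  interpret product_sigma_finite "\<lambda>_::nat. normal_measure (sqrt z)" by standard
  have "(\<integral>\<^sup>+x. g (\<Sum>i\<in>{i}. (x i)\<^sup>2) \<partial>PiM {i} (\<lambda>_. normal_measure (sqrt z))) = (\<integral>\<^sup>+x. g (x\<^sup>2) \<partial>normal_measure (sqrt z))"
    using product_nn_integral_singleton[of "\<lambda>x. g (x\<^sup>2)" i] by simp
  then show ?case using z singleton by (simp add: nn_integral_normal_square)
next
  case (insert i J)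
  note [measurable] = insert.prems
  interpret N: prob_space "normal_measure (sqrt z)" using z by (intro prob_space_normal_density) simp
  interpret product_sigma_finite "\<lambda>_::nat. normal_measure (sqrt z)" by standard
  have card: "0 < card J" using insert.hyps by (simp add: card_gt_0_iff)
  have "(\<integral>\<^sup>+x. g (\<Sum>j\<in>insert i J. (x j)\<^sup>2) \<partial>PiM (insert i J) (\<lambda>_. normal_measure (sqrt z))) =
      (\<integral>\<^sup>+x. \<integral>\<^sup>+y. g (\<Sum>j\<in>insert i J. ((x(i := y)) j)\<^sup>2) \<partial>normal_measure (sqrt z) \<partial>PiM J (\<lambda>_. normal_measure (sqrt z)))"
    using insert.hyps by (intro product_nn_integral_insert) measurable
  also have "\<dots> = (\<integral>\<^sup>+x. (\<integral>\<^sup>+y. g ((\<Sum>j\<in>J. (x j)\<^sup>2) + y\<^sup>2) \<partial>normal_measure (sqrt z)) \<partial>PiM J (\<lambda>_. normal_measure (sqrt z)))"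
  proof -
    have "(\<Sum>j\<in>insert i J. ((x(i := y)) j)\<^sup>2) = (\<Sum>j\<in>J. (x j)\<^sup>2) + y\<^sup>2" for x :: "nat \<Rightarrow> real" and y
    proof -
      have "(\<Sum>j\<in>J. ((x(i := y)) j)\<^sup>2) = (\<Sum>j\<in>J. (x j)\<^sup>2)"
        using insert.hyps by (intro sum.cong) auto
      then show ?thesis using insert.hyps by (simp add: add.commute)
    qed
    then show ?thesis by (simp only:)
  qed
  also have "\<dots> = (\<integral>\<^sup>+u. (\<integral>\<^sup>+y. g (u + y\<^sup>2) \<partial>normal_measure (sqrt z)) \<partial>gamma_measure (real (card J) / 2) (1 / (2 * z)))"
    by (rule insert.IH[where g = "\<lambda>u. \<integral>\<^sup>+y. g (u + y\<^sup>2) \<partial>normal_measure (sqrt z)"]) measurable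
  also have "\<dots> = (\<integral>\<^sup>+u. (\<integral>\<^sup>+w. g (u + w) \<partial>gamma_measure (1 / 2) (1 / (2 * z))) \<partial>gamma_measure (real (card J) / 2) (1 / (2 * z)))"
    by (intro nn_integral_cong nn_integral_normal_square[where g = "\<lambda>w. g (_ + w)"] z) measurable
  also have "\<dots> = (\<integral>\<^sup>+u. g u \<partial>gamma_measure (real (card J) / 2 + 1 / 2) (1 / (2 * z)))"
    using card z by (intro gamma_add) auto
  also have "real (card J) / 2 + 1 / 2 = real (card (insert i J)) / 2"
    using insert.hyps by (simp add: add_divide_distrib)
  finally show ?case .
qed

lemma
  assumes M: "prob_space M" and B: "independent_brownian_motions M d B" and i: "i \<in> {1..d}" and z: "0 < z"
  shows brownian_motion_measurable: "B i z \<in> borel_measurable M"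
    and distr_brownian_motion: "distr M borel (B i z) = normal_measure (sqrt z)"
proof -
  have W: "brownian_motion M (B i)" using B i by (simp add: independent_brownian_motions_def)
  then have meas: "B i s \<in> borel_measurable M" if "0 \<le> s" for s using that by (simp add: brownian_motion_def)
  then show [measurable]: "B i z \<in> borel_measurable M" using z by simp
  have [measurable]: "B i 0 \<in> borel_measurable M" using meas by simp
  have D: "distributed M lborel (\<lambda>\<omega>. B i z \<omega> - B i 0 \<omega>) (\<lambda>x. ennreal (normal_density 0 (sqrt (z - 0)) x))"
    using W z unfolding brownian_motion_def by blast
  have "AE \<omega> in M. B i 0 \<omega> = 0" using W by (simp add: brownian_motion_def)
  then have "distr M borel (B i z) = distr M borel (\<lambda>\<omega>. B i z \<omega> - B i 0 \<omega>)"
    by (intro distr_cong_AE) auto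
  also have "\<dots> = distr M lborel (\<lambda>\<omega>. B i z \<omega> - B i 0 \<omega>)" by (rule distr_cong) simp_all
  also have "\<dots> = normal_measure (sqrt z)" using distributed_distr_eq_density[OF D] by simp
  finally show "distr M borel (B i z) = normal_measure (sqrt z)" .
qed

lemma nn_integral_bessel:
  fixes g :: "real \<Rightarrow> ennreal"
  assumes M: "prob_space M" and B: "independent_brownian_motions M d B" and d: "1 \<le> d" and z: "0 < z"
    and [measurable]: "g \<in> borel_measurable borel"
  shows "(\<integral>\<^sup>+\<omega>. g (bessel_process d B z \<omega>) \<partial>M) = (\<integral>\<^sup>+u. g (sqrt u) \<partial>gamma_measure (real d / 2) (1 / (2 * z)))"
proof -
  interpret prob_space M by fact
  note meas = brownian_motion_measurable[OF M B _ z]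
  have "indep_sets (\<lambda>i. {B i z -` A \<inter> space M | A. A \<in> sets borel}) {1..d}"
  proof (rule indep_sets_mono_sets)
    show "indep_sets (\<lambda>i. generated_events M {B i s | s. 0 \<le> s}) {1..d}"
      using B by (simp add: independent_brownian_motions_def)
    show "{B i z -` A \<inter> space M | A. A \<in> sets borel} \<subseteq> generated_events M {B i s | s. 0 \<le> s}" for i
      using z unfolding generated_events_def by (auto intro!: sigma_sets.Basic) (metis less_imp_le)
  qed
  then have "indep_vars (\<lambda>_. borel) (\<lambda>i. B i z) {1..d}"
    using meas by (simp add: indep_vars_def2)
  moreover have "PiM {1..d} (\<lambda>i. distr M borel (B i z)) = PiM {1..d} (\<lambda>_. normal_measure (sqrt z))"
    by (intro PiM_cong) (auto simp: distr_brownian_motion[OF M B _ z])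
  ultimately have distr: "distr M (PiM {1..d} (\<lambda>_. borel)) (\<lambda>\<omega>. \<lambda>i\<in>{1..d}. B i z \<omega>) = PiM {1..d} (\<lambda>_. normal_measure (sqrt z))"
    using d meas by (subst (asm) indep_vars_iff_distr_eq_PiM') auto
  have [measurable]: "(\<lambda>\<omega>. \<lambda>i\<in>{1..d}. B i z \<omega>) \<in> M \<rightarrow>\<^sub>M PiM {1..d} (\<lambda>_. borel)"
    using meas by (intro measurable_restrict) auto
  have "(\<integral>\<^sup>+\<omega>. g (bessel_process d B z \<omega>) \<partial>M) =
      (\<integral>\<^sup>+\<omega>. g (sqrt (\<Sum>i\<in>{1..d}. ((\<lambda>i\<in>{1..d}. B i z \<omega>) i)\<^sup>2)) \<partial>M)"
    using z by (intro nn_integral_cong) (simp add: bessel_process_def)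
  also have "\<dots> = (\<integral>\<^sup>+x. g (sqrt (\<Sum>i\<in>{1..d}. (x i)\<^sup>2)) \<partial>distr M (PiM {1..d} (\<lambda>_. borel)) (\<lambda>\<omega>. \<lambda>i\<in>{1..d}. B i z \<omega>))"
    by (rule nn_integral_distr[symmetric]) measurable
  also have "\<dots> = (\<integral>\<^sup>+u. g (sqrt u) \<partial>gamma_measure (real (card {1..d}) / 2) (1 / (2 * z)))"
    unfolding distr using d z
    by (intro nn_integral_sum_normal_squares[where g = "\<lambda>u. g (sqrt u)"]) auto
  finally show ?thesis by simp
qed

text \<open>Evaluation at a random time requires joint measurability. The sigma-algebra on outcomes
  is the one generated by the Bessel process itself, since independence of the random time is
  assumed for that one.\<close>

lemma measurable_bessel_process:
  assumes B: "independent_brownian_motions M d B"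
  shows "(\<lambda>(\<omega>, z). bessel_process d B z \<omega>) \<in>
    borel_measurable (gen_sigma M {bessel_process d B s | s. 0 \<le> s} \<Otimes>\<^sub>M borel)"
    (is "_ \<in> borel_measurable (?M \<Otimes>\<^sub>M borel)")
proof -
  \<comment> \<open>Grid points approach z from above: for nonnegative z they stay in the half-line
    on which the paths are continuous, and each grid has countably many values.\<close>
  define z' where "z' k z = real_of_int \<lceil>z * real (Suc k)\<rceil> / real (Suc k)" for k and z :: real
  have lim: "(\<lambda>k. z' k z) \<longlonglongrightarrow> z" for z
  proof (rule real_tendsto_sandwich)
    show "\<forall>\<^sub>F k in sequentially. z \<le> z' k z"
      by (intro always_eventually allI) (simp add: z'_def field_simps del: of_nat_Suc)
    have "z' k z \<le> z + 1 / real (Suc k)" for k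
    proof -
      have "real_of_int \<lceil>z * real (Suc k)\<rceil> \<le> z * real (Suc k) + 1" by linarith
      then show ?thesis by (simp add: z'_def field_simps del: of_nat_Suc)
    qed
    then show "\<forall>\<^sub>F k in sequentially. z' k z \<le> z + 1 / real (Suc k)" by simp
    show "(\<lambda>k. z + 1 / real (Suc k)) \<longlonglongrightarrow> z"
      using tendsto_add[OF tendsto_const LIMSEQ_inverse_real_of_nat, of z] by (simp add: inverse_eq_divide)
  qed simp
  have meas: "(\<lambda>p. bessel_process d B (z' k (snd p)) (fst p)) \<in> borel_measurable (?M \<Otimes>\<^sub>M borel)" for k
  proof -
    have R: "bessel_process d B s \<in> borel_measurable ?M" for s
    proof (cases "0 \<le> s")
      case True
      then show ?thesis by (intro measurable_gen_sigma) auto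
    next
      case False
      then have "bessel_process d B s = (\<lambda>_. 0)" by (auto simp: bessel_process_def)
      then show ?thesis by simp
    qed
    have "(\<lambda>p. bessel_process d B (real_of_int \<lceil>snd p * real (Suc k)\<rceil> / real (Suc k)) (fst p)) \<in> borel_measurable (?M \<Otimes>\<^sub>M borel)"
      by (rule measurable_compose_countable[where f = "\<lambda>i p. bessel_process d B (real_of_int i / real (Suc k)) (fst p)"])
        (rule measurable_compose[OF measurable_fst R], measurable)
    then show ?thesis by (simp add: z'_def)
  qed
  have "(\<lambda>p. bessel_process d B (snd p) (fst p)) \<in> borel_measurable (?M \<Otimes>\<^sub>M borel)"
  proof (rule borel_measurable_LIMSEQ_real[OF _ meas])
    fix p assume "p \<in> space (?M \<Otimes>\<^sub>M (borel :: real measure))"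
    then have \<omega>: "fst p \<in> space M" by (auto simp: space_pair_measure)
    let ?\<omega> = "fst p" and ?z = "snd p"
    show "(\<lambda>k. bessel_process d B (z' k ?z) ?\<omega>) \<longlonglongrightarrow> bessel_process d B ?z ?\<omega>"
    proof (cases "0 \<le> ?z")
      case True
      have "continuous_on {0..} (\<lambda>s. B i s ?\<omega>)" if "i \<in> {1..d}" for i
        using B \<omega> that by (simp add: independent_brownian_motions_def brownian_motion_def)
      then have "continuous_on {0..} (\<lambda>s. sqrt (\<Sum>i = 1..d. (B i s ?\<omega>)\<^sup>2))"
        by (intro continuous_intros) auto
      moreover have pos: "0 \<le> z' k ?z" for k using True
        by (auto simp: z'_def zero_le_ceiling intro!: divide_nonneg_nonneg less_le_trans[OF _ mult_nonneg_nonneg])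
      ultimately have "(\<lambda>k. sqrt (\<Sum>i = 1..d. (B i (z' k ?z) ?\<omega>)\<^sup>2)) \<longlonglongrightarrow> sqrt (\<Sum>i = 1..d. (B i ?z ?\<omega>)\<^sup>2)"
        using True lim[of ?z] by (intro continuous_on_tendsto_compose[where f = "\<lambda>s. sqrt (\<Sum>i = 1..d. (B i s ?\<omega>)\<^sup>2)" and s = "{0..}"]) auto
      then show ?thesis using True pos by (simp add: bessel_process_def)
    next
      case False
      \<comment> \<open>For negative z the grid points are eventually negative too, where the
        process is 0 by convention.\<close>
      then have "\<forall>\<^sub>F k in sequentially. z' k ?z < 0"
        using lim[of ?z] by (intro order_tendstoD(2)) auto
      then have "\<forall>\<^sub>F k in sequentially. bessel_process d B (z' k ?z) ?\<omega> = bessel_process d B ?z ?\<omega>"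
        by eventually_elim (use False in \<open>simp add: bessel_process_def\<close>)
      then show ?thesis by (rule tendsto_eventually)
    qed
  qed
  then show ?thesis by (simp add: case_prod_unfold)
qed

lemma
  fixes g :: "real \<Rightarrow> ennreal"
  assumes M: "prob_space M" and B: "independent_brownian_motions M d B" and d: "1 \<le> d"
    and G: "distributed M lborel G (\<lambda>s. ennreal (gamma_density \<alpha> t s))"
    and ind: "prob_space.indep_set M (generated_events M {bessel_process d B s | s. 0 \<le> s}) (generated_events M {G})"
  shows measurable_subordinated_bessel: "(\<lambda>\<omega>. bessel_process d B (G \<omega>) \<omega>) \<in> borel_measurable M"
    and nn_integral_subordinated_bessel: "g \<in> borel_measurable borel \<Longrightarrow>
      (\<integral>\<^sup>+\<omega>. g (bessel_process d B (G \<omega>) \<omega>) \<partial>M) =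
      (\<integral>\<^sup>+z. \<integral>\<^sup>+u. g (sqrt u) \<partial>gamma_measure (real d / 2) (1 / (2 * z)) \<partial>gamma_measure \<alpha> t)"
proof -
  interpret prob_space M by fact
  let ?N = "gen_sigma M {bessel_process d B s | s. 0 \<le> s}"
  have [measurable]: "(\<lambda>p. bessel_process d B (snd p) (fst p)) \<in> borel_measurable (?N \<Otimes>\<^sub>M borel)"
    using measurable_bessel_process[OF B] by (simp add: case_prod_unfold)
  have [measurable]: "bessel_process d B z \<in> borel_measurable ?N" for z
    using measurable_compose[of "\<lambda>\<omega>. (\<omega>, z)" ?N "?N \<Otimes>\<^sub>M borel" "\<lambda>p. bessel_process d B (snd p) (fst p)" borel]
    by simp
  \<comment> \<open>The identity on outcomes, read as a map into the sigma-algebra of the Bessel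
    process, stands for the whole path.\<close>
  have id: "(\<lambda>\<omega>. \<omega>) \<in> ?N \<rightarrow>\<^sub>M ?N" by simp
  have Gg: "G \<in> gen_sigma M {G} \<rightarrow>\<^sub>M borel" by (rule measurable_gen_sigma) simp
  note [measurable] = indep_generated_measurable1[OF M ind id Gg] indep_generated_measurable2[OF M ind id Gg]
  have "(\<lambda>\<omega>. bessel_process d B (snd (\<omega>, G \<omega>)) (fst (\<omega>, G \<omega>))) \<in> borel_measurable M"
    by (rule measurable_compose[where f = "\<lambda>\<omega>. (\<omega>, G \<omega>)" and N = "?N \<Otimes>\<^sub>M borel"]) measurable
  then show "(\<lambda>\<omega>. bessel_process d B (G \<omega>) \<omega>) \<in> borel_measurable M" by simp
  have distr_G: "distr M borel G = gamma_measure \<alpha> t"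
  proof -
    have "distr M borel G = distr M lborel G" by (rule distr_cong) simp_all
    then show ?thesis using distributed_distr_eq_density[OF G] by (simp add: gamma_measure_def)
  qed
  interpret N: prob_space "distr M ?N (\<lambda>\<omega>. \<omega>)" by (rule prob_space_distr) measurable
  interpret G: prob_space "distr M borel G" by (rule prob_space_distr) measurable
  interpret P: pair_prob_space "distr M ?N (\<lambda>\<omega>. \<omega>)" "distr M borel G" ..
  interpret P': pair_prob_space "distr M borel G" "distr M ?N (\<lambda>\<omega>. \<omega>)" ..
  assume [measurable]: "g \<in> borel_measurable borel"
  have "(\<integral>\<^sup>+\<omega>. g (bessel_process d B (G \<omega>) \<omega>) \<partial>M) =
      (\<integral>\<^sup>+\<omega>. \<integral>\<^sup>+z. g (bessel_process d B z \<omega>) \<partial>distr M borel G \<partial>distr M ?N (\<lambda>\<omega>. \<omega>))"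
    using indep_generated_nn_integral[OF M ind id Gg, where h = "\<lambda>p. g (bessel_process d B (snd p) (fst p))"]
    by simp
  also have "\<dots> = (\<integral>\<^sup>+z. \<integral>\<^sup>+\<omega>. g (bessel_process d B z \<omega>) \<partial>distr M ?N (\<lambda>\<omega>. \<omega>) \<partial>distr M borel G)"
    by (rule P'.Fubini') (subst measurable_pair_swap_iff, simp add: case_prod_unfold)
  also have "\<dots> = (\<integral>\<^sup>+z. \<integral>\<^sup>+\<omega>. g (bessel_process d B z \<omega>) \<partial>M \<partial>distr M borel G)"
  proof (rule nn_integral_cong)
    fix z
    show "(\<integral>\<^sup>+\<omega>. g (bessel_process d B z \<omega>) \<partial>distr M ?N (\<lambda>\<omega>. \<omega>)) = (\<integral>\<^sup>+\<omega>. g (bessel_process d B z \<omega>) \<partial>M)"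
      by (subst nn_integral_distr) simp_all
  qed
  also have "\<dots> = (\<integral>\<^sup>+z. \<integral>\<^sup>+u. g (sqrt u) \<partial>gamma_measure (real d / 2) (1 / (2 * z)) \<partial>gamma_measure \<alpha> t)"
    unfolding distr_G
    by (rule nn_integral_cong_AE, use AE_gamma_measure in eventually_elim) (rule nn_integral_bessel[OF M B d], auto)
  finally show "(\<integral>\<^sup>+\<omega>. g (bessel_process d B (G \<omega>) \<omega>) \<partial>M) =
      (\<integral>\<^sup>+z. \<integral>\<^sup>+u. g (sqrt u) \<partial>gamma_measure (real d / 2) (1 / (2 * z)) \<partial>gamma_measure \<alpha> t)" .
qed

section \<open>Normal mixtures and the Bessel function\<close>

lemma bessel_K_measurable [measurable]: "bessel_K \<mu> \<in> borel_measurable borel"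
  unfolding bessel_K_def[abs_def] set_lebesgue_integral_def by measurable

lemma normal_density_measurable_sd [measurable (raw)]:
  assumes [measurable]: "f \<in> borel_measurable M" "g \<in> borel_measurable M"
  shows "(\<lambda>x. normal_density 0 (f x) (g x)) \<in> borel_measurable M"
  unfolding normal_density_def by measurable

lemma bessel_K_eq:
  "bessel_K \<mu> x = 1 / 2 * (x / 2) powr \<mu> *
    enn2real (\<integral>\<^sup>+z. ennreal (indicator {0<..} z * (exp (- z - x\<^sup>2 / (4 * z)) * z powr (- \<mu> - 1))) \<partial>lborel)"
  unfolding bessel_K_def set_lebesgue_integral_def
  by (subst integral_eq_nn_integral) simp_all

text \<open>Rescaling the gamma variable by t turns the normal mixture into the integral of
  \<open>bessel_K\<close> at order \<open>1 / 2 - \<alpha>\<close>. It stays a nonnegative integral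
  because it can be infinite at y = 0.\<close>

lemma nn_integral_gamma_normal:
  assumes t: "0 < t" and \<alpha>: "0 < \<alpha>" and b: "0 < b"
  shows "(\<integral>\<^sup>+z. ennreal (normal_density 0 (sqrt z) (y / b) / b) \<partial>gamma_measure \<alpha> t) =
    ennreal (sqrt t / (Gamma \<alpha> * sqrt (2 * pi) * b)) *
    (\<integral>\<^sup>+z. ennreal (indicator {0<..} z * (exp (- z - (sqrt (2 * t) * \<bar>y\<bar> / b)\<^sup>2 / (4 * z)) * z powr (\<alpha> - 3 / 2))) \<partial>lborel)"
proof -
  let ?k = "\<lambda>z. indicator {0<..} z * (exp (- z - (sqrt (2 * t) * \<bar>y\<bar> / b)\<^sup>2 / (4 * z)) * z powr (\<alpha> - 3 / 2)) :: real"
  let ?C = "sqrt t / (Gamma \<alpha> * sqrt (2 * pi) * b)"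
  have "ennreal ?C * (\<integral>\<^sup>+z. ennreal (?k z) \<partial>lborel) = ennreal ?C * (ennreal t * (\<integral>\<^sup>+z. ennreal (?k (t * z)) \<partial>lborel))"
    using t by (subst nn_integral_real_affine[where c = t and t = 0]) simp_all
  also have "\<dots> = (\<integral>\<^sup>+z. ennreal ?C * (ennreal t * ennreal (?k (t * z))) \<partial>lborel)"
    by (simp add: nn_integral_cmult)
  also have "\<dots> = (\<integral>\<^sup>+z. ennreal (gamma_density \<alpha> t z) * ennreal (normal_density 0 (sqrt z) (y / b) / b) \<partial>lborel)"
  proof (rule nn_integral_cong)
    fix z :: real
    have "?C * (t * ?k (t * z)) = gamma_density \<alpha> t z * (normal_density 0 (sqrt z) (y / b) / b)"
    proof (cases "0 < z")
      case True
      have e: "exp (- (t * z) - (sqrt (2 * t) * \<bar>y\<bar> / b)\<^sup>2 / (4 * (t * z))) = exp (- t * z) * exp (- (y / b - 0)\<^sup>2 / (2 * (sqrt z)\<^sup>2))"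
        using True t b by (simp add: power_divide power_mult_distrib field_simps flip: exp_add)
      have "sqrt t * t * (t * z) powr (\<alpha> - 3 / 2) = t powr \<alpha> * z powr (\<alpha> - 1) / sqrt z"
      proof -
        have "t powr \<alpha> = t powr (1 / 2 + 1 + (\<alpha> - 3 / 2))" "z powr (\<alpha> - 3 / 2) = z powr ((\<alpha> - 1) - 1 / 2)" by simp_all
        then have "t powr \<alpha> = sqrt t * t * t powr (\<alpha> - 3 / 2)" "z powr (\<alpha> - 3 / 2) = z powr (\<alpha> - 1) / sqrt z"
          using t True by (simp_all only: powr_add powr_diff powr_half_sqrt[OF less_imp_le] powr_one)
        then show ?thesis using t True by (simp add: powr_mult)
      qed
      then have p: "?C * (t * ((t * z) powr (\<alpha> - 3 / 2))) = t powr \<alpha> / Gamma \<alpha> * z powr (\<alpha> - 1) * (1 / sqrt (2 * pi * (sqrt z)\<^sup>2) / b)"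
        using True by (simp add: real_sqrt_mult ac_simps)
      have "?C * (t * ?k (t * z)) = ?C * (t * ((t * z) powr (\<alpha> - 3 / 2))) *
          exp (- (t * z) - (sqrt (2 * t) * \<bar>y\<bar> / b)\<^sup>2 / (4 * (t * z)))"
        using True t by simp
      also have "\<dots> = gamma_density \<alpha> t z * (normal_density 0 (sqrt z) (y / b) / b)"
        unfolding p e using True by (simp add: gamma_density_def normal_density_def)
      finally show ?thesis .
    qed (use t in \<open>simp add: gamma_density_def zero_less_mult_iff\<close>)
    moreover have "0 \<le> ?C" "0 \<le> ?k (t * z)" "0 \<le> gamma_density \<alpha> t z" "0 \<le> normal_density 0 (sqrt z) (y / b) / b"
      using t \<alpha> b Gamma_real_pos[OF \<alpha>] by (simp_all add: gamma_density_nonneg)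
    ultimately show "ennreal ?C * (ennreal t * ennreal (?k (t * z))) =
        ennreal (gamma_density \<alpha> t z) * ennreal (normal_density 0 (sqrt z) (y / b) / b)"
      using t by (simp only: ennreal_mult[symmetric] mult_nonneg_nonneg less_imp_le)
  qed
  also have "\<dots> = (\<integral>\<^sup>+z. ennreal (normal_density 0 (sqrt z) (y / b) / b) \<partial>gamma_measure \<alpha> t)"
    by (rule nn_integral_gamma_measure[symmetric]) (simp add: normal_density_def)
  finally show ?thesis ..
qed

text \<open>Both sides come from one gamma variable s of shape v + 1: a beta factor w cuts its shape
  down to a, another beta factor b cuts it down to 1/2. Which of the two is absorbed first decides
  between the left and the right side.\<close>

lemma sym_beta_gamma_eq_normal_beta:
  fixes g :: "real \<Rightarrow> ennreal"
  assumes a: "0 < a" and v: "a < v + 1" "- 1 / 2 < v" and z: "0 < z" and [measurable]: "g \<in> borel_measurable borel"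
  shows "(\<integral>\<^sup>+u. \<integral>\<^sup>+y. g (sqrt u * y) \<partial>sym_beta_measure v \<partial>gamma_measure a (1 / (2 * z))) =
    (\<integral>\<^sup>+w. \<integral>\<^sup>+x. g (sqrt w * x) \<partial>normal_measure (sqrt z) \<partial>beta_measure a (v + 1 - a))"
proof -
  let ?\<kappa> = "1 / (2 * z)" and ?Q = "beta_measure a (v + 1 - a)" and ?Q' = "beta_measure (1 / 2) (v + 1 / 2)"
  let ?S = "gamma_measure (v + 1) (1 / (2 * z))"
  define h where "h w r = ennreal (1 / 2) * (g (sqrt w * sqrt r) + g (sqrt w * - sqrt r))" for w r
  have [measurable (raw)]: "(\<lambda>x. h (f x) (f' x)) \<in> borel_measurable L"
    if [measurable]: "f \<in> borel_measurable L" "f' \<in> borel_measurable L" for f f' and L :: "'z measure"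
    unfolding h_def by measurable
  have \<kappa>: "0 < ?\<kappa>" using z by simp
  interpret Q: prob_space ?Q using a v by (intro prob_space_beta_measure) auto
  interpret Q': prob_space ?Q' using v by (intro prob_space_beta_measure) auto
  interpret S: prob_space ?S using v \<kappa> by (intro prob_space_gamma_measure) auto
  interpret QS: pair_prob_space ?Q ?S ..
  have "(\<integral>\<^sup>+u. \<integral>\<^sup>+y. g (sqrt u * y) \<partial>sym_beta_measure v \<partial>gamma_measure a ?\<kappa>) =
      (\<integral>\<^sup>+u. \<integral>\<^sup>+b. h u b \<partial>?Q' \<partial>gamma_measure a ?\<kappa>)"
    unfolding h_def using v by (intro nn_integral_cong nn_integral_sym_beta_measure'[where g = "\<lambda>y. g (sqrt _ * y)"]) auto
  also have "\<dots> = (\<integral>\<^sup>+s. \<integral>\<^sup>+w. \<integral>\<^sup>+b. h (s * w) b \<partial>?Q' \<partial>?Q \<partial>gamma_measure (a + (v + 1 - a)) ?\<kappa>)"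
    using a v \<kappa> by (intro gamma_mult_beta[symmetric, where g = "\<lambda>u. \<integral>\<^sup>+b. h u b \<partial>?Q'"]) auto
  \<comment> \<open>The factor s changes sides: sqrt (s w) sqrt b = sqrt w sqrt (s b).\<close>
  also have "\<dots> = (\<integral>\<^sup>+s. \<integral>\<^sup>+w. \<integral>\<^sup>+b. h w (s * b) \<partial>?Q' \<partial>?Q \<partial>?S)"
    by (simp add: h_def real_sqrt_mult ac_simps)
  also have "\<dots> = (\<integral>\<^sup>+w. \<integral>\<^sup>+s. \<integral>\<^sup>+b. h w (s * b) \<partial>?Q' \<partial>?S \<partial>?Q)"
    by (rule QS.Fubini') measurable
  also have "\<dots> = (\<integral>\<^sup>+w. \<integral>\<^sup>+r. h w r \<partial>gamma_measure (1 / 2) ?\<kappa> \<partial>?Q)"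
  proof (rule nn_integral_cong)
    fix w
    show "(\<integral>\<^sup>+s. \<integral>\<^sup>+b. h w (s * b) \<partial>?Q' \<partial>?S) = (\<integral>\<^sup>+r. h w r \<partial>gamma_measure (1 / 2) ?\<kappa>)"
      using gamma_mult_beta[of "1 / 2" "v + 1 / 2" ?\<kappa> "h w"] v \<kappa> by (simp add: add.commute)
  qed
  also have "\<dots> = (\<integral>\<^sup>+w. \<integral>\<^sup>+x. g (sqrt w * x) \<partial>normal_measure (sqrt z) \<partial>?Q)"
  proof (rule nn_integral_cong)
    fix w
    have "(\<integral>\<^sup>+x. g (sqrt w * x) \<partial>normal_measure (sqrt z)) = (\<integral>\<^sup>+x. ennreal (normal_density 0 (sqrt z) x) * g (sqrt w * x) \<partial>lborel)"
      by (rule nn_integral_density) measurable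
    also have "\<dots> = (\<integral>\<^sup>+r. h w r \<partial>gamma_measure (1 / 2) ?\<kappa>)"
      unfolding h_def using nn_integral_normal_density[of "\<lambda>x. g (sqrt w * x)" "sqrt z"] z by simp
    finally show "(\<integral>\<^sup>+r. h w r \<partial>gamma_measure (1 / 2) ?\<kappa>) = (\<integral>\<^sup>+x. g (sqrt w * x) \<partial>normal_measure (sqrt z))" ..
  qed
  finally show ?thesis .
qed

lemma nn_integral_normal_scale:
  fixes g :: "real \<Rightarrow> ennreal"
  assumes b: "0 < b" and [measurable]: "g \<in> borel_measurable borel"
  shows "(\<integral>\<^sup>+x. g (b * x) \<partial>normal_measure \<sigma>) = (\<integral>\<^sup>+y. ennreal (normal_density 0 \<sigma> (y / b) / b) * g y \<partial>lborel)"
proof -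
  have "(\<integral>\<^sup>+y. ennreal (normal_density 0 \<sigma> (y / b) / b) * g y \<partial>lborel) =
      ennreal b * (\<integral>\<^sup>+x. ennreal (normal_density 0 \<sigma> x / b) * g (b * x) \<partial>lborel)"
    using b by (subst nn_integral_real_affine[where c = b and t = 0]) simp_all
  also have "\<dots> = (\<integral>\<^sup>+x. ennreal b * (ennreal (normal_density 0 \<sigma> x / b) * g (b * x)) \<partial>lborel)"
    by (rule nn_integral_cmult[symmetric]) measurable
  also have "\<dots> = (\<integral>\<^sup>+x. ennreal (normal_density 0 \<sigma> x) * g (b * x) \<partial>lborel)"
    using b by (intro nn_integral_cong) (simp add: mult.assoc[symmetric] flip: ennreal_mult')
  also have "\<dots> = (\<integral>\<^sup>+x. g (b * x) \<partial>normal_measure \<sigma>)"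
    by (rule nn_integral_density[symmetric]) measurable
  finally show ?thesis ..
qed

text \<open>Extended-real valued, because the value at y = 0 can be infinite. The gamma variable is
  integrated innermost so that it yields the Bessel factor for each fixed w.\<close>

definition mixture_density :: "real \<Rightarrow> real \<Rightarrow> real \<Rightarrow> real \<Rightarrow> real \<Rightarrow> real \<Rightarrow> ennreal" where
  "mixture_density c t \<alpha> a b y = (\<integral>\<^sup>+w. \<integral>\<^sup>+z. ennreal (normal_density 0 (sqrt z) (y / (c * sqrt w)) / (c * sqrt w))
    \<partial>gamma_measure \<alpha> t \<partial>beta_measure a b)"

lemma mixture_density_measurable [measurable]:
  assumes "0 < t" "0 < \<alpha>" "0 < a" "0 < b"
  shows "mixture_density c t \<alpha> a b \<in> borel_measurable borel"
proof -
  interpret Q: prob_space "beta_measure a b" using assms by (intro prob_space_beta_measure) auto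
  interpret Z: prob_space "gamma_measure \<alpha> t" using assms by (intro prob_space_gamma_measure) auto
  show ?thesis
    unfolding mixture_density_def[abs_def] by measurable
qed

lemma nn_integral_mixture:
  fixes g :: "real \<Rightarrow> ennreal"
  assumes c: "0 < c" and t: "0 < t" and \<alpha>: "0 < \<alpha>" and a: "0 < a" and b: "0 < b" and [measurable]: "g \<in> borel_measurable borel"
  shows "(\<integral>\<^sup>+z. \<integral>\<^sup>+w. \<integral>\<^sup>+x. g (c * (sqrt w * x)) \<partial>normal_measure (sqrt z) \<partial>beta_measure a b \<partial>gamma_measure \<alpha> t) =
    (\<integral>\<^sup>+y. mixture_density c t \<alpha> a b y * g y \<partial>lborel)"
proof -
  let ?Q = "beta_measure a b" and ?Z = "gamma_measure \<alpha> t"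
  let ?k = "\<lambda>z w y. ennreal (normal_density 0 (sqrt z) (y / (c * sqrt w)) / (c * sqrt w))"
  interpret Q: prob_space ?Q using a b by (intro prob_space_beta_measure) auto
  interpret Z: prob_space ?Z using \<alpha> t by (intro prob_space_gamma_measure) auto
  interpret QZ: pair_prob_space ?Q ?Z ..
  interpret LZ: pair_sigma_finite "lborel :: real measure" ?Z ..
  interpret LQ: pair_sigma_finite "lborel :: real measure" ?Q ..
  have "(\<integral>\<^sup>+z. \<integral>\<^sup>+w. \<integral>\<^sup>+x. g (c * (sqrt w * x)) \<partial>normal_measure (sqrt z) \<partial>?Q \<partial>?Z) =
      (\<integral>\<^sup>+z. \<integral>\<^sup>+w. \<integral>\<^sup>+y. ?k z w y * g y \<partial>lborel \<partial>?Q \<partial>?Z)"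
  proof (rule nn_integral_cong, rule nn_integral_cong_AE)
    fix z
    show "AE w in ?Q. (\<integral>\<^sup>+x. g (c * (sqrt w * x)) \<partial>normal_measure (sqrt z)) = (\<integral>\<^sup>+y. ?k z w y * g y \<partial>lborel)"
      using AE_beta_measure
    proof eventually_elim
      case (elim w)
      with c have "0 < c * sqrt w" by simp
      from nn_integral_normal_scale[OF this, of g "sqrt z"] show ?case by (simp add: mult.assoc)
    qed
  qed
  also have "\<dots> = (\<integral>\<^sup>+z. \<integral>\<^sup>+y. \<integral>\<^sup>+w. ?k z w y * g y \<partial>?Q \<partial>lborel \<partial>?Z)"
    by (rule nn_integral_cong, rule LQ.Fubini') measurable
  also have "\<dots> = (\<integral>\<^sup>+y. \<integral>\<^sup>+z. \<integral>\<^sup>+w. ?k z w y * g y \<partial>?Q \<partial>?Z \<partial>lborel)"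
    by (rule LZ.Fubini') measurable
  also have "\<dots> = (\<integral>\<^sup>+y. \<integral>\<^sup>+w. \<integral>\<^sup>+z. ?k z w y * g y \<partial>?Z \<partial>?Q \<partial>lborel)"
    by (rule nn_integral_cong, rule QZ.Fubini') measurable
  also have "\<dots> = (\<integral>\<^sup>+y. mixture_density c t \<alpha> a b y * g y \<partial>lborel)"
    unfolding mixture_density_def by (simp add: nn_integral_multc)
  finally show ?thesis .
qed

text \<open>Testing the mixture with the constant 1 shows total mass 1.\<close>

lemma AE_mixture_density_finite:
  assumes "0 < c" "0 < t" "0 < \<alpha>" "0 < a" "0 < b"
  shows "AE y in lborel. mixture_density c t \<alpha> a b y \<noteq> \<infinity>"
proof -
  interpret Q: prob_space "beta_measure a b" using assms by (intro prob_space_beta_measure) auto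
  interpret Z: prob_space "gamma_measure \<alpha> t" using assms by (intro prob_space_gamma_measure) auto
  note [measurable] = mixture_density_measurable[OF assms(2-5)]
  have "(\<integral>\<^sup>+y. mixture_density c t \<alpha> a b y * 1 \<partial>lborel) =
      (\<integral>\<^sup>+z. \<integral>\<^sup>+w. \<integral>\<^sup>+x. 1 \<partial>normal_measure (sqrt z) \<partial>beta_measure a b \<partial>gamma_measure \<alpha> t)"
    using assms by (intro nn_integral_mixture[symmetric]) auto
  also have "\<dots> = (\<integral>\<^sup>+z. 1 \<partial>gamma_measure \<alpha> t)"
  proof (rule nn_integral_cong_AE, use AE_gamma_measure in eventually_elim)
    fix z :: real assume "0 < z"
    then interpret N: prob_space "normal_measure (sqrt z)" by (intro prob_space_normal_density) simp
    show "(\<integral>\<^sup>+w. \<integral>\<^sup>+x. 1 \<partial>normal_measure (sqrt z) \<partial>beta_measure a b) = 1"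
      using N.emeasure_space_1 Q.emeasure_space_1 by simp
  qed
  also have "\<dots> = 1" using Z.emeasure_space_1 by simp
  finally show ?thesis by (intro nn_integral_PInf_AE) auto
qed

text \<open>The nonnegative integral becomes the Bochner integral of the formula wherever it is
  finite. The point y = 0 is left out because \<open>0 powr _\<close> is 0, so that the two powers
  below would not cancel there.\<close>

lemma AE_mixture_density_eq:
  assumes c: "0 < c" and t: "0 < t" and \<alpha>: "0 < \<alpha>" and a: "0 < a" and b: "0 < b"
  shows "AE y in lborel. mixture_density c t \<alpha> a b y = ennreal (1 / (Gamma \<alpha> * Beta a b) *
      (LBINT w:{0<..<1}. w powr (a - 1) * (1 - w) powr (b - 1) * (sqrt (2 * t) / (sqrt (pi * w) * c)) *
         (sqrt t * \<bar>y\<bar> / (c * sqrt (2 * w))) powr (\<alpha> - 1 / 2) *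
         bessel_K (- \<alpha> + 1 / 2) (sqrt (2 * t) * \<bar>y\<bar> / (c * sqrt w))))"
  using AE_mixture_density_finite[OF assms] AE_lborel_singleton[of 0]
proof eventually_elim
  fix y :: real assume fin: "mixture_density c t \<alpha> a b y \<noteq> \<infinity>" and y: "y \<noteq> 0"
  let ?X = "\<lambda>w. sqrt (2 * t) * \<bar>y\<bar> / (c * sqrt w)"
  define J where "J w = (\<integral>\<^sup>+z. ennreal (indicator {0<..} z * (exp (- z - (?X w)\<^sup>2 / (4 * z)) * z powr (\<alpha> - 3 / 2))) \<partial>lborel)" for w
  define C where "C w = sqrt t / (Gamma \<alpha> * sqrt (2 * pi) * (c * sqrt w))" for w
  define h where "h w = w powr (a - 1) * (1 - w) powr (b - 1) * (sqrt (2 * t) / (sqrt (pi * w) * c)) *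
         (sqrt t * \<bar>y\<bar> / (c * sqrt (2 * w))) powr (\<alpha> - 1 / 2) * bessel_K (- \<alpha> + 1 / 2) (?X w)" for w
  have J[measurable]: "J \<in> borel_measurable borel" unfolding J_def[abs_def] by measurable
  have C[measurable]: "C \<in> borel_measurable borel" unfolding C_def[abs_def] by measurable
  have h[measurable]: "h \<in> borel_measurable borel" unfolding h_def[abs_def] by measurable
  have \<Gamma>: "0 < Gamma \<alpha>" "0 < Beta a b" using \<alpha> a b by (simp_all add: Beta_pos)
  have md: "mixture_density c t \<alpha> a b y = (\<integral>\<^sup>+w. ennreal (beta_density a b w) * (ennreal (C w) * J w) \<partial>lborel)"
  proof -
    have "mixture_density c t \<alpha> a b y = (\<integral>\<^sup>+w. ennreal (C w) * J w \<partial>beta_measure a b)"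
      unfolding mixture_density_def
    proof (rule nn_integral_cong_AE, use AE_beta_measure in eventually_elim)
      fix w :: real assume "0 < w \<and> w < 1"
      then have "0 < c * sqrt w" using c by simp
      from nn_integral_gamma_normal[OF t \<alpha> this]
      show "(\<integral>\<^sup>+z. ennreal (normal_density 0 (sqrt z) (y / (c * sqrt w)) / (c * sqrt w)) \<partial>gamma_measure \<alpha> t) = ennreal (C w) * J w"
        unfolding C_def J_def .
    qed
    also have "\<dots> = (\<integral>\<^sup>+w. ennreal (beta_density a b w) * (ennreal (C w) * J w) \<partial>lborel)"
      by (rule nn_integral_beta_measure) measurable
    finally show ?thesis .
  qed
  \<comment> \<open>Finiteness of the total gives finiteness for almost every w; since the other
    factors are positive on (0, 1), the Bessel integral is finite there without any
    estimate.\<close>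
  have "AE w in lborel. ennreal (beta_density a b w) * (ennreal (C w) * J w) \<noteq> \<infinity>"
    using fin unfolding md by (intro nn_integral_PInf_AE) auto
  then have eq: "AE w in lborel. ennreal (beta_density a b w) * (ennreal (C w) * J w) =
      ennreal (1 / (Gamma \<alpha> * Beta a b) * (indicator {0<..<1} w * h w)) \<and> 0 \<le> indicator {0<..<1} w * h w"
  proof eventually_elim
    fix w assume fin_w: "ennreal (beta_density a b w) * (ennreal (C w) * J w) \<noteq> \<infinity>"
    show "ennreal (beta_density a b w) * (ennreal (C w) * J w) =
      ennreal (1 / (Gamma \<alpha> * Beta a b) * (indicator {0<..<1} w * h w)) \<and> 0 \<le> indicator {0<..<1} w * h w"
    proof (cases "0 < w \<and> w < 1")
      case True
      have Cpos: "0 < C w" using True c t \<Gamma> by (simp add: C_def)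
      have bpos: "0 < beta_density a b w" using True \<Gamma> by (simp add: beta_density_def)
      have "J w \<noteq> \<infinity>"
        using fin_w Cpos bpos by (auto simp: ennreal_mult_eq_top_iff)
      then obtain j where j: "J w = ennreal j" "0 \<le> j" by (cases "J w") auto
      have X: "0 < ?X w" using True c t y by simp
      have sqrt2: "sqrt (2 * t) / 2 = sqrt t / sqrt 2"
        by (simp add: real_sqrt_mult real_div_sqrt field_simps)
      \<comment> \<open>The base of the power in the formula is half the argument of the Bessel
        function, so it meets the factor \<open>(x / 2) powr \<mu>\<close> of
        \<open>bessel_K\<close> with the opposite exponent.\<close>
      have half: "sqrt t * \<bar>y\<bar> / (c * sqrt (2 * w)) = ?X w / 2"
      proof -
        have "?X w / 2 = sqrt t / sqrt 2 * \<bar>y\<bar> / (c * sqrt w)" using sqrt2 by (metis times_divide_eq_left divide_divide_eq_left mult.commute)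
        then show ?thesis by (simp add: real_sqrt_mult ac_simps)
      qed
      have K: "bessel_K (- \<alpha> + 1 / 2) (?X w) = 1 / 2 * (?X w / 2) powr (- \<alpha> + 1 / 2) * j"
      proof -
        have "- (- \<alpha> + 1 / 2) - 1 = \<alpha> - 3 / 2" by simp
        then show ?thesis using j unfolding bessel_K_eq J_def by simp
      qed
      have P: "(?X w / 2) powr (\<alpha> - 1 / 2) * (?X w / 2) powr (- \<alpha> + 1 / 2) = 1"
      proof -
        have "x powr (\<alpha> - 1 / 2) * x powr (- \<alpha> + 1 / 2) = 1" if "0 < x" for x :: real
          using that by (simp flip: powr_add)
        then show ?thesis using X half_gt_zero by blast
      qed
      have "h w = w powr (a - 1) * (1 - w) powr (b - 1) * (sqrt (2 * t) / (sqrt (pi * w) * c)) * (1 / 2 * j) *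
          ((?X w / 2) powr (\<alpha> - 1 / 2) * (?X w / 2) powr (- \<alpha> + 1 / 2))"
        unfolding h_def half K by (simp only: ac_simps)
      then have h_eq: "h w = w powr (a - 1) * (1 - w) powr (b - 1) * (sqrt (2 * t) / (sqrt (pi * w) * c)) * (1 / 2 * j)"
        unfolding P by simp
      have s: "sqrt (2 * t) / (sqrt (pi * w) * c) * (1 / 2) = sqrt t / (sqrt (2 * pi) * (c * sqrt w))"
      proof -
        have "sqrt (2 * t) / (sqrt (pi * w) * c) * (1 / 2) = (sqrt (2 * t) / 2) / (sqrt (pi * w) * c)" by simp
        then show ?thesis unfolding sqrt2 by (simp add: real_sqrt_mult ac_simps)
      qed
      have "beta_density a b w * (C w * j) = 1 / (Gamma \<alpha> * Beta a b) * (w powr (a - 1) * (1 - w) powr (b - 1) *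
          (sqrt t / (sqrt (2 * pi) * (c * sqrt w))) * j)"
        using True by (simp add: beta_density_def C_def ac_simps)
      also have "\<dots> = 1 / (Gamma \<alpha> * Beta a b) * h w"
        unfolding h_eq s[symmetric] by (simp only: ac_simps)
      finally have "beta_density a b w * (C w * j) = 1 / (Gamma \<alpha> * Beta a b) * h w" .
      moreover have "0 \<le> h w" unfolding h_eq using True t c j(2) by simp
      ultimately show ?thesis
        using True Cpos bpos j by (simp flip: ennreal_mult)
    qed (auto simp: beta_density_def indicator_def)
  qed
  let ?f = "\<lambda>w. 1 / (Gamma \<alpha> * Beta a b) * (indicator {0<..<1} w * h w)"
  have m1: "mixture_density c t \<alpha> a b y = (\<integral>\<^sup>+w. ennreal (?f w) \<partial>lborel)"
    unfolding md using eq by (intro nn_integral_cong_AE) (auto elim!: eventually_mono)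
  have m2: "(\<integral>w. ?f w \<partial>lborel) = enn2real (\<integral>\<^sup>+w. ennreal (?f w) \<partial>lborel)"
  proof (rule integral_eq_nn_integral)
    show "AE w in lborel. 0 \<le> ?f w"
      using eq
    proof eventually_elim
      case (elim w)
      then have nonneg: "0 \<le> indicator {0<..<1} w * h w" by blast
      show ?case by (rule mult_nonneg_nonneg[OF _ nonneg]) (use \<Gamma> in simp)
    qed
  qed measurable
  have m3: "(\<integral>w. ?f w \<partial>lborel) = 1 / (Gamma \<alpha> * Beta a b) * (LBINT w:{0<..<1}. h w)"
    unfolding set_lebesgue_integral_def by simp
  have "mixture_density c t \<alpha> a b y = ennreal (enn2real (mixture_density c t \<alpha> a b y))"
    using fin by (simp add: less_top)
  then have "mixture_density c t \<alpha> a b y = ennreal (1 / (Gamma \<alpha> * Beta a b) * (LBINT w:{0<..<1}. h w))"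
    by (simp only: m2[folded m1, symmetric] m3)
  then show "mixture_density c t \<alpha> a b y = ennreal (1 / (Gamma \<alpha> * Beta a b) *
      (LBINT w:{0<..<1}. w powr (a - 1) * (1 - w) powr (b - 1) * (sqrt (2 * t) / (sqrt (pi * w) * c)) *
         (sqrt t * \<bar>y\<bar> / (c * sqrt (2 * w))) powr (\<alpha> - 1 / 2) *
         bessel_K (- \<alpha> + 1 / 2) (?X w)))"
    unfolding h_def .
qed

section \<open>The conditional law as a kernel in time, and the final identity\<close>

lemma (in flight) measurable_cond_law:
  assumes n: "1 \<le> n"
  shows "cond_law_given_count M (random_flight c S \<theta>) (event_count S) n \<in> borel \<rightarrow>\<^sub>M subprob_algebra borel"
    and "A \<in> sets borel \<Longrightarrow> emeasure (cond_law_given_count M (random_flight c S \<theta>) (event_count S) n s) A =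
      (if 0 < s then \<integral>\<^sup>+x. indicator A (c * s * x) \<partial>sym_beta_measure (flight_order m n) else 0)"
proof -
  let ?K = "cond_law_given_count M (random_flight c S \<theta>) (event_count S) n"
  interpret L: real_distribution "sym_beta_measure (flight_order m n)" by (rule real_distribution_sym_beta)
  \<comment> \<open>A closed form at every real s, from which measurability in s is read off
    below.\<close>
  show K: "emeasure (?K s) A = (if 0 < s then \<integral>\<^sup>+x. indicator A (c * s * x) \<partial>sym_beta_measure (flight_order m n) else 0)"
    if [measurable]: "A \<in> sets borel" for s A
  proof (cases "0 < s")
    case True
    have "emeasure (?K s) A = (\<integral>\<^sup>+x. indicator A x \<partial>?K s)"
      by (simp add: cond_law_given_count_def)
    also have "\<dots> = (\<integral>\<^sup>+x. indicator A (c * s * x) \<partial>sym_beta_measure (flight_order m n))"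
      unfolding cond_law_pos[OF n True] by (rule nn_integral_distr) measurable
    finally show ?thesis using True by simp
  qed (simp add: cond_law_nonpos[OF n])
  show "?K \<in> borel \<rightarrow>\<^sub>M subprob_algebra borel"
  proof (rule measurable_subprob_algebra)
    show "subprob_space (?K s)" for s
    proof (cases "0 < s")
      case True
      show ?thesis
        unfolding cond_law_pos[OF n True]
        by (intro prob_space_imp_subprob_space L.prob_space_distr) measurable
    next
      case False
      then show ?thesis by (simp add: cond_law_nonpos[OF n] subprob_space_null_measure)
    qed
    show "sets (?K s) = sets borel" for s by (simp add: cond_law_given_count_def)
    show "(\<lambda>s. emeasure (?K s) A) \<in> borel_measurable borel" if [measurable]: "A \<in> sets borel" for A
      unfolding K[OF that] by measurable
  qed
qed

theorem theorem4p8: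
  fixes M :: "'a measure"
    and c rate t \<alpha> v :: real
    and d m n :: nat
    and S \<theta> :: "nat \<Rightarrow> 'a \<Rightarrow> real"
    and B :: "nat \<Rightarrow> real \<Rightarrow> 'a \<Rightarrow> real"
    and G :: "'a \<Rightarrow> real"
    and N :: "real \<Rightarrow> 'a \<Rightarrow> nat"
    and X R :: "real \<Rightarrow> 'a \<Rightarrow> real"
  assumes "prob_space M"
    and "0 < c" and "0 < rate" and "0 < t" and "0 < \<alpha>"
    and "1 \<le> d" and "m \<in> {0, 1}" and "1 \<le> n"
    and "v = flight_order m n" and "v > real d / 2 - 1"
    and "poisson_event_times M rate S"
    and "iid_angles M m \<theta>"
    and "prob_space.indep_set M (generated_events M (range S)) (generated_events M (\<theta> ` {1..}))"
    and "N = event_count S"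
    and "X = random_flight c S \<theta>"
    and "independent_brownian_motions M d B"
    and "R = bessel_process d B"
    and "distributed M lborel G (\<lambda>s. ennreal (gamma_density \<alpha> t s))"
    and "prob_space.indep_set M (generated_events M {R s | s. 0 \<le> s}) (generated_events M {G})"
    and "prob_space.indep_set M (generated_events M ({R s | s. 0 \<le> s} \<union> {G}))
           (generated_events M ({X s | s. 0 \<le> s} \<union> {(\<lambda>\<omega>. real (N s \<omega>)) | s. 0 \<le> s}))"
  shows "fixed_count_law M X N n (\<lambda>\<omega>. R (G \<omega>) \<omega>) =
    density lborel (\<lambda>x. ennreal (
      1 / (Gamma \<alpha> * Beta (real d / 2) (v - real d / 2 + 1)) *
      (LBINT w:{0<..<1}.
         w powr (real d / 2 - 1) * (1 - w) powr (v - real d / 2) *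
         (sqrt (2 * t) / (sqrt (pi * w) * c)) *
         (sqrt t * \<bar>x\<bar> / (c * sqrt (2 * w))) powr (\<alpha> - 1 / 2) *
         bessel_K (- \<alpha> + 1 / 2) (sqrt (2 * t) * \<bar>x\<bar> / (c * sqrt w)))))"
proof -
  interpret flight M c rate m S \<theta>
    by (rule flight.intro) fact+
  note n = \<open>1 \<le> n\<close> and c = \<open>0 < c\<close> and t = \<open>0 < t\<close> and \<alpha> = \<open>0 < \<alpha>\<close>
  let ?a = "real d / 2" and ?b = "v - real d / 2 + 1"
  let ?T = "\<lambda>\<omega>. R (G \<omega>) \<omega>" and ?K = "cond_law_given_count M X N n" and ?Y = "sym_beta_measure v"
  have a: "0 < ?a" and b: "0 < ?b" using assms by auto
  have v: "- 1 / 2 < v" using assms by (simp add: flight_order_gt)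
  have b': "v + 1 - ?a = ?b" by simp
  interpret Y: real_distribution ?Y using \<open>v = flight_order m n\<close> real_distribution_sym_beta by simp
  note [measurable] = mixture_density_measurable[OF t \<alpha> a b]
  have ind: "indep_set (generated_events M {bessel_process d B s | s. 0 \<le> s}) (generated_events M {G})"
    using assms by simp
  have T[measurable]: "?T \<in> borel_measurable M"
    unfolding \<open>R = bessel_process d B\<close>
    by (rule measurable_subordinated_bessel[OF prob assms(16) assms(6) assms(18) ind])
  have K: "?K \<in> borel \<rightarrow>\<^sub>M subprob_algebra borel"
    using measurable_cond_law(1)[OF n] assms by simp
  have law: "fixed_count_law M X N n ?T = density lborel (mixture_density c t \<alpha> ?a ?b)"
  proof (rule measure_eqI)
    show "sets (fixed_count_law M X N n ?T) = sets (density lborel (mixture_density c t \<alpha> ?a ?b))"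
      unfolding fixed_count_law_def using K by (subst sets_bind[where N = borel]) (auto simp: sets_kernel)
    fix A assume "A \<in> sets (fixed_count_law M X N n ?T)"
    then have A[measurable]: "A \<in> sets borel"
      unfolding fixed_count_law_def using K by (subst (asm) sets_bind[where N = borel]) (auto simp: sets_kernel)
    \<comment> \<open>The kernel evaluated at A, as an explicit measurable function of time that can
      be integrated against the law of the random time.\<close>
    define \<Psi> where "\<Psi> s = (if 0 < s then \<integral>\<^sup>+x. indicator A (c * s * x) \<partial>?Y else 0)" for s
    have [measurable]: "\<Psi> \<in> borel_measurable borel" unfolding \<Psi>_def[abs_def] by measurable
    have "emeasure (fixed_count_law M X N n ?T) A = (\<integral>\<^sup>+s. emeasure (?K s) A \<partial>distr M borel ?T)"
      unfolding fixed_count_law_def using K by (intro emeasure_bind[where N = borel]) auto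
    also have "\<dots> = (\<integral>\<^sup>+s. \<Psi> s \<partial>distr M borel ?T)"
      by (simp only: \<Psi>_def measurable_cond_law(2)[OF n A, folded assms(9) assms(14) assms(15)])
    also have "\<dots> = (\<integral>\<^sup>+\<omega>. \<Psi> (?T \<omega>) \<partial>M)"
      by (rule nn_integral_distr) measurable
    also have "\<dots> = (\<integral>\<^sup>+z. \<integral>\<^sup>+u. \<Psi> (sqrt u) \<partial>gamma_measure ?a (1 / (2 * z)) \<partial>gamma_measure \<alpha> t)"
      unfolding \<open>R = bessel_process d B\<close>
      by (rule nn_integral_subordinated_bessel[OF prob assms(16) assms(6) assms(18) ind]) measurable
    also have "\<dots> = (\<integral>\<^sup>+z. \<integral>\<^sup>+w. \<integral>\<^sup>+x. indicator A (c * (sqrt w * x)) \<partial>normal_measure (sqrt z) \<partial>beta_measure ?a ?b \<partial>gamma_measure \<alpha> t)"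
    proof (rule nn_integral_cong_AE, use AE_gamma_measure in eventually_elim)
      \<comment> \<open>Positivity of z makes 1 / (2 * z) a legitimate rate, and u > 0 almost surely
        selects the first branch of \<Psi>.\<close>
      fix z :: real assume z: "0 < z"
      have "(\<integral>\<^sup>+u. \<Psi> (sqrt u) \<partial>gamma_measure ?a (1 / (2 * z))) =
          (\<integral>\<^sup>+u. \<integral>\<^sup>+y. indicator A (c * (sqrt u * y)) \<partial>?Y \<partial>gamma_measure ?a (1 / (2 * z)))"
        by (rule nn_integral_cong_AE, use AE_gamma_measure in eventually_elim) (simp add: \<Psi>_def mult.assoc)
      also have "\<dots> = (\<integral>\<^sup>+w. \<integral>\<^sup>+x. indicator A (c * (sqrt w * x)) \<partial>normal_measure (sqrt z) \<partial>beta_measure ?a ?b)"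
        unfolding b'[symmetric] using a b v z
        by (intro sym_beta_gamma_eq_normal_beta[where g = "\<lambda>x. indicator A (c * x)"]) auto
      finally show "(\<integral>\<^sup>+u. \<Psi> (sqrt u) \<partial>gamma_measure ?a (1 / (2 * z))) =
          (\<integral>\<^sup>+w. \<integral>\<^sup>+x. indicator A (c * (sqrt w * x)) \<partial>normal_measure (sqrt z) \<partial>beta_measure ?a ?b)" .
    qed
    also have "\<dots> = (\<integral>\<^sup>+y. mixture_density c t \<alpha> ?a ?b y * indicator A y \<partial>lborel)"
      by (rule nn_integral_mixture[OF c t \<alpha> a b]) measurable
    also have "\<dots> = emeasure (density lborel (mixture_density c t \<alpha> ?a ?b)) A"
      by (rule emeasure_density[symmetric]) measurable
    finally show "emeasure (fixed_count_law M X N n ?T) A = emeasure (density lborel (mixture_density c t \<alpha> ?a ?b)) A" .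
  qed
  have b1: "?b - 1 = v - real d / 2" by simp
  \<comment> \<open>Densities that agree almost everywhere give the same measure, so y = 0 and the
    infinite values are harmless.\<close>
  show ?thesis
    unfolding law
    by (rule density_cong[OF _ _ AE_mixture_density_eq[OF c t \<alpha> a b, unfolded b1]])
      (measurable, unfold set_lebesgue_integral_def, measurable)
qed

end
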